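(* Let $\{F_n\}_{n\ge1}$ be a sequence of non-commutative random variables in the second Wigner chaos such that $\varphi(F_n^2)=1$ for all $n\ge1$, and let $F_\infty$ have the normalized tetilla law. Then, as $n\to\infty$, the following assertions are equivalent: (I) $d_{W_2}(F_n,F_\infty)\to0$; (II) $F_n\to F_\infty$ in distribution; (III) (1) $\varphi(F_n^4)\to 5/2$, and (2) $\varphi(F_n^{2r})\to\varphi(F_\infty^{2r})$ for some integer $r\ge3$.
   Context: Let $(\mathcal A,\varphi)$ be a free (non-commutative) probability space: $\mathcal A$ a von Neumann algebra with faithful, positive, weakly continuous, unital trace $\varphi$. Let $S=(S(t))_{t\ge0}$ be a free Brownian motion on it. The second Wigner chaos $\mathscr H_2^S$ is the set of $I_2^S(f)$, $f\in L^2(\mathbb R_+^2)$ real and symmetric, where $I_2^S$ is the Wigner double integral with respect to $S$. Equivalently, its elements are the $F=\sum_{z\in\mathbb Z}\lambda_z(S_z^2-1)$ with $(S_z)_{z\in\mathbb Z}$ freely independent centered semicircular variables of unit variance, $\lambda_z$ real, $\sum_z\lambda_z^2=\varphi(F^2)<\infty$, the series converging in $L^2(\mathcal A,\varphi)$. The normalized tetilla law is the law of $F_\infty=(S_1S_2+S_2S_1)/\sqrt2\overset{law}{=}(S_1^2-S_2^2)/\sqrt2$ with $S_1,S_2$ freely independent centered semicircular of unit variance. The law of a self-adjoint non-commutative random variable $F$ is the probability measure $Q$ on $\mathbb R$ with $\varphi(F^n)=\int x^nQ(dx)$ for all $n$; convergence in distribution means weak convergence of the laws. $d_{W_2}$ is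 the Wasserstein-2 distance between the laws: $d_{W_2}(Q_1,Q_2)=\inf\mathbb E\big((X_1-X_2)^2\big)^{1/2}$ over all pairs of real random variables on a common classical probability space with marginals $Q_1,Q_2$. *)

theory Defs
  imports "HOL-Probability.Probability"
begin

section \<open>Bounded operators on a complex Hilbert space\<close>

class scaleC =
  fixes scaleC :: "complex \<Rightarrow> 'a \<Rightarrow> 'a"  (infixr "*\<^sub>C" 75)

text \<open>The inner product is linear in its first argument. Completeness comes from \<^class>\<open>banach\<close>.\<close>

class complex_hilbert_space = banach + scaleC +
  fixes cinner :: "'a \<Rightarrow> 'a \<Rightarrow> complex"
  assumes scaleC_of_real: "complex_of_real r *\<^sub>C x = r *\<^sub>R x"
    and scaleC_scaleC: "a *\<^sub>C b *\<^sub>C x = (a * b) *\<^sub>C x"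
    and scaleC_add_left: "(a + b) *\<^sub>C x = a *\<^sub>C x + b *\<^sub>C x"
    and scaleC_add_right: "a *\<^sub>C (x + y) = a *\<^sub>C x + a *\<^sub>C y"
    and cinner_commute: "cinner x y = cnj (cinner y x)"
    and cinner_add_left: "cinner (x + y) z = cinner x z + cinner y z"
    and cinner_scaleC_left: "cinner (a *\<^sub>C x) y = a * cinner x y"
    and norm_eq_sqrt_cinner: "norm x = sqrt (Re (cinner x x))"

lemma scaleC_zero_right: "a *\<^sub>C (0 :: 'a :: complex_hilbert_space) = 0"
  using scaleC_add_right[of a 0 "0 :: 'a"] by simp

lemma scaleC_minus_right: "a *\<^sub>C (- x) = - (a *\<^sub>C (x :: 'a :: complex_hilbert_space))"
  using scaleC_add_right[of a x "- x"] by (simp add: scaleC_zero_right eq_neg_iff_add_eq_0 add.commute)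

lemma scaleC_diff_right: "a *\<^sub>C (x - y) = a *\<^sub>C x - a *\<^sub>C (y :: 'a :: complex_hilbert_space)"
  using scaleC_add_right[of a x "- y"] by (simp add: scaleC_minus_right)

lemma cinner_add_right:
  "cinner x (y + z) = cinner x y + cinner (x :: 'a :: complex_hilbert_space) z"
  by (metis cinner_add_left cinner_commute complex_cnj_add)

lemma cinner_scaleC_right:
  "cinner x (a *\<^sub>C y) = cnj a * cinner (x :: 'a :: complex_hilbert_space) y"
  by (metis cinner_commute cinner_scaleC_left complex_cnj_mult)

lemma norm_scaleC: "norm (a *\<^sub>C (x :: 'a :: complex_hilbert_space)) = cmod a * norm x"
proof -
  have "cinner (a *\<^sub>C x) (a *\<^sub>C x) = (a * cnj a) * cinner x x"
    by (simp add: cinner_scaleC_left cinner_scaleC_right)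
  also have "a * cnj a = complex_of_real ((cmod a)\<^sup>2)"
    by (rule complex_norm_square[symmetric])
  finally have "Re (cinner (a *\<^sub>C x) (a *\<^sub>C x)) = (cmod a)\<^sup>2 * Re (cinner x x)"
    by (simp only: Re_complex_of_real times_complex.simps Im_complex_of_real)
  then show ?thesis
    by (simp add: norm_eq_sqrt_cinner real_sqrt_mult)
qed

lemma bounded_linear_scaleC: "bounded_linear (\<lambda>x :: 'a :: complex_hilbert_space. a *\<^sub>C x)"
proof (rule bounded_linear_intro)
  show "a *\<^sub>C (x + y) = a *\<^sub>C x + a *\<^sub>C y" for x y :: 'a
    by (rule scaleC_add_right)
  show "a *\<^sub>C r *\<^sub>R x = r *\<^sub>R a *\<^sub>C x" for r and x :: 'a
    by (simp add: scaleC_of_real[symmetric] scaleC_scaleC mult.commute)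
  show "norm (a *\<^sub>C x) \<le> norm x * cmod a" for x :: 'a
    by (simp add: norm_scaleC mult.commute)
qed

typedef (overloaded) 'h bop =
  "{T :: 'h :: complex_hilbert_space \<Rightarrow> 'h. bounded_linear T \<and> (\<forall>c x. T (c *\<^sub>C x) = c *\<^sub>C T x)}"
  morphisms bop_apply Bop
  by (rule exI[of _ "\<lambda>x. 0"]) (simp add: scaleC_zero_right)

setup_lifting type_definition_bop

instantiation bop :: (complex_hilbert_space) "{ring, monoid_mult, scaleC}"
begin

lift_definition zero_bop :: "'a bop" is "\<lambda>x. 0"
  by (simp add: scaleC_zero_right)
lift_definition plus_bop :: "'a bop \<Rightarrow> 'a bop \<Rightarrow> 'a bop" is "\<lambda>S T x. S x + T x"
  by (simp add: bounded_linear_add scaleC_add_right)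
lift_definition uminus_bop :: "'a bop \<Rightarrow> 'a bop" is "\<lambda>T x. - T x"
  by (simp add: bounded_linear_minus scaleC_minus_right)
lift_definition minus_bop :: "'a bop \<Rightarrow> 'a bop \<Rightarrow> 'a bop" is "\<lambda>S T x. S x - T x"
  by (simp add: bounded_linear_sub scaleC_diff_right)
lift_definition one_bop :: "'a bop" is "\<lambda>x. x"
  by simp
lift_definition times_bop :: "'a bop \<Rightarrow> 'a bop \<Rightarrow> 'a bop" is "\<lambda>S T x. S (T x)"
  by (simp add: bounded_linear_compose)
lift_definition scaleC_bop :: "complex \<Rightarrow> 'a bop \<Rightarrow> 'a bop" is "\<lambda>c T x. c *\<^sub>C T x"
  by (auto simp: scaleC_scaleC mult.commute intro: bounded_linear_compose[OF bounded_linear_scaleC])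

instance
proof
  fix a b c :: "'a bop"
  show "a + b + c = a + (b + c)" by transfer (simp add: add.assoc)
  show "a + b = b + a" by transfer (simp add: add.commute)
  show "0 + a = a" by transfer simp
  show "- a + a = 0" by transfer simp
  show "a - b = a + - b" by transfer simp
  show "a * b * c = a * (b * c)" by transfer simp
  show "(a + b) * c = a * c + b * c" by transfer simp
  show "a * (b + c) = a * b + a * c" by transfer (auto simp: linear_simps)
  show "1 * a = a" by transfer simp
  show "a * 1 = a" by transfer simp
qed

end

definition is_adjoint :: "'h :: complex_hilbert_space bop \<Rightarrow> 'h bop \<Rightarrow> bool" where
  "is_adjoint T R \<longleftrightarrow> (\<forall>x y. cinner (bop_apply T x) y = cinner x (bop_apply R y))"

definition adj :: "'h :: complex_hilbert_space bop \<Rightarrow> 'h bop" where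
  "adj T = (THE R. is_adjoint T R)"

definition self_adjoint :: "'h :: complex_hilbert_space bop \<Rightarrow> bool" where
  "self_adjoint T \<longleftrightarrow> is_adjoint T T"


section \<open>Free probability spaces\<close>

definition commutant :: "'h :: complex_hilbert_space bop set \<Rightarrow> 'h bop set" where
  "commutant A = {T. \<forall>R\<in>A. T * R = R * T}"

definition von_neumann_algebra :: "'h :: complex_hilbert_space bop set \<Rightarrow> bool" where
  "von_neumann_algebra A \<longleftrightarrow>
     (\<forall>T\<in>A. \<exists>R\<in>A. is_adjoint T R) \<and> commutant (commutant A) = A"

definition ultraweak_topology :: "'h :: complex_hilbert_space bop topology" where
  "ultraweak_topology = topology_generated_by
     {{T. (\<Sum>n. cinner (bop_apply T (\<xi> n)) (\<eta> n)) \<in> U} | \<xi> \<eta> U.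
        summable (\<lambda>n::nat. (norm (\<xi> n))\<^sup>2) \<and> summable (\<lambda>n. (norm (\<eta> n))\<^sup>2) \<and> open U}"

text \<open>
  Only the values of \<open>\<phi>\<close> on \<open>A\<close> matter. Weak continuity of the trace is understood as
  ultraweak continuity (normality). It is implied by continuity for the weak operator
  topology, since the ultraweak topology is the finer one.
\<close>

locale free_probability_space =
  fixes A :: "'h :: complex_hilbert_space bop set" and \<phi> :: "'h bop \<Rightarrow> complex"
  assumes von_neumann: "von_neumann_algebra A"
    and state_add: "T \<in> A \<Longrightarrow> R \<in> A \<Longrightarrow> \<phi> (T + R) = \<phi> T + \<phi> R"
    and state_scaleC: "T \<in> A \<Longrightarrow> \<phi> (c *\<^sub>C T) = c * \<phi> T"
    and state_one: "\<phi> 1 = 1"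
    and state_positive: "T \<in> A \<Longrightarrow> \<phi> (adj T * T) \<in> \<real>\<^sub>\<ge>\<^sub>0"
    and state_faithful: "T \<in> A \<Longrightarrow> \<phi> (adj T * T) = 0 \<Longrightarrow> T = 0"
    and state_trace: "T \<in> A \<Longrightarrow> R \<in> A \<Longrightarrow> \<phi> (T * R) = \<phi> (R * T)"
    and state_weakly_continuous:
      "continuous_map (subtopology ultraweak_topology A) euclidean \<phi>"

inductive_set generated_unital_algebra ::
    "'h :: complex_hilbert_space bop set \<Rightarrow> 'h bop set" for X where
  "1 \<in> generated_unital_algebra X"
| "T \<in> X \<Longrightarrow> T \<in> generated_unital_algebra X"
| "T \<in> generated_unital_algebra X \<Longrightarrow> R \<in> generated_unital_algebra X \<Longrightarrow>
     T + R \<in> generated_unital_algebra X"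
| "T \<in> generated_unital_algebra X \<Longrightarrow> R \<in> generated_unital_algebra X \<Longrightarrow>
     T * R \<in> generated_unital_algebra X"
| "T \<in> generated_unital_algebra X \<Longrightarrow> c *\<^sub>C T \<in> generated_unital_algebra X"

text \<open>
  Free independence of a family of unital subalgebras: alternating products of centered
  elements are centered. A word is a list of pairs (index, element of that subalgebra).
\<close>

definition free_algebras ::
    "('h :: complex_hilbert_space bop \<Rightarrow> complex) \<Rightarrow> 'i set \<Rightarrow> ('i \<Rightarrow> 'h bop set) \<Rightarrow> bool" where
  "free_algebras \<phi> I B \<longleftrightarrow>
     (\<forall>w :: ('i \<times> 'h bop) list.
        w \<noteq> [] \<and> (\<forall>(i, a)\<in>set w. i \<in> I \<and> a \<in> B i \<and> \<phi> a = 0) \<and> distinct_adj (map fst w)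
        \<longrightarrow> \<phi> (prod_list (map snd w)) = 0)"

text \<open>
  Used below for sets of self-adjoint elements, whose generated unital algebras are \<open>*\<close>-algebras.
\<close>

definition freely_independent ::
    "('h :: complex_hilbert_space bop \<Rightarrow> complex) \<Rightarrow> 'h bop set \<Rightarrow> 'h bop set \<Rightarrow> bool" where
  "freely_independent \<phi> X Y \<longleftrightarrow>
     free_algebras \<phi> (UNIV :: bool set)
       (\<lambda>b. generated_unital_algebra (if b then X else Y))"


section \<open>Laws\<close>

definition has_nc_law ::
    "('h :: complex_hilbert_space bop \<Rightarrow> complex) \<Rightarrow> 'h bop \<Rightarrow> real measure \<Rightarrow> bool" where
  "has_nc_law \<phi> F Q \<longleftrightarrow>
     prob_space Q \<and> sets Q = sets borel \<and>
     (\<forall>n. integrable Q (\<lambda>x. x ^ n) \<and> \<phi> (F ^ n) = complex_of_real (\<integral>x. x ^ n \<partial>Q))"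

text \<open>For self-adjoint \<open>F\<close> in a free probability space the law exists and is unique.\<close>

definition nc_law ::
    "('h :: complex_hilbert_space bop \<Rightarrow> complex) \<Rightarrow> 'h bop \<Rightarrow> real measure" where
  "nc_law \<phi> F = (THE Q. has_nc_law \<phi> F Q)"

definition semicircle_law :: "real \<Rightarrow> real measure" where
  "semicircle_law v = density lborel
     (\<lambda>x. ennreal (indicator {- 2 * sqrt v .. 2 * sqrt v} x * sqrt (4 * v - x\<^sup>2) / (2 * pi * v)))"

definition semicircular ::
    "('h :: complex_hilbert_space bop \<Rightarrow> complex) \<Rightarrow> real \<Rightarrow> 'h bop \<Rightarrow> bool" where
  "semicircular \<phi> v X \<longleftrightarrow> self_adjoint X \<and> has_nc_law \<phi> X (semicircle_law v)"

definition couplings :: "real measure \<Rightarrow> real measure \<Rightarrow> (real \<times> real) measure set" where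
  "couplings P Q = {\<pi>. prob_space \<pi> \<and> sets \<pi> = sets (borel \<Otimes>\<^sub>M borel) \<and>
                       distr \<pi> borel fst = P \<and> distr \<pi> borel snd = Q}"

text \<open>
  The pair \<open>(X\<^sub>1, X\<^sub>2)\<close> enters only through its joint law. Couplings of infinite cost do not
  affect the infimum, provided some coupling has finite cost, as is the case for laws with
  finite second moments. They are left out because the Bochner integral would give them cost 0.
\<close>

definition wasserstein2 :: "real measure \<Rightarrow> real measure \<Rightarrow> real" where
  "wasserstein2 P Q =
     Inf {sqrt (\<integral>(x, y). (x - y)\<^sup>2 \<partial>\<pi>) | \<pi>.
            \<pi> \<in> couplings P Q \<and> integrable \<pi> (\<lambda>(x, y). (x - y)\<^sup>2)}"


section \<open>Free Brownian motion and the second Wigner chaos\<close>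

definition free_brownian_motion ::
    "'h :: complex_hilbert_space bop set \<Rightarrow> ('h bop \<Rightarrow> complex) \<Rightarrow> (real \<Rightarrow> 'h bop) \<Rightarrow> bool" where
  "free_brownian_motion A \<phi> S \<longleftrightarrow>
     S 0 = 0 \<and>
     (\<forall>t\<ge>0. S t \<in> A \<and> self_adjoint (S t)) \<and>
     (\<forall>s t. 0 \<le> s \<and> s < t \<longrightarrow>
        semicircular \<phi> (t - s) (S t - S s) \<and>
        freely_independent \<phi> {S t - S s} (S ` {0..s}))"

text \<open>
  A tuple \<open>(c, a, b, a', b')\<close> stands for \<open>c\<close> times the indicator of the off-diagonal
  rectangle \<open>[a, b) \<times> [a', b')\<close>. A list stands for the sum of its entries.
\<close>

type_synonym rectangles = "(real \<times> real \<times> real \<times> real \<times> real) list"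

definition off_diagonal :: "rectangles \<Rightarrow> bool" where
  "off_diagonal L \<longleftrightarrow>
     (\<forall>(c, a, b, a', b')\<in>set L. 0 \<le> a \<and> a < b \<and> 0 \<le> a' \<and> a' < b' \<and> (b \<le> a' \<or> b' \<le> a))"

definition step_kernel :: "rectangles \<Rightarrow> real \<times> real \<Rightarrow> real" where
  "step_kernel L z = (\<Sum>(c, a, b, a', b')\<leftarrow>L. c * indicator ({a..<b} \<times> {a'..<b'}) z)"

definition step_wigner_integral2 ::
    "(real \<Rightarrow> 'h :: complex_hilbert_space bop) \<Rightarrow> rectangles \<Rightarrow> 'h bop" where
  "step_wigner_integral2 S L =
     (\<Sum>(c, a, b, a', b')\<leftarrow>L. complex_of_real c *\<^sub>C ((S b - S a) * (S b' - S a')))"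

abbreviation quadrant :: "(real \<times> real) set" where
  "quadrant \<equiv> {0..} \<times> {0..}"

definition square_integrable_kernel :: "(real \<times> real \<Rightarrow> real) \<Rightarrow> bool" where
  "square_integrable_kernel f \<longleftrightarrow>
     f \<in> borel_measurable borel \<and> set_integrable lborel quadrant (\<lambda>z. (f z)\<^sup>2)"

definition symmetric_kernel :: "(real \<times> real \<Rightarrow> real) \<Rightarrow> bool" where
  "symmetric_kernel f \<longleftrightarrow> (AE (s, t) in lborel. (s, t) \<in> quadrant \<longrightarrow> f (s, t) = f (t, s))"

text \<open>
  \<open>F\<close> is the Wigner double integral of \<open>f\<close>: the extension of the integral of off-diagonal step
  kernels by the isometry from \<open>L\<^sup>2\<close> of the quadrant to \<open>L\<^sup>2(A, \<phi>)\<close>. Its values lie in \<open>A\<close>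
  (Biane and Speicher), so nothing is lost by requiring \<open>F \<in> A\<close>.
\<close>

definition has_wigner_integral2 ::
    "'h :: complex_hilbert_space bop set \<Rightarrow> ('h bop \<Rightarrow> complex) \<Rightarrow> (real \<Rightarrow> 'h bop) \<Rightarrow>
     (real \<times> real \<Rightarrow> real) \<Rightarrow> 'h bop \<Rightarrow> bool" where
  "has_wigner_integral2 A \<phi> S f F \<longleftrightarrow>
     F \<in> A \<and>
     (\<exists>L :: nat \<Rightarrow> rectangles.
        (\<forall>n. off_diagonal (L n)) \<and>
        (\<lambda>n. LINT z:quadrant|lborel. (f z - step_kernel (L n) z)\<^sup>2) \<longlonglongrightarrow> 0 \<and>
        (\<lambda>n. \<phi> (adj (F - step_wigner_integral2 S (L n)) * (F - step_wigner_integral2 S (L n))))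
          \<longlonglongrightarrow> 0)"

definition second_wigner_chaos ::
    "'h :: complex_hilbert_space bop set \<Rightarrow> ('h bop \<Rightarrow> complex) \<Rightarrow> (real \<Rightarrow> 'h bop) \<Rightarrow> 'h bop set"
  where
  "second_wigner_chaos A \<phi> S =
     {F. \<exists>f. square_integrable_kernel f \<and> symmetric_kernel f \<and> has_wigner_integral2 A \<phi> S f F}"

end

theory Submission
  imports Defs "HOL-Computational_Algebra.Computational_Algebra" "Jordan_Normal_Form.Schur_Decomposition"
begin

text \<open>
  An element of the second chaos is an \<open>L\<^sup>2\<close>-limit of quadratic forms in orthonormal semicircular
  families with symmetric coefficient matrices of trace zero. The free cumulants \<open>\<kappa> k\<close> of such a
  form are the power sums \<open>\<Sum>\<^sub>i x\<^sub>i ^ k\<close> of the eigenvalues, where \<open>\<kappa> 1 = 0\<close> and \<open>\<kappa> 2 = 1\<close>, and the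
  moments are polynomials with nonnegative coefficients in the cumulants. Those of the tetilla law
  are \<open>\<kappa> (2 * k) = 2 * (1 / 2) ^ k\<close> and \<open>0\<close> for odd index.

  The fourth moment is \<open>\<kappa> 4 + 2\<close>. If \<open>\<kappa> 4\<close> is close to \<open>1 / 2\<close>, convexity makes the even cumulants at
  least as large as those of the tetilla law up to a small error, and the odd ones have nearly the
  sign of the eigenvalue of largest modulus. After a change of sign all cumulants thus nearly
  dominate those of the tetilla law, and hence so do the moments. The even moment of order at
  least six exceeds that of the tetilla law by at least \<open>(\<kappa> 3)\<^sup>2\<close> and by the difference of the
  cumulants of that order; its convergence forces both to vanish in the limit. Then the
  eigenvalues concentrate on \<open>x\<^sup>2 = 1 / 2\<close> and all cumulants converge.

  All laws live on one compact interval, on which convergence of moments, weak convergence and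
  convergence in the Wasserstein distance are equivalent.
\<close>

section \<open>Operators and traces\<close>

text \<open>Even moments contain products of odd cumulants such as
  \<open>\<kappa> 3 * \<kappa> 5\<close>, and a negative one could offset an excess of an even
  cumulant. This is why the signs of the odd cumulants must be controlled. The order has to be at
  least six because \<open>\<kappa> (2 * r)\<close> averages the power \<open>r - 1\<close> of
  \<open>x\<^sup>2\<close> under the weights \<open>x\<^sup>2\<close>: for order four this is
  linear, and only from six on does strict convexity detect the spread around 1/2. Freeness is
  turned into cumulants without noncrossing partitions. Chebyshev polynomials of a semicircular
  element are centered, so freeness of alternating words yields a Schwinger-Dyson equation, and the
  recursion for traces of powers of a matrix drops out of it. No spectral theorem for
  Hilbert-Schmidt operators is used. Step kernels give finite matrices, and a diagonal choice
  replaces each element of the chaos by one finite form whose first moments are close. Since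
  \<open>nc_law\<close> is a definite description, existence of the law is proved from the state
  alone, as a moment problem on a compact interval.\<close>

lemma bop_scaleC_simps:
  fixes S T :: "'h :: complex_hilbert_space bop"
  shows "c *\<^sub>C (S + T) = c *\<^sub>C S + c *\<^sub>C T"
    and "c *\<^sub>C (S - T) = c *\<^sub>C S - c *\<^sub>C T"
    and "(c + d) *\<^sub>C S = c *\<^sub>C S + d *\<^sub>C S"
    and "c *\<^sub>C (d *\<^sub>C S) = (c * d) *\<^sub>C S"
    and "(c *\<^sub>C S) * T = c *\<^sub>C (S * T)"
    and "S * (c *\<^sub>C T) = c *\<^sub>C (S * T)"
    and "c *\<^sub>C (0 :: 'h bop) = 0"
    and "c *\<^sub>C (- S) = - (c *\<^sub>C S)"
proof -
  show "c *\<^sub>C (S + T) = c *\<^sub>C S + c *\<^sub>C T" by transfer (simp add: scaleC_add_right)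
  show "c *\<^sub>C (S - T) = c *\<^sub>C S - c *\<^sub>C T" by transfer (simp add: scaleC_diff_right)
  show "(c + d) *\<^sub>C S = c *\<^sub>C S + d *\<^sub>C S" by transfer (simp add: scaleC_add_left)
  show "c *\<^sub>C (d *\<^sub>C S) = (c * d) *\<^sub>C S" by transfer (simp add: scaleC_scaleC)
  show "(c *\<^sub>C S) * T = c *\<^sub>C (S * T)" by transfer simp
  show "S * (c *\<^sub>C T) = c *\<^sub>C (S * T)" by transfer simp
  show "c *\<^sub>C (0 :: 'h bop) = 0" by transfer (simp add: scaleC_zero_right)
  show "c *\<^sub>C (- S) = - (c *\<^sub>C S)" by transfer (simp add: scaleC_minus_right)
qed

lemma bop_scaleC_of_real_simps:
  fixes S :: "'h :: complex_hilbert_space bop"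
  shows "1 *\<^sub>C S = S" and "0 *\<^sub>C S = 0" and "(- c) *\<^sub>C S = - (c *\<^sub>C S)"
proof -
  have one: "1 *\<^sub>C x = x" and zero: "0 *\<^sub>C x = 0" for x :: 'h
    using scaleC_of_real[of 1 x] scaleC_of_real[of 0 x] by simp_all
  show "1 *\<^sub>C S = S" by transfer (simp add: one)
  show z: "0 *\<^sub>C S = 0" by transfer (simp add: zero)
  have "(- c) *\<^sub>C S + c *\<^sub>C S = 0"
    using bop_scaleC_simps(3)[of "- c" c S] by (simp add: z)
  then show "(- c) *\<^sub>C S = - (c *\<^sub>C S)" by (simp add: eq_neg_iff_add_eq_0)
qed

lemmas bop_scaleC = bop_scaleC_simps bop_scaleC_of_real_simps

lemma bop_scaleC_sum:
  "c *\<^sub>C (\<Sum>i\<in>I. f i) = (\<Sum>i\<in>I. c *\<^sub>C (f i :: 'h :: complex_hilbert_space bop))"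
  by (induction I rule: infinite_finite_induct) (simp_all add: bop_scaleC)

lemma cinner_zero_left: "cinner (0 :: 'a :: complex_hilbert_space) y = 0"
  using cinner_add_left[of 0 0 y] by simp

lemma cinner_zero_right: "cinner (y :: 'a :: complex_hilbert_space) 0 = 0"
  using cinner_add_right[of y 0 0] by simp

lemma cinner_minus_right: "cinner y (- x) = - cinner (y :: 'a :: complex_hilbert_space) x"
  using cinner_add_right[of y x "- x"] by (simp add: cinner_zero_right eq_neg_iff_add_eq_0 add.commute)

lemma cinner_self_eq_0: "cinner x x = 0 \<Longrightarrow> x = (0 :: 'a :: complex_hilbert_space)"
  using norm_eq_sqrt_cinner[of x] by simp

lemma cinner_right_eqI:
  assumes "\<And>x. cinner x y = cinner x (z :: 'a :: complex_hilbert_space)"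
  shows "y = z"
proof -
  have "cinner (y - z) (y - z) = cinner (y - z) y + cinner (y - z) (- z)"
    by (metis cinner_add_right diff_conv_add_uminus)
  also have "\<dots> = 0" using assms[of "y - z"] by (simp add: cinner_minus_right)
  finally show ?thesis using cinner_self_eq_0[of "y - z"] by simp
qed

lemma is_adjoint_unique:
  assumes "is_adjoint T R" "is_adjoint T R'"
  shows "R = R'"
proof -
  have "bop_apply R y = bop_apply R' y" for y
    using assms by (intro cinner_right_eqI) (metis is_adjoint_def)
  then show ?thesis by (metis bop_apply_inject ext)
qed

lemma adj_eqI: "is_adjoint T R \<Longrightarrow> adj T = R"
  unfolding adj_def by (rule the_equality) (auto intro: is_adjoint_unique)

lemma is_adjoint_sym: "is_adjoint T R \<Longrightarrow> is_adjoint R T"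
  unfolding is_adjoint_def by (metis cinner_commute)

lemma is_adjoint_add: "is_adjoint T R \<Longrightarrow> is_adjoint T' R' \<Longrightarrow> is_adjoint (T + T') (R + R')"
  unfolding is_adjoint_def by (simp add: plus_bop.rep_eq cinner_add_left cinner_add_right)

lemma is_adjoint_times: "is_adjoint T R \<Longrightarrow> is_adjoint T' R' \<Longrightarrow> is_adjoint (T * T') (R' * R)"
  unfolding is_adjoint_def by (simp add: times_bop.rep_eq)

lemma is_adjoint_scaleC: "is_adjoint T R \<Longrightarrow> is_adjoint (c *\<^sub>C T) (cnj c *\<^sub>C R)"
  unfolding is_adjoint_def
  by (simp add: scaleC_bop.rep_eq cinner_scaleC_left cinner_scaleC_right)

lemma is_adjoint_one: "is_adjoint 1 1"
  unfolding is_adjoint_def by (simp add: one_bop.rep_eq)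

lemma self_adjoint_adj: "self_adjoint T \<Longrightarrow> adj T = T"
  by (simp add: self_adjoint_def adj_eqI)

lemma self_adjoint_one: "self_adjoint 1"
  by (simp add: self_adjoint_def is_adjoint_one)

lemma self_adjoint_add: "self_adjoint S \<Longrightarrow> self_adjoint T \<Longrightarrow> self_adjoint (S + T)"
  by (simp add: self_adjoint_def is_adjoint_add)

lemma self_adjoint_of_real: "self_adjoint S \<Longrightarrow> self_adjoint (complex_of_real c *\<^sub>C S)"
  using is_adjoint_scaleC[of S S "complex_of_real c"] by (simp add: self_adjoint_def)

lemma self_adjoint_diff: "self_adjoint S \<Longrightarrow> self_adjoint T \<Longrightarrow> self_adjoint (S - T)"
  using self_adjoint_add[of S "- T"] self_adjoint_of_real[of T "- 1"] by (simp add: bop_scaleC)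

lemma self_adjoint_power: "self_adjoint S \<Longrightarrow> self_adjoint (S ^ n)"
  by (induction n)
    (auto simp: self_adjoint_def power_commutes is_adjoint_one
      dest: is_adjoint_times[of S S "S ^ n" "S ^ n" for n])

lemma self_adjoint_zero: "self_adjoint 0"
  by (simp add: self_adjoint_def is_adjoint_def zero_bop.rep_eq cinner_zero_left cinner_zero_right)

text \<open>Each functional defining the topology is bounded by a multiple of the operator norm, and
  the property survives the finite intersections and unions that generate the topology. It serves to
  bound the state by the operator norm.\<close>

lemma openin_ultraweak_zero:
  fixes U :: "'h :: complex_hilbert_space bop set"
  assumes "openin ultraweak_topology U" "0 \<in> U"
  shows "\<exists>e>0. \<forall>T. onorm (bop_apply T) < e \<longrightarrow> T \<in> U"
proof -
  let ?B = "{{T :: 'h bop. (\<Sum>n. cinner (bop_apply T (\<xi> n)) (\<eta> n)) \<in> U} | \<xi> \<eta> U.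
        summable (\<lambda>n::nat. (norm (\<xi> n))\<^sup>2) \<and> summable (\<lambda>n. (norm (\<eta> n))\<^sup>2) \<and> open U}"
  have CS: "cmod (cinner x y) \<le> norm x * norm y" for x y :: 'h
  proof (cases "cinner x y = 0 \<or> norm y = 0")
    case True
    then show ?thesis using cinner_zero_right by auto
  next
    case False
    define u where "u = cinner x y"
    define r where "r = norm x / norm y"
    have yy: "cinner z z = complex_of_real ((norm z)\<^sup>2)" for z :: 'h
    proof -
      have "cinner z z \<in> \<real>" using cinner_commute[of z z] by (metis Reals_cnj_iff)
      moreover have "Re (cinner z z) \<ge> 0"
        using norm_eq_sqrt_cinner[of z] by (metis norm_ge_zero real_sqrt_ge_0_iff)
      then have "(norm z)\<^sup>2 = Re (cinner z z)" by (simp add: norm_eq_sqrt_cinner)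
      ultimately show ?thesis by simp
    qed
    \<comment> \<open>For this \<open>t\<close> the norm of \<open>x + t y\<close> is least; that
      its square is nonnegative is the Cauchy-Schwarz inequality.\<close>
    define t where "t = - (u / complex_of_real ((norm y)\<^sup>2))"
    have ny: "norm y \<noteq> 0" using False by simp
    have "cinner (x + t *\<^sub>C y) (x + t *\<^sub>C y) =
        cinner x x + cnj t * u + t * cnj u + t * cnj t * cinner y y"
      by (simp add: cinner_add_left cinner_add_right cinner_scaleC_left cinner_scaleC_right u_def
          cinner_commute[of y x] algebra_simps)
    also have "\<dots> = complex_of_real ((norm x)\<^sup>2 - (cmod u)\<^sup>2 / (norm y)\<^sup>2)"
      using ny unfolding t_def yy
      by (simp add: field_simps power2_eq_square complex_norm_square[unfolded power2_eq_square] flip: of_real_mult)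
    finally have "0 \<le> (norm x)\<^sup>2 - (cmod u)\<^sup>2 / (norm y)\<^sup>2"
      unfolding yy by (metis of_real_eq_iff zero_le_power2)
    then have "(cmod u)\<^sup>2 \<le> (norm x * norm y)\<^sup>2"
      using ny by (simp add: field_simps power_mult_distrib)
    then show ?thesis unfolding u_def by (rule power2_le_imp_le) simp
  qed
  have "generate_topology_on ?B U"
    using assms(1) unfolding ultraweak_topology_def openin_topology_generated_by_iff .
  then have "0 \<in> U \<longrightarrow> ?thesis"
  proof induction
    case Empty
    then show ?case by simp
  next
    case (Int a b)
    show ?case
    proof
      assume "0 \<in> a \<inter> b"
      then obtain e1 e2 where "e1 > 0" "e2 > 0" "\<forall>T. onorm (bop_apply T) < e1 \<longrightarrow> T \<in> a"
        "\<forall>T. onorm (bop_apply T) < e2 \<longrightarrow> T \<in> b" using Int by auto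
      then show "\<exists>e>0. \<forall>T. onorm (bop_apply T) < e \<longrightarrow> T \<in> a \<inter> b"
        by (intro exI[of _ "min e1 e2"]) auto
    qed
  next
    case (UN K)
    then show ?case by blast
  next
    case (Basis s)
    then obtain \<xi> \<eta> V where s: "s = {T. (\<Sum>n. cinner (bop_apply T (\<xi> n)) (\<eta> n)) \<in> V}"
      and sm: "summable (\<lambda>n::nat. (norm (\<xi> n))\<^sup>2)" "summable (\<lambda>n. (norm (\<eta> n))\<^sup>2)" and V: "open V"
      by auto
    show ?case
    proof
      assume "0 \<in> s"
      then have "0 \<in> V" by (simp add: s zero_bop.rep_eq cinner_zero_left)
      then obtain d where d: "d > 0" "\<And>z. cmod z < d \<Longrightarrow> z \<in> V"
        using V unfolding open_dist by (metis dist_0_norm dist_commute)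
      \<comment> \<open>The product of two norms is estimated by the sum of their squares. The
        radius below uses \<open>K + 1\<close> so that \<open>K = 0\<close> causes no division by
        zero.\<close>
      define K where "K = (\<Sum>n. (norm (\<xi> n))\<^sup>2 + (norm (\<eta> n))\<^sup>2)"
      have sK: "summable (\<lambda>n. (norm (\<xi> n))\<^sup>2 + (norm (\<eta> n))\<^sup>2)" using sm by (rule summable_add)
      have K0: "K \<ge> 0" unfolding K_def by (intro suminf_nonneg sK) simp
      have bd: "cmod (\<Sum>n. cinner (bop_apply T (\<xi> n)) (\<eta> n)) \<le> onorm (bop_apply T) * K" for T
      proof -
        have bl: "bounded_linear (bop_apply T)" using bop_apply[of T] by simp
        have p: "cmod (cinner (bop_apply T (\<xi> n)) (\<eta> n)) \<le>
            onorm (bop_apply T) * ((norm (\<xi> n))\<^sup>2 + (norm (\<eta> n))\<^sup>2)" for n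
        proof -
          have "cmod (cinner (bop_apply T (\<xi> n)) (\<eta> n)) \<le> norm (bop_apply T (\<xi> n)) * norm (\<eta> n)"
            by (rule CS)
          also have "\<dots> \<le> (onorm (bop_apply T) * norm (\<xi> n)) * norm (\<eta> n)"
            by (intro mult_right_mono onorm bl) simp
          also have "\<dots> = onorm (bop_apply T) * (norm (\<xi> n) * norm (\<eta> n))" by simp
          also have "\<dots> \<le> onorm (bop_apply T) * ((norm (\<xi> n))\<^sup>2 + (norm (\<eta> n))\<^sup>2)"
          proof (intro mult_left_mono onorm_pos_le bl)
            have "0 \<le> norm (\<xi> n) * norm (\<eta> n)" by simp
            then show "norm (\<xi> n) * norm (\<eta> n) \<le> (norm (\<xi> n))\<^sup>2 + (norm (\<eta> n))\<^sup>2"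
              using sum_squares_bound[of "norm (\<xi> n)" "norm (\<eta> n)"] by linarith
          qed
          finally show ?thesis .
        qed
        have s2: "summable (\<lambda>n. onorm (bop_apply T) * ((norm (\<xi> n))\<^sup>2 + (norm (\<eta> n))\<^sup>2))"
          using sK by (rule summable_mult)
        have s3: "summable (\<lambda>n. cmod (cinner (bop_apply T (\<xi> n)) (\<eta> n)))"
          by (rule summable_comparison_test'[OF s2, of 0]) (use p in simp)
        have "cmod (\<Sum>n. cinner (bop_apply T (\<xi> n)) (\<eta> n)) \<le> (\<Sum>n. cmod (cinner (bop_apply T (\<xi> n)) (\<eta> n)))"
          by (rule summable_norm[OF s3])
        also have "\<dots> \<le> (\<Sum>n. onorm (bop_apply T) * ((norm (\<xi> n))\<^sup>2 + (norm (\<eta> n))\<^sup>2))"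
          by (rule suminf_le[OF p s3 s2])
        also have "\<dots> = onorm (bop_apply T) * K" unfolding K_def by (rule suminf_mult[OF sK])
        finally show ?thesis .
      qed
      show "\<exists>e>0. \<forall>T. onorm (bop_apply T) < e \<longrightarrow> T \<in> s"
      proof (intro exI[of _ "d / (K + 1)"] conjI allI impI)
        show "d / (K + 1) > 0" using d K0 by simp
        fix T :: "'h bop" assume T: "onorm (bop_apply T) < d / (K + 1)"
        have "onorm (bop_apply T) * K \<le> onorm (bop_apply T) * (K + 1)"
          using onorm_pos_le[of "bop_apply T"] bop_apply[of T] by (intro mult_left_mono) auto
        also have "\<dots> < d" using T K0 by (simp add: field_simps)
        finally show "T \<in> s" using bd[of T] d(2) unfolding s by simp
      qed
    qed
  qed
  with assms(2) show ?thesis by simp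
qed

definition unital_subalgebra :: "'h :: complex_hilbert_space bop set \<Rightarrow> bool" where
  "unital_subalgebra B \<longleftrightarrow> 1 \<in> B \<and> (\<forall>x\<in>B. \<forall>y\<in>B. x + y \<in> B \<and> x * y \<in> B) \<and>
     (\<forall>c. \<forall>x\<in>B. c *\<^sub>C x \<in> B)"

lemma unital_subalgebraD:
  assumes "unital_subalgebra B"
  shows "1 \<in> B" "x \<in> B \<Longrightarrow> y \<in> B \<Longrightarrow> x + y \<in> B" "x \<in> B \<Longrightarrow> y \<in> B \<Longrightarrow> x * y \<in> B"
    "x \<in> B \<Longrightarrow> c *\<^sub>C x \<in> B"
  using assms by (auto simp: unital_subalgebra_def)

lemma unital_subalgebra_closed:
  assumes B: "unital_subalgebra B"
  shows "0 \<in> B" "x \<in> B \<Longrightarrow> - x \<in> B" "x \<in> B \<Longrightarrow> y \<in> B \<Longrightarrow> x - y \<in> B" "x \<in> B \<Longrightarrow> x ^ n \<in> B"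
    "(\<And>i. i \<in> I \<Longrightarrow> f i \<in> B) \<Longrightarrow> sum f I \<in> B"
    "(\<And>y. y \<in> set xs \<Longrightarrow> y \<in> B) \<Longrightarrow> prod_list xs \<in> B"
proof -
  note D = unital_subalgebraD[OF B]
  show z: "0 \<in> B" using D(4)[OF D(1), of 0] by (simp add: bop_scaleC)
  show m: "x \<in> B \<Longrightarrow> - x \<in> B" for x using D(4)[of x "- 1"] by (simp add: bop_scaleC)
  show "x \<in> B \<Longrightarrow> y \<in> B \<Longrightarrow> x - y \<in> B" using D(2)[of x "- y"] m[of y] by simp
  show "x \<in> B \<Longrightarrow> x ^ n \<in> B" by (induction n) (auto intro: D)
  show "(\<And>i. i \<in> I \<Longrightarrow> f i \<in> B) \<Longrightarrow> sum f I \<in> B"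
    by (induction I rule: infinite_finite_induct) (auto intro: D z)
  show "(\<And>y. y \<in> set xs \<Longrightarrow> y \<in> B) \<Longrightarrow> prod_list xs \<in> B"
    by (induction xs) (auto intro: D)
qed

lemma unital_subalgebra_generated: "unital_subalgebra (generated_unital_algebra X)"
  by (auto simp: unital_subalgebra_def intro: generated_unital_algebra.intros)

lemma generated_unital_algebra_subset:
  assumes "unital_subalgebra B" "X \<subseteq> B"
  shows "generated_unital_algebra X \<subseteq> B"
proof
  fix x assume "x \<in> generated_unital_algebra X"
  then show "x \<in> B"
    by induction (use assms in \<open>auto intro: unital_subalgebraD\<close>)
qed

lemma unital_subalgebra_commutant: "unital_subalgebra (commutant (A :: 'h :: complex_hilbert_space bop set))"
proof -
  have "x * y * R = R * (x * y)" if "x * R = R * x" "y * R = R * y" for x y R :: "'h bop"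
    by (metis mult.assoc that)
  then show ?thesis
    unfolding unital_subalgebra_def commutant_def by (auto simp: distrib_left distrib_right bop_scaleC)
qed

section \<open>The L2-norm of a tracial state and its relation to the operator norm\<close>

context free_probability_space
begin

lemma subalgebra_A: "unital_subalgebra A"
  using unital_subalgebra_commutant[of "commutant A"] von_neumann
  by (simp add: von_neumann_algebra_def)

lemmas A_intros = unital_subalgebraD[OF subalgebra_A] unital_subalgebra_closed[OF subalgebra_A]

lemma adj_A: "T \<in> A \<Longrightarrow> adj T \<in> A" and is_adjoint_adj: "T \<in> A \<Longrightarrow> is_adjoint T (adj T)"
  using von_neumann unfolding von_neumann_algebra_def by (metis adj_eqI)+

lemma adj_add: "T \<in> A \<Longrightarrow> R \<in> A \<Longrightarrow> adj (T + R) = adj T + adj R"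
  by (intro adj_eqI is_adjoint_add is_adjoint_adj)

lemma adj_times: "T \<in> A \<Longrightarrow> R \<in> A \<Longrightarrow> adj (T * R) = adj R * adj T"
  by (intro adj_eqI is_adjoint_times is_adjoint_adj)

lemma adj_scaleC: "T \<in> A \<Longrightarrow> adj (c *\<^sub>C T) = cnj c *\<^sub>C adj T"
  by (intro adj_eqI is_adjoint_scaleC is_adjoint_adj)

lemma adj_adj: "T \<in> A \<Longrightarrow> adj (adj T) = T"
  by (intro adj_eqI is_adjoint_sym[OF is_adjoint_adj])

lemma adj_minus: "T \<in> A \<Longrightarrow> adj (- T) = - adj T"
  using adj_scaleC[of T "- 1"] by (simp add: bop_scaleC)

lemma adj_diff: "T \<in> A \<Longrightarrow> R \<in> A \<Longrightarrow> adj (T - R) = adj T - adj R"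
  using adj_add[of T "- R"] by (simp add: adj_minus A_intros)

lemma state_zero: "\<phi> 0 = 0"
  using state_scaleC[of 1 0] by (simp add: bop_scaleC A_intros)

lemma state_minus: "T \<in> A \<Longrightarrow> \<phi> (- T) = - \<phi> T"
  using state_scaleC[of T "- 1"] by (simp add: bop_scaleC)

lemma state_diff: "T \<in> A \<Longrightarrow> R \<in> A \<Longrightarrow> \<phi> (T - R) = \<phi> T - \<phi> R"
  using state_add[of T "- R"] by (simp add: state_minus A_intros)

lemma state_sum: "(\<And>i. i \<in> I \<Longrightarrow> f i \<in> A) \<Longrightarrow> \<phi> (sum f I) = (\<Sum>i\<in>I. \<phi> (f i))"
proof (induction I rule: infinite_finite_induct)
  case (insert x F)
  then show ?case using state_add[of "f x" "sum f F"] A_intros(9)[of F f] by simp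
qed (simp_all add: state_zero)

text \<open>Positivity makes the state of \<open>adj x * x\<close> real; polarization with
  \<open>x = 1 + T\<close> and \<open>x = 1 + \<i> T\<close> separates the real and imaginary
  parts.\<close>

lemma state_adj:
  assumes T: "T \<in> A"
  shows "\<phi> (adj T) = cnj (\<phi> T)"
proof -
  have exp: "\<phi> (adj (1 + c *\<^sub>C T) * (1 + c *\<^sub>C T)) =
      1 + c * \<phi> T + cnj c * \<phi> (adj T) + c * cnj c * \<phi> (adj T * T)" for c
    using T by (simp add: adj_add adj_scaleC adj_eqI[OF is_adjoint_one] A_intros adj_A bop_scaleC
        distrib_left distrib_right state_add state_scaleC state_one algebra_simps)
  have real: "Im (\<phi> (adj x * x)) = 0" if "x \<in> A" for x
    using state_positive[OF that] by (auto simp: nonneg_Reals_def)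
  have "Im (\<phi> T + \<phi> (adj T)) = 0"
    using real[of "1 + 1 *\<^sub>C T"] real[OF T] exp[of 1] T by (simp add: A_intros)
  moreover have "Im (\<i> * \<phi> T - \<i> * \<phi> (adj T)) = 0"
    using real[of "1 + \<i> *\<^sub>C T"] real[OF T] exp[of \<i>] T by (simp add: A_intros)
  ultimately show ?thesis by (simp add: complex_eq_iff)
qed

text \<open>The norm of the Hilbert space obtained from the state by the GNS construction.\<close>

definition norm2 :: "'h bop \<Rightarrow> real" where
  "norm2 T = sqrt (Re (\<phi> (adj T * T)))"

lemma norm2_sq: "T \<in> A \<Longrightarrow> \<phi> (adj T * T) = complex_of_real ((norm2 T)\<^sup>2)"
  using state_positive[of T] by (auto simp: norm2_def nonneg_Reals_def complex_eq_iff)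

lemma norm2_nonneg: "T \<in> A \<Longrightarrow> norm2 T \<ge> 0"
  using state_positive[of T] by (auto simp: norm2_def nonneg_Reals_def)

lemma norm2_eq_0: "T \<in> A \<Longrightarrow> norm2 T = 0 \<Longrightarrow> T = 0"
  using state_faithful[of T] norm2_sq[of T] by simp

lemma Cauchy_Schwarz:
  assumes T: "T \<in> A" and R: "R \<in> A"
  shows "cmod (\<phi> (adj T * R)) \<le> norm2 T * norm2 R"
proof (cases "norm2 T = 0")
  case True
  then have "T = 0" using T norm2_eq_0 by blast
  then have "adj T = 0" using adj_scaleC[of 1 0] by (simp add: bop_scaleC A_intros)
  then show ?thesis using True by (simp add: state_zero)
next
  case False
  define u where "u = \<phi> (adj T * R)"
  define a where "a = (norm2 T)\<^sup>2"
  have a: "a \<noteq> 0" using False by (simp add: a_def)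
  have u': "\<phi> (adj R * T) = cnj u"
    unfolding u_def using T R by (simp add: adj_times adj_adj adj_A A_intros flip: state_adj)
  \<comment> \<open>The multiple of \<open>T\<close> for which \<open>R + c T\<close> has the least
    L2-norm.\<close>
  define c where "c = - (u / complex_of_real a)"
  have cA: "R + c *\<^sub>C T \<in> A" using T R by (simp add: A_intros)
  have sq: "complex_of_real (cmod u) * complex_of_real (cmod u) = u * cnj u"
    using complex_norm_square[of u] by (simp add: power2_eq_square)
  have "\<phi> (adj (R + c *\<^sub>C T) * (R + c *\<^sub>C T)) =
      \<phi> (adj R * R) + c * cnj u + cnj c * u + c * cnj c * \<phi> (adj T * T)"
    using T R u' by (simp add: adj_add adj_scaleC A_intros adj_A bop_scaleC
        distrib_left distrib_right state_add state_scaleC algebra_simps u_def)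
  also have "\<dots> = complex_of_real ((norm2 R)\<^sup>2 - (cmod u)\<^sup>2 / a)"
    unfolding norm2_sq[OF T] norm2_sq[OF R] c_def using a
    by (simp add: field_simps power2_eq_square a_def sq)
  finally have "complex_of_real ((norm2 (R + c *\<^sub>C T))\<^sup>2) = complex_of_real ((norm2 R)\<^sup>2 - (cmod u)\<^sup>2 / a)"
    unfolding norm2_sq[OF cA] .
  then have "0 \<le> (norm2 R)\<^sup>2 - (cmod u)\<^sup>2 / a" by (metis of_real_eq_iff zero_le_power2)
  moreover have "a > 0" using a by (simp add: a_def)
  ultimately have "(cmod u)\<^sup>2 \<le> (norm2 T * norm2 R)\<^sup>2"
    by (simp add: field_simps power_mult_distrib a_def)
  then show ?thesis unfolding u_def
    by (rule power2_le_imp_le) (simp add: norm2_nonneg T R)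
qed

lemma norm2_adj: "T \<in> A \<Longrightarrow> norm2 (adj T) = norm2 T"
  unfolding norm2_def using state_trace[of "adj T" T] by (simp add: adj_adj adj_A)

lemma norm2_triangle:
  assumes T: "T \<in> A" and R: "R \<in> A"
  shows "norm2 (T + R) \<le> norm2 T + norm2 R"
proof (rule power2_le_imp_le)
  have "\<phi> (adj (T + R) * (T + R)) =
      \<phi> (adj T * T) + \<phi> (adj T * R) + \<phi> (adj R * T) + \<phi> (adj R * R)"
    using T R by (simp add: adj_add A_intros adj_A distrib_left distrib_right state_add algebra_simps)
  then have "Re (\<phi> (adj (T + R) * (T + R))) \<le>
      (norm2 T)\<^sup>2 + norm2 T * norm2 R + norm2 R * norm2 T + (norm2 R)\<^sup>2"
    using arg_cong[OF norm2_sq[OF T], of Re] arg_cong[OF norm2_sq[OF R], of Re]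
      Cauchy_Schwarz[OF T R] Cauchy_Schwarz[OF R T, unfolded mult.commute[of "norm2 R"]]
      complex_Re_le_cmod[of "\<phi> (adj T * R)"] complex_Re_le_cmod[of "\<phi> (adj R * T)"]
    by (simp del: of_real_power add: mult.commute)
  then show "(norm2 (T + R))\<^sup>2 \<le> (norm2 T + norm2 R)\<^sup>2"
    using norm2_sq[of "T + R"] T R by (simp add: A_intros power2_eq_square algebra_simps)
  show "0 \<le> norm2 T + norm2 R" using T R by (simp add: norm2_nonneg)
qed

lemma norm2_minus: "T \<in> A \<Longrightarrow> norm2 (- T) = norm2 T"
  by (simp add: norm2_def adj_minus)

lemma norm2_diff_commute: "T \<in> A \<Longrightarrow> R \<in> A \<Longrightarrow> norm2 (T - R) = norm2 (R - T)"
  using norm2_minus[of "T - R"] by (simp add: A_intros)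

lemma norm2_scale: "T \<in> A \<Longrightarrow> norm2 (complex_of_real c *\<^sub>C T) = \<bar>c\<bar> * norm2 T"
proof -
  assume T: "T \<in> A"
  have "\<phi> (adj (complex_of_real c *\<^sub>C T) * (complex_of_real c *\<^sub>C T)) = complex_of_real (c\<^sup>2) * \<phi> (adj T * T)"
    using T by (simp add: adj_scaleC bop_scaleC state_scaleC A_intros(3) adj_A power2_eq_square)
  then show ?thesis
    unfolding norm2_def by (simp del: of_real_power add: real_sqrt_mult)
qed

text \<open>Ultraweak continuity at 0 gives a norm ball on which the state is below 1 in modulus;
  scaling does the rest. The bound controls all moments of an operator and thereby the support of
  its law.\<close>

lemma state_norm_bound:
  obtains K where "K > 0" "\<And>T. T \<in> A \<Longrightarrow> cmod (\<phi> T) \<le> K * onorm (bop_apply T)"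
proof -
  have "openin (subtopology ultraweak_topology A) {T \<in> topspace (subtopology ultraweak_topology A). \<phi> T \<in> ball 0 1}"
    using state_weakly_continuous by (intro openin_continuous_map_preimage) auto
  then obtain U where U: "openin ultraweak_topology U"
    and eq: "{T \<in> topspace (subtopology ultraweak_topology A). \<phi> T \<in> ball 0 1} = U \<inter> A"
    unfolding openin_subtopology by blast
  have "topspace (ultraweak_topology :: 'h bop topology) = UNIV"
  proof -
    have "(UNIV :: 'h bop set) \<in> {{T. (\<Sum>n. cinner (bop_apply T (\<xi> n)) (\<eta> n)) \<in> U} | \<xi> \<eta> U.
        summable (\<lambda>n::nat. (norm (\<xi> n))\<^sup>2) \<and> summable (\<lambda>n. (norm (\<eta> n))\<^sup>2) \<and> open U}"
      by (intro CollectI exI[of _ "\<lambda>_. 0"] exI[of _ UNIV]) auto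
    then show ?thesis unfolding ultraweak_topology_def topology_generated_by_topspace
      by (rule subset_antisym[OF subset_UNIV Union_upper])
  qed
  then have eq: "U \<inter> A = {T \<in> A. cmod (\<phi> T) < 1}"
    unfolding eq[symmetric] by auto
  have "0 \<in> {T \<in> A. cmod (\<phi> T) < 1}" by (simp add: A_intros(5) state_zero)
  then have "0 \<in> U" unfolding eq[symmetric] by simp
  from openin_ultraweak_zero[OF U this] obtain e where e: "e > 0"
    "\<And>T. onorm (bop_apply T) < e \<Longrightarrow> T \<in> U" by blast
  show thesis
proof (rule that[of "2 / e"])
    show "2 / e > 0" using e by simp
    fix T assume T: "T \<in> A"
    let ?o = "onorm (bop_apply T)"
    have bl: "bounded_linear (bop_apply T)" using bop_apply[of T] by simp
    have os: "onorm (bop_apply (complex_of_real c *\<^sub>C T)) = \<bar>c\<bar> * ?o" for c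
      using onorm_scaleR[OF bl, of c] by (simp add: scaleC_bop.rep_eq scaleC_of_real)
    have lt: "\<bar>c\<bar> * cmod (\<phi> T) < 1" if "\<bar>c\<bar> * ?o < e" for c
    proof -
      have "complex_of_real c *\<^sub>C T \<in> U \<inter> A"
        using e(2)[of "complex_of_real c *\<^sub>C T"] that T by (simp add: os A_intros)
      then show ?thesis unfolding eq using T by (simp add: state_scaleC norm_mult)
    qed
    show "cmod (\<phi> T) \<le> 2 / e * ?o"
    proof (cases "?o = 0")
      case True
      \<comment> \<open>With operator norm 0 every multiple of \<open>T\<close> stays in the ball,
        so a nonzero value of the state could be scaled up to 1.\<close>
      have "cmod (\<phi> T) \<le> 0"
      proof (rule ccontr)
        assume "\<not> cmod (\<phi> T) \<le> 0"
        then show False using lt[of "1 / cmod (\<phi> T)"] True e(1) by simp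
      qed
      then show ?thesis using True by simp
    next
      case False
      then have o: "?o > 0" using onorm_pos_le[OF bl] by simp
      have "e / (2 * ?o) * cmod (\<phi> T) < 1"
        using lt[of "e / (2 * ?o)"] o e(1) by simp
      then show ?thesis using o e(1) by (simp add: field_simps)
    qed
  qed
qed

end

section \<open>Compactly supported laws and their moments\<close>

text \<open>Markov's inequality for the power \<open>2 * n\<close> bounds the mass beyond
  \<open>R + e\<close> by \<open>C\<close> times the power \<open>2 * n\<close> of
  \<open>R / (R + e)\<close>, which tends to 0.\<close>

lemma AE_bounded_of_moments:
  fixes Q :: "real measure"
  assumes Q: "prob_space Q" "sets Q = sets borel"
    and int: "\<And>n. integrable Q (\<lambda>x. x ^ n)"
    and bd: "\<And>n. \<bar>\<integral>x. x ^ n \<partial>Q\<bar> \<le> C * R ^ n" and R: "R > 0"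
  shows "AE x in Q. \<bar>x\<bar> \<le> R"
proof -
  interpret prob_space Q by fact
  have [measurable_cong]: "sets Q = sets borel" by fact
  have step: "AE x in Q. \<bar>x\<bar> < R + e" if e: "e > 0" for e
  proof -
    define r where "r = (R / (R + e))\<^sup>2"
    have r: "0 \<le> r" "r < 1"
      using R e power_strict_mono[of "R / (R + e)" 1 2] by (auto simp: r_def)
    have le: "prob {x \<in> space Q. \<bar>x\<bar> \<ge> R + e} \<le> C * r ^ n" for n
    proof -
      have "(R + e) ^ (2 * n) * prob {x \<in> space Q. \<bar>x\<bar> \<ge> R + e} \<le> (\<integral>x. x ^ (2 * n) \<partial>Q)"
      proof -
        have "prob {x \<in> space Q. \<bar>x\<bar> \<ge> R + e} \<le> prob {x \<in> space Q. (R + e) ^ (2 * n) \<le> x ^ (2 * n)}"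
        proof (rule finite_measure_mono)
          show "{x \<in> space Q. \<bar>x\<bar> \<ge> R + e} \<subseteq> {x \<in> space Q. (R + e) ^ (2 * n) \<le> x ^ (2 * n)}"
          proof safe
            fix x assume "R + e \<le> \<bar>x\<bar>"
            then have "(R + e) ^ (2 * n) \<le> \<bar>x\<bar> ^ (2 * n)" using R e by (intro power_mono) auto
            then show "(R + e) ^ (2 * n) \<le> x ^ (2 * n)" by (simp add: power_even_abs)
          qed
        qed measurable
        also have "\<dots> \<le> (\<integral>x. x ^ (2 * n) \<partial>Q) / (R + e) ^ (2 * n)"
          using R e by (intro integral_Markov_inequality_measure[where A="{}"] int) auto
        finally show ?thesis using R e by (simp add: field_simps)
      qed
      also have "\<dots> \<le> C * R ^ (2 * n)" using bd[of "2 * n"] by simp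
      finally show ?thesis using R e
        by (simp add: r_def power_divide field_simps flip: power_mult)
    qed
    have "(\<lambda>n. C * r ^ n) \<longlonglongrightarrow> C * 0"
      by (intro tendsto_mult tendsto_const LIMSEQ_realpow_zero r)
    then have "prob {x \<in> space Q. \<bar>x\<bar> \<ge> R + e} \<le> 0"
      using le by (intro LIMSEQ_le_const[of "\<lambda>n. C * r ^ n"]) auto
    then have "prob {x \<in> space Q. \<bar>x\<bar> \<ge> R + e} = 0" using measure_nonneg by (metis antisym)
    then have "AE x in Q. x \<notin> {x \<in> space Q. \<bar>x\<bar> \<ge> R + e}"
      by (subst (asm) prob_eq_0) auto
    with AE_space show ?thesis by eventually_elim auto
  qed
  have "AE x in Q. \<forall>n. \<bar>x\<bar> < R + inverse (real (Suc n))"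
    unfolding AE_all_countable by (intro allI step) simp
  then show ?thesis
  proof (rule AE_mp, intro AE_I2 impI)
    fix x assume *: "\<forall>n. \<bar>x\<bar> < R + inverse (real (Suc n))"
    show "\<bar>x\<bar> \<le> R"
    proof (rule ccontr)
      assume "\<not> \<bar>x\<bar> \<le> R"
      then obtain n where "inverse (real (Suc n)) < \<bar>x\<bar> - R"
        using reals_Archimedean[of "\<bar>x\<bar> - R"] by auto
      with *[rule_format, of n] show False by linarith
    qed
  qed
qed

lemma integrable_AE_bounded_power:
  fixes Q :: "real measure"
  assumes "real_distribution Q" "AE x in Q. \<bar>x\<bar> \<le> R"
  shows "integrable Q (\<lambda>x. x ^ n)" "\<bar>\<integral>x. x ^ n \<partial>Q\<bar> \<le> R ^ n" "(\<integral>x. \<bar>x\<bar> ^ n \<partial>Q) \<le> R ^ n"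
proof -
  interpret real_distribution Q by fact
  have ae: "AE x in Q. \<bar>x\<bar> ^ n \<le> R ^ n"
    using assms(2) by eventually_elim (auto intro: power_mono)
  show int: "integrable Q (\<lambda>x. x ^ n)"
    by (rule integrable_const_bound[where B="R ^ n"]) (use ae in \<open>auto simp: power_abs\<close>)
  show *: "(\<integral>x. \<bar>x\<bar> ^ n \<partial>Q) \<le> R ^ n"
    using integral_mono_AE[of Q "\<lambda>x. \<bar>x\<bar> ^ n" "\<lambda>_. R ^ n"] ae integrable_abs[OF int]
      prob_space by (simp add: power_abs)
  have "\<bar>\<integral>x. x ^ n \<partial>Q\<bar> \<le> (\<integral>x. \<bar>x ^ n\<bar> \<partial>Q)" by (rule integral_abs_bound)
  with * show "\<bar>\<integral>x. x ^ n \<partial>Q\<bar> \<le> R ^ n" by (simp add: power_abs)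
qed

text \<open>The error depends on the law only through \<open>R\<close>, so finitely many moments
  determine the characteristic function uniformly over all laws on the interval.\<close>

lemma char_moment_approx:
  assumes Q: "real_distribution Q" "AE x in Q. \<bar>x\<bar> \<le> R"
  shows "cmod (char Q t - (\<Sum>k\<le>n. ((\<i> * t) ^ k / fact k) * (\<integral>x. x ^ k \<partial>Q))) \<le> 2 * ((\<bar>t\<bar> * R) ^ n / fact n)"
proof -
  interpret real_distribution Q by fact
  note b = integrable_AE_bounded_power[OF Q]
  have "cmod (char Q t - (\<Sum>k\<le>n. ((\<i> * t) ^ k / fact k) * (\<integral>x. x ^ k \<partial>Q)))
      \<le> (2 * \<bar>t\<bar> ^ n / fact n) * (\<integral>x. \<bar>x\<bar> ^ n \<partial>Q)"
    by (rule char_approx1) (rule b)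
  also have "\<dots> \<le> (2 * \<bar>t\<bar> ^ n / fact n) * R ^ n" by (intro mult_left_mono b) auto
  finally show ?thesis by (simp add: power_mult_distrib)
qed

lemma weak_conv_m_of_moments:
  fixes M :: "nat \<Rightarrow> real measure"
  assumes M: "\<And>n. real_distribution (M n)" "\<And>n. AE x in M n. \<bar>x\<bar> \<le> R"
    and Q: "real_distribution Q" "AE x in Q. \<bar>x\<bar> \<le> R"
    and conv: "\<And>k. (\<lambda>n. \<integral>x. x ^ k \<partial>M n) \<longlonglongrightarrow> (\<integral>x. x ^ k \<partial>Q)"
  shows "weak_conv_m M Q"
proof (rule levy_continuity[OF M(1) Q(1)])
  fix t :: real
  define T where "T N P = (\<Sum>k\<le>N. ((\<i> * t) ^ k / fact k) * complex_of_real (\<integral>x. x ^ k \<partial>P))"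
    for N and P :: "real measure"
  have T: "(\<lambda>n. T N (M n)) \<longlonglongrightarrow> T N Q" for N
    unfolding T_def by (intro tendsto_intros conv)
  show "(\<lambda>n. char (M n) t) \<longlonglongrightarrow> char Q t"
  proof (rule LIMSEQ_I)
    fix e :: real assume e: "e > 0"
    have "(\<lambda>n. (\<bar>t\<bar> * R) ^ n / fact n) \<longlonglongrightarrow> 0"
      using summable_LIMSEQ_zero[OF summable_exp[of "\<bar>t\<bar> * R"]] by (simp add: field_simps)
    \<comment> \<open>The truncation error carries a factor 2, so \<open>e / 8\<close> leaves
      \<open>e / 4\<close> for each of the two laws.\<close>
    then have "\<forall>\<^sub>F n in sequentially. (\<bar>t\<bar> * R) ^ n / fact n < e / 8"
      using e by (intro order_tendstoD) auto
    then obtain N where N: "(\<bar>t\<bar> * R) ^ N / fact N < e / 8" by (auto simp: eventually_sequentially)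
    from LIMSEQ_D[OF T[of N], of "e / 4"] e obtain n0 where
      n0: "\<And>n. n \<ge> n0 \<Longrightarrow> cmod (T N (M n) - T N Q) < e / 4" by auto
    show "\<exists>n0. \<forall>n\<ge>n0. cmod (char (M n) t - char Q t) < e"
    proof (intro exI[of _ n0] allI impI)
      fix n assume "n \<ge> n0"
      have "cmod (char (M n) t - char Q t) \<le>
          cmod (char (M n) t - T N (M n)) + cmod (T N (M n) - T N Q) + cmod (char Q t - T N Q)"
        using norm_triangle_ineq[of "char (M n) t - T N (M n)" "T N (M n) - T N Q"]
          norm_triangle_ineq4[of "char (M n) t - T N Q" "char Q t - T N Q"] by simp
      also have "\<dots> < e / 4 + e / 4 + e / 4"
        using char_moment_approx[OF M, of n t N] char_moment_approx[OF Q, of t N] N n0[OF \<open>n \<ge> n0\<close>]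
        unfolding T_def by linarith
      finally show "cmod (char (M n) t - char Q t) < e" using e by simp
    qed
  qed
qed

text \<open>The method of moments applied to the constant sequence \<open>P\<close>.\<close>

lemma real_distribution_eqI_moments:
  assumes P: "real_distribution P" "AE x in P. \<bar>x\<bar> \<le> R"
    and Q: "real_distribution Q" "AE x in Q. \<bar>x\<bar> \<le> R"
    and eq: "\<And>k. (\<integral>x. x ^ k \<partial>P) = (\<integral>x. x ^ k \<partial>Q)"
  shows "P = Q"
proof (rule Levy_uniqueness[OF P(1) Q(1)])
  have "weak_conv_m (\<lambda>_. P) Q"
    by (rule weak_conv_m_of_moments[of "\<lambda>_. P" R]) (use assms in auto)
  from levy_continuity1[OF P(1) Q(1) this] show "char P = char Q"
    by (intro ext) (simp add: LIMSEQ_const_iff)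
qed

lemma moments_of_weak_conv_m:
  fixes M :: "nat \<Rightarrow> real measure"
  assumes M: "\<And>n. real_distribution (M n)" "\<And>n. AE x in M n. \<bar>x\<bar> \<le> R"
    and Q: "real_distribution Q" "AE x in Q. \<bar>x\<bar> \<le> R"
    and w: "weak_conv_m M Q" and R: "R \<ge> 0"
  shows "(\<lambda>n. \<integral>x. x ^ k \<partial>M n) \<longlonglongrightarrow> (\<integral>x. x ^ k \<partial>Q)"
proof -
  \<comment> \<open>Powers are unbounded test functions; clamping to the interval makes them bounded
    and continuous and changes nothing almost everywhere.\<close>
  let ?f = "\<lambda>x. (max (- R) (min R x)) ^ k"
  have "(\<lambda>n. \<integral>x. ?f x \<partial>M n) \<longlonglongrightarrow> (\<integral>x. ?f x \<partial>Q)"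
  proof (rule weak_conv_imp_integral_bdd_continuous_conv[OF M(1) Q(1) w, where B="R ^ k"])
    show "isCont ?f x" for x by (intro continuous_intros)
    show "norm (?f x) \<le> R ^ k" for x
      unfolding norm_power using R by (intro power_mono) auto
  qed
  moreover have "(\<integral>x. ?f x \<partial>P) = (\<integral>x. x ^ k \<partial>P)"
    if P: "real_distribution P" "AE x in P. \<bar>x\<bar> \<le> R" for P
  proof -
    interpret real_distribution P by fact
    have "AE x in P. ?f x = x ^ k"
      using P(2)
    proof eventually_elim
      case (elim x)
      then have "max (- R) (min R x) = x" by linarith
      then show ?case by simp
    qed
    then show ?thesis by (intro integral_cong_AE) auto
  qed
  ultimately show ?thesis using M Q by simp
qed

section \<open>Wasserstein distance and weak convergence on a compact interval\<close>

lemma couplings_distr_pair: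
  assumes "prob_space \<Omega>" "X \<in> borel_measurable \<Omega>" "Y \<in> borel_measurable \<Omega>"
  shows "distr \<Omega> (borel \<Otimes>\<^sub>M borel) (\<lambda>w. (X w :: real, Y w :: real)) \<in>
    couplings (distr \<Omega> borel X) (distr \<Omega> borel Y)"
proof -
  interpret prob_space \<Omega> by fact
  have [measurable]: "X \<in> borel_measurable \<Omega>" "Y \<in> borel_measurable \<Omega>" by fact+
  show ?thesis
    unfolding couplings_def by (auto simp: distr_distr comp_def intro!: prob_space_distr)
qed

lemma wasserstein2_nonneg_le:
  assumes "\<pi> \<in> couplings P Q" "integrable \<pi> (\<lambda>(x, y). (x - y)\<^sup>2)"
  shows "0 \<le> wasserstein2 P Q" "wasserstein2 P Q \<le> sqrt (\<integral>(x, y). (x - y)\<^sup>2 \<partial>\<pi>)"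
proof -
  let ?S = "{sqrt (\<integral>(x, y). (x - y)\<^sup>2 \<partial>\<pi>) | \<pi>.
            \<pi> \<in> couplings P Q \<and> integrable \<pi> (\<lambda>(x, y). (x - y)\<^sup>2)}"
  have nn: "0 \<le> s" if "s \<in> ?S" for s
    using that by (auto intro!: real_sqrt_ge_zero integral_nonneg_AE)
  have bdd: "bdd_below ?S" using nn by (rule bdd_belowI)
  show "0 \<le> wasserstein2 P Q" unfolding wasserstein2_def
    by (rule cInf_greatest) (use assms nn in auto)
  show "wasserstein2 P Q \<le> sqrt (\<integral>(x, y). (x - y)\<^sup>2 \<partial>\<pi>)" unfolding wasserstein2_def
    by (rule cInf_lower[OF _ bdd]) (use assms in auto)
qed

text \<open>Skorohod's representation supplies couplings that converge pointwise, and the common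
  bound \<open>R\<close> allows dominated convergence of their costs.\<close>

lemma wasserstein2_of_weak_conv_m:
  fixes M :: "nat \<Rightarrow> real measure"
  assumes M: "\<And>n. real_distribution (M n)" "\<And>n. AE x in M n. \<bar>x\<bar> \<le> R"
    and Q: "real_distribution Q" "AE x in Q. \<bar>x\<bar> \<le> R"
    and w: "weak_conv_m M Q"
  shows "(\<lambda>n. wasserstein2 (M n) Q) \<longlonglongrightarrow> 0"
proof -
  from Skorohod[OF M(1) Q(1) w] obtain \<Omega> :: "real measure" and Z Y where
    \<Omega>: "prob_space \<Omega>" and Zm: "\<And>n. Z n \<in> borel_measurable \<Omega>" and Zd: "\<And>n. distr \<Omega> borel (Z n) = M n"
    and Ym: "Y \<in> borel_measurable \<Omega>" and Yd: "distr \<Omega> borel Y = Q"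
    and conv: "\<And>x. x \<in> space \<Omega> \<Longrightarrow> (\<lambda>n. Z n x) \<longlonglongrightarrow> Y x" by force
  interpret prob_space \<Omega> by fact
  note [measurable] = Zm Ym
  have Zb: "AE x in \<Omega>. \<bar>Z n x\<bar> \<le> R" for n
    using M(2)[of n] unfolding Zd[of n, symmetric] by (subst (asm) AE_distr_iff) auto
  have Yb: "AE x in \<Omega>. \<bar>Y x\<bar> \<le> R"
    using Q(2) unfolding Yd[symmetric] by (subst (asm) AE_distr_iff) auto
  have bd: "AE x in \<Omega>. norm ((Z n x - Y x)\<^sup>2) \<le> (2 * R)\<^sup>2" for n
    using Zb[of n] Yb
  proof eventually_elim
    case (elim x)
    then have "\<bar>Z n x - Y x\<bar> \<le> 2 * R" by linarith
    then have "\<bar>Z n x - Y x\<bar>\<^sup>2 \<le> (2 * R)\<^sup>2" by (rule power_mono) simp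
    then show ?case by simp
  qed
  define \<pi> where "\<pi> n = distr \<Omega> (borel \<Otimes>\<^sub>M borel) (\<lambda>w. (Z n w, Y w))" for n
  have cp: "\<pi> n \<in> couplings (M n) Q" for n
    using couplings_distr_pair[OF \<Omega> Zm[of n] Ym] unfolding \<pi>_def Zd Yd .
  have int: "integrable \<Omega> (\<lambda>x. (Z n x - Y x)\<^sup>2)" for n
    by (rule integrable_const_bound[OF bd]) measurable
  have int\<pi>: "integrable (\<pi> n) (\<lambda>(x, y). (x - y)\<^sup>2)" for n
    unfolding \<pi>_def using int[of n] by (subst integrable_distr_eq) auto
  have val: "(\<integral>(x, y). (x - y)\<^sup>2 \<partial>\<pi> n) = (\<integral>x. (Z n x - Y x)\<^sup>2 \<partial>\<Omega>)" for n
    unfolding \<pi>_def by (subst integral_distr) auto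
  have "(\<lambda>n. \<integral>x. (Z n x - Y x)\<^sup>2 \<partial>\<Omega>) \<longlonglongrightarrow> (\<integral>x. 0 \<partial>\<Omega>)"
  proof (rule integral_dominated_convergence[where w="\<lambda>_. (2 * R)\<^sup>2"])
    show "AE x in \<Omega>. (\<lambda>n. (Z n x - Y x)\<^sup>2) \<longlonglongrightarrow> 0"
    proof (rule AE_I2)
      fix x assume "x \<in> space \<Omega>"
      then have "(\<lambda>n. (Z n x - Y x)\<^sup>2) \<longlonglongrightarrow> (Y x - Y x)\<^sup>2" by (intro tendsto_intros conv)
      then show "(\<lambda>n. (Z n x - Y x)\<^sup>2) \<longlonglongrightarrow> 0" by simp
    qed
  qed (use bd in auto)
  then have "(\<lambda>n. sqrt (\<integral>x. (Z n x - Y x)\<^sup>2 \<partial>\<Omega>)) \<longlonglongrightarrow> sqrt 0" by (intro tendsto_real_sqrt) simp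
  then show ?thesis
    using wasserstein2_nonneg_le[OF cp int\<pi>] unfolding val
    by (intro tendsto_sandwich[OF _ _ tendsto_const, of 0 "\<lambda>n. wasserstein2 (M n) Q"]) auto
qed

text \<open>Every coupling bounds the difference of the characteristic functions at \<open>t\<close>
  by \<open>\<bar>t\<bar>\<close> times the square root of its cost, because \<open>iexp\<close> is
  1-Lipschitz; the infimum inherits the bound.\<close>

lemma weak_conv_m_of_wasserstein2:
  fixes M :: "nat \<Rightarrow> real measure"
  assumes M: "\<And>n. real_distribution (M n)" "\<And>n. AE x in M n. \<bar>x\<bar> \<le> R"
    and Q: "real_distribution Q" "AE x in Q. \<bar>x\<bar> \<le> R"
    and w: "(\<lambda>n. wasserstein2 (M n) Q) \<longlonglongrightarrow> 0"
  shows "weak_conv_m M Q"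
proof (rule levy_continuity[OF M(1) Q(1)])
  fix t :: real
  have bound: "cmod (char (M n) t - char Q t) \<le> \<bar>t\<bar> * wasserstein2 (M n) Q" for n
  proof (cases "t = 0")
    case True
    interpret Mn: real_distribution "M n" by (rule M)
    interpret Q: real_distribution Q by fact
    show ?thesis using True by (simp add: Mn.char_zero Q.char_zero)
  next
    case False
    interpret Mn: real_distribution "M n" by (rule M)
    interpret Q: real_distribution Q by fact
    interpret P: pair_prob_space "M n" Q ..
    let ?S = "{sqrt (\<integral>(x, y). (x - y)\<^sup>2 \<partial>\<pi>) | \<pi>.
            \<pi> \<in> couplings (M n) Q \<and> integrable \<pi> (\<lambda>(x, y). (x - y)\<^sup>2)}"
    have cpl: "integrable \<pi> (\<lambda>(x, y). (x - y)\<^sup>2) \<and>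
        cmod (char (M n) t - char Q t) \<le> \<bar>t\<bar> * sqrt (\<integral>(x, y). (x - y)\<^sup>2 \<partial>\<pi>)"
      if \<pi>: "\<pi> \<in> couplings (M n) Q" for \<pi>
    proof -
      interpret \<pi>: prob_space \<pi> using \<pi> by (simp add: couplings_def)
      have [measurable_cong]: "sets \<pi> = sets (borel \<Otimes>\<^sub>M borel)"
        and df: "distr \<pi> borel fst = M n" and ds: "distr \<pi> borel snd = Q"
        using \<pi> by (auto simp: couplings_def)
      have b1: "AE z in \<pi>. \<bar>fst z\<bar> \<le> R"
        using M(2)[of n] unfolding df[symmetric] by (subst (asm) AE_distr_iff) auto
      have b2: "AE z in \<pi>. \<bar>snd z\<bar> \<le> R"
        using Q(2) unfolding ds[symmetric] by (subst (asm) AE_distr_iff) auto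
      have bd: "AE z in \<pi>. \<bar>fst z - snd z\<bar> \<le> 2 * R"
        using b1 b2 by eventually_elim linarith
      have i1: "integrable \<pi> (\<lambda>z. \<bar>fst z - snd z\<bar>)"
        by (rule \<pi>.integrable_const_bound[where B="2 * R"]) (use bd in auto)
      have "AE z in \<pi>. norm ((fst z - snd z)\<^sup>2) \<le> (2 * R)\<^sup>2"
        using bd by eventually_elim (use abs_le_square_iff[of _ "2 * R"] in fastforce)
      then have i2: "integrable \<pi> (\<lambda>z. (fst z - snd z)\<^sup>2)"
        by (rule \<pi>.integrable_const_bound) measurable
      have ie: "integrable \<pi> (\<lambda>z. iexp (t * f z))" if "f \<in> borel_measurable \<pi>" for f
        by (rule \<pi>.integrable_const_bound[where B=1]) (use that in auto)
      have "char (M n) t - char Q t = (\<integral>z. iexp (t * fst z) \<partial>\<pi>) - (\<integral>z. iexp (t * snd z) \<partial>\<pi>)"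
        unfolding char_def df[symmetric] ds[symmetric] by (simp add: integral_distr)
      also have "\<dots> = (\<integral>z. iexp (t * fst z) - iexp (t * snd z) \<partial>\<pi>)"
        by (intro Bochner_Integration.integral_diff[symmetric] ie) measurable
      also have "cmod \<dots> \<le> (\<integral>z. \<bar>t\<bar> * \<bar>fst z - snd z\<bar> \<partial>\<pi>)"
      proof (rule Bochner_Integration.integral_norm_bound_integral)
        show "integrable \<pi> (\<lambda>z. iexp (t * fst z) - iexp (t * snd z))"
          by (intro Bochner_Integration.integrable_diff ie) auto
        show "integrable \<pi> (\<lambda>z. \<bar>t\<bar> * \<bar>fst z - snd z\<bar>)" using i1 by (rule integrable_mult_right)
        fix z
        have "iexp (t * fst z) - iexp (t * snd z) = iexp (t * snd z) * (iexp (t * (fst z - snd z)) - 1)"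
          by (simp add: algebra_simps flip: exp_add)
        also have "cmod \<dots> = cmod (iexp (t * (fst z - snd z)) - 1)" by (simp add: norm_mult)
        also have "\<dots> \<le> \<bar>t * (fst z - snd z)\<bar>" using iexp_approx1[of "t * (fst z - snd z)" 0] by simp
        finally show "cmod (iexp (t * fst z) - iexp (t * snd z)) \<le> \<bar>t\<bar> * \<bar>fst z - snd z\<bar>"
          by (simp add: abs_mult)
      qed
      also have "\<dots> = \<bar>t\<bar> * (\<integral>z. \<bar>fst z - snd z\<bar> \<partial>\<pi>)" by simp
      also have "\<dots> \<le> \<bar>t\<bar> * sqrt (\<integral>z. (fst z - snd z)\<^sup>2 \<partial>\<pi>)"
      proof (intro mult_left_mono real_le_rsqrt)
        \<comment> \<open>Nonnegative variance compares the mean distance with the quadratic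
          mean.\<close>
        have "0 \<le> \<pi>.variance (\<lambda>z. \<bar>fst z - snd z\<bar>)" by (rule \<pi>.variance_positive)
        also have "\<dots> = (\<integral>z. (fst z - snd z)\<^sup>2 \<partial>\<pi>) - (\<integral>z. \<bar>fst z - snd z\<bar> \<partial>\<pi>)\<^sup>2"
          using \<pi>.variance_eq[of "\<lambda>z. \<bar>fst z - snd z\<bar>"] i1 i2 by simp
        finally show "(\<integral>z. \<bar>fst z - snd z\<bar> \<partial>\<pi>)\<^sup>2 \<le> (\<integral>z. (fst z - snd z)\<^sup>2 \<partial>\<pi>)" by simp
      qed simp
      finally show ?thesis using i2 by (simp add: case_prod_unfold)
    qed
    \<comment> \<open>The independent coupling shows that the infimum is over a nonempty set;
      without it a lower bound for the elements would say nothing about \<open>Inf\<close>.\<close>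
    have "M n \<Otimes>\<^sub>M Q \<in> couplings (M n) Q"
      unfolding couplings_def
    proof (intro CollectI conjI)
      show "prob_space (M n \<Otimes>\<^sub>M Q)" by (rule P.prob_space_axioms)
      show "sets (M n \<Otimes>\<^sub>M Q) = sets (borel \<Otimes>\<^sub>M borel)" by (intro sets_pair_measure_cong) auto
      have "distr (M n \<Otimes>\<^sub>M Q) (M n) fst = M n" by (rule Q.distr_pair_fst)
      then show "distr (M n \<Otimes>\<^sub>M Q) borel fst = M n" by (metis Mn.events_eq_borel distr_cong)
      show "distr (M n \<Otimes>\<^sub>M Q) borel snd = Q"
      proof (rule measure_eqI)
        fix X assume "X \<in> sets (distr (M n \<Otimes>\<^sub>M Q) borel snd)"
        then have X: "X \<in> sets borel" by simp
        have "emeasure (distr (M n \<Otimes>\<^sub>M Q) borel snd) X = emeasure (M n \<Otimes>\<^sub>M Q) (snd -` X \<inter> space (M n \<Otimes>\<^sub>M Q))"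
          using X by (intro emeasure_distr) auto
        also have "snd -` X \<inter> space (M n \<Otimes>\<^sub>M Q) = space (M n) \<times> X"
          by (auto simp: space_pair_measure)
        also have "emeasure (M n \<Otimes>\<^sub>M Q) \<dots> = emeasure (M n) (space (M n)) * emeasure Q X"
          using X by (intro Q.emeasure_pair_measure_Times) auto
        finally show "emeasure (distr (M n \<Otimes>\<^sub>M Q) borel snd) X = emeasure Q X"
          using Mn.emeasure_space_1 by simp
      qed simp
    qed
    then have ne: "?S \<noteq> {}" using cpl by blast
    have "cmod (char (M n) t - char Q t) / \<bar>t\<bar> \<le> wasserstein2 (M n) Q"
      unfolding wasserstein2_def
    proof (rule cInf_greatest[OF ne])
      fix s assume "s \<in> ?S"
      then obtain \<pi> where s: "s = sqrt (\<integral>(x, y). (x - y)\<^sup>2 \<partial>\<pi>)" "\<pi> \<in> couplings (M n) Q" by blast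
      then show "cmod (char (M n) t - char Q t) / \<bar>t\<bar> \<le> s"
        using cpl[OF s(2)] False by (simp add: field_simps)
    qed
    then show ?thesis using False by (simp add: field_simps)
  qed
  have "(\<lambda>n. \<bar>t\<bar> * wasserstein2 (M n) Q) \<longlonglongrightarrow> \<bar>t\<bar> * 0" by (intro tendsto_intros w)
  then have "(\<lambda>n. \<bar>t\<bar> * wasserstein2 (M n) Q) \<longlonglongrightarrow> 0" by simp
  then have "(\<lambda>n. char (M n) t - char Q t) \<longlonglongrightarrow> 0"
    by (rule Lim_null_comparison[rotated]) (intro always_eventually allI bound)
  then show "(\<lambda>n. char (M n) t) \<longlonglongrightarrow> char Q t" by (rule LIM_zero_cancel)
qed

section \<open>The Hausdorff moment problem on the unit interval\<close>

lemma abs_power_minus_binomial_ratio_le: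
  assumes "k \<le> n" "2 * j < n"
  shows "\<bar>(real k / real n) ^ j - real (k choose j) / real (n choose j)\<bar> \<le> real (j * j) / real (n - j)"
proof -
  have c: "real (a choose j) = (\<Prod>i\<in>{0..<j}. real a - real i) / fact j" for a
    by (simp only: binomial_gbinomial gbinomial_prod_rev)
  have pos: "real n - real i > 0" if "i < j" for i using that assms by simp
  have "real (k choose j) / real (n choose j) = (\<Prod>i\<in>{0..<j}. (real k - real i) / (real n - real i))"
    unfolding c by (simp add: prod_dividef)
  moreover have "(real k / real n) ^ j = (\<Prod>i\<in>{0..<j}. real k / real n)" by simp
  ultimately have "\<bar>(real k / real n) ^ j - real (k choose j) / real (n choose j)\<bar> =
      norm ((\<Prod>i\<in>{0..<j}. real k / real n) - (\<Prod>i\<in>{0..<j}. (real k - real i) / (real n - real i)))"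
    by (simp only: real_norm_def)
  also have "\<dots> \<le> (\<Sum>i\<in>{0..<j}. norm (real k / real n - (real k - real i) / (real n - real i)))"
  proof (rule norm_prod_diff)
    show "norm (real k / real n) \<le> 1" if "i \<in> {0..<j}" for i using assms by simp
    \<comment> \<open>A factor with \<open>k < i\<close> is negative, and \<open>2 * j < n\<close>
      keeps its modulus at most 1. Then the difference of the products is at most the sum of the
      differences of the factors.\<close>
    show "norm ((real k - real i) / (real n - real i)) \<le> 1" if "i \<in> {0..<j}" for i
    proof -
      have "\<bar>real k - real i\<bar> \<le> real n - real i" using that assms by (auto simp: abs_le_iff)
      then show ?thesis using pos[of i] that by (auto simp: abs_divide divide_le_eq_1)
    qed
  qed
  also have "\<dots> \<le> (\<Sum>i\<in>{0..<j}. real j / real (n - j))"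
  proof (rule sum_mono)
    fix i assume i: "i \<in> {0..<j}"
    have "real k / real n - (real k - real i) / (real n - real i) =
        (real i * ((real n - real k) / real n)) / (real n - real i)"
      using i assms pos[of i] by (simp add: field_simps)
    also have "norm \<dots> \<le> (real j * 1) / (real n - real j)"
      unfolding real_norm_def abs_divide abs_mult
      using i assms pos[of i] by (intro frac_le mult_mono) (auto simp: field_simps)
    finally show "norm (real k / real n - (real k - real i) / (real n - real i)) \<le> real j / real (n - j)"
      using assms by simp
  qed
  also have "\<dots> = real (j * j) / real (n - j)" by simp
  finally show ?thesis .
qed

text \<open>
  The law is a weak limit of the discrete measures that put the mass of the Bernstein
  polynomial number \<open>k\<close> of degree \<open>n\<close> at \<open>k / n\<close>.
\<close>

lemma Hausdorff_moment_unit_interval: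
  fixes L :: "real poly \<Rightarrow> real"
  assumes add: "\<And>p q. L (p + q) = L p + L q" and smult: "\<And>c p. L (Polynomial.smult c p) = c * L p"
    and one: "L 1 = 1"
    and pos: "\<And>k l. L ([:0, 1:] ^ k * [:1, -1:] ^ l) \<ge> 0"
  shows "\<exists>M. real_distribution M \<and> (AE x in M. 0 \<le> x \<and> x \<le> 1) \<and> (\<forall>j. (\<integral>x. x ^ j \<partial>M) = L ([:0, 1:] ^ j))"
proof -
  let ?X = "[:0, 1:] :: real poly" and ?Y = "[:1, -1:] :: real poly"
  have XY: "?X + ?Y = 1" by (simp add: one_pCons)
  have zero: "L 0 = 0" using add[of 0 0] by simp
  have Lsum: "L (sum f I) = (\<Sum>i\<in>I. L (f i))" for f and I :: "nat set"
    by (induction I rule: infinite_finite_induct) (auto simp: zero add)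
  have Lof_nat: "L (of_nat c * p) = real c * L p" for c p
    using smult[of "real c" p] by (simp add: of_nat_poly)
  define w where "w n k = real (n choose k) * L (?X ^ k * ?Y ^ (n - k))" for n k
  have w0: "w n k \<ge> 0" for n k unfolding w_def by (intro mult_nonneg_nonneg pos) simp
  \<comment> \<open>The factorial moments of the weights are exact: absorbing the binomial
    coefficients leaves \<open>(?X + ?Y) ^ (n - j)\<close>, which is 1.\<close>
  have wsum: "(\<Sum>k\<le>n. real (k choose j) * w n k) = real (n choose j) * L (?X ^ j)" if jn: "j \<le> n" for n j
  proof -
    have "(\<Sum>k\<le>n. of_nat (k choose j) * (of_nat (n choose k) * (?X ^ k * ?Y ^ (n - k)))) =
        (\<Sum>k\<in>{j..n}. of_nat (k choose j) * (of_nat (n choose k) * (?X ^ k * ?Y ^ (n - k))))"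
      using jn by (intro sum.mono_neutral_right) auto
    also have "\<dots> = (\<Sum>l\<le>n - j. of_nat (n choose j) * ?X ^ j * (of_nat (n - j choose l) * ?X ^ l * ?Y ^ (n - j - l)))"
    proof (rule sum.reindex_bij_witness[of _ "\<lambda>l. l + j" "\<lambda>k. k - j"])
      fix k assume k: "k \<in> {j..n}"
      have "(n choose k) * (k choose j) = (n choose j) * (n - j choose (k - j))"
        using k by (intro choose_mult) auto
      then have "of_nat (k choose j) * of_nat (n choose k) = (of_nat ((n choose j) * (n - j choose (k - j))) :: real poly)"
        by (metis of_nat_mult mult.commute)
      moreover have "?X ^ k = ?X ^ j * ?X ^ (k - j)" using k by (simp flip: power_add)
      moreover have "n - j - (k - j) = n - k" using k by simp
      ultimately show "of_nat (n choose j) * ?X ^ j * (of_nat (n - j choose (k - j)) * ?X ^ (k - j) * ?Y ^ (n - j - (k - j)))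
          = of_nat (k choose j) * (of_nat (n choose k) * (?X ^ k * ?Y ^ (n - k)))"
        by (simp only: mult.assoc[symmetric] of_nat_mult) (simp only: ac_simps)
    qed (use jn in auto)
    also have "\<dots> = of_nat (n choose j) * ?X ^ j * (?X + ?Y) ^ (n - j)"
      by (simp only: binomial_ring sum_distrib_left)
    finally have "L (\<Sum>k\<le>n. of_nat (k choose j) * (of_nat (n choose k) * (?X ^ k * ?Y ^ (n - k)))) =
        L (of_nat (n choose j) * ?X ^ j)" by (simp only: XY) simp
    then show ?thesis by (simp only: Lsum Lof_nat w_def mult.assoc)
  qed
  have w1: "(\<Sum>k\<le>n. w n k) = 1" for n using wsum[of 0 n] one by simp
  define \<mu> where "\<mu> n = distr (point_measure {..n} (\<lambda>k. ennreal (w n k))) borel (\<lambda>k. real k / real n)" for n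
  have pm: "prob_space (point_measure {..n} (\<lambda>k. ennreal (w n k)))" for n
    by (rule prob_spaceI)
      (simp add: space_point_measure emeasure_point_measure_finite sum_ennreal w0 w1)
  have rd: "real_distribution (\<mu> n)" for n
    unfolding \<mu>_def by (intro prob_space.real_distribution_distr pm) (simp add: measurable_point_measure_eq1)
  have E: "(\<integral>x. g x \<partial>\<mu> n) = (\<Sum>k\<le>n. w n k * g (real k / real n))"
    if [measurable]: "g \<in> borel_measurable borel" for n and g :: "real \<Rightarrow> real"
    unfolding \<mu>_def by (subst integral_distr)
      (auto simp: measurable_point_measure_eq1 lebesgue_integral_point_measure_finite w0)
  have AE01: "AE x in \<mu> n. 0 \<le> x \<and> x \<le> 1" for n
    unfolding \<mu>_def
    by (subst AE_distr_iff) (auto simp: measurable_point_measure_eq1 AE_point_measure divide_le_eq_1)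
  have conv: "(\<lambda>n. \<integral>x. x ^ j \<partial>\<mu> n) \<longlonglongrightarrow> L (?X ^ j)" for j
  proof -
    have bd: "\<bar>(\<integral>x. x ^ j \<partial>\<mu> n) - L (?X ^ j)\<bar> \<le> real (j * j) / real (n - j)" if n: "n > 2 * j" for n
    proof -
      have "L (?X ^ j) = (\<Sum>k\<le>n. w n k * (real (k choose j) / real (n choose j)))"
        using wsum[of j n] n by (simp add: field_simps flip: sum_divide_distrib)
      then have "(\<integral>x. x ^ j \<partial>\<mu> n) - L (?X ^ j) =
          (\<Sum>k\<le>n. w n k * ((real k / real n) ^ j - real (k choose j) / real (n choose j)))"
        by (subst E) (auto simp: right_diff_distrib sum_subtractf)
      also have "\<bar>\<dots>\<bar> \<le> (\<Sum>k\<le>n. w n k * (real (j * j) / real (n - j)))"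
      proof (rule order_trans[OF sum_abs sum_mono])
        fix k assume "k \<in> {..n}"
        then have "\<bar>(real k / real n) ^ j - real (k choose j) / real (n choose j)\<bar> \<le> real (j * j) / real (n - j)"
          using n by (intro abs_power_minus_binomial_ratio_le) auto
        from mult_left_mono[OF this w0[of n k]]
        show "\<bar>w n k * ((real k / real n) ^ j - real (k choose j) / real (n choose j))\<bar>
            \<le> w n k * (real (j * j) / real (n - j))"
          using w0[of n k] by (simp only: abs_mult abs_of_nonneg)
      qed
      also have "\<dots> = real (j * j) / real (n - j)" by (subst sum_distrib_right[symmetric]) (simp only: w1 mult_1)
      finally show ?thesis .
    qed
    have "(\<lambda>n. real (j * j) / real n) \<longlonglongrightarrow> 0" by (rule lim_const_over_n)
    then have "(\<lambda>n. real (j * j) / real (n - j)) \<longlonglongrightarrow> 0"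
      by (intro LIMSEQ_offset[where k=j and f="\<lambda>n. real (j * j) / real (n - j)"]) simp
    then have "(\<lambda>n. (\<integral>x. x ^ j \<partial>\<mu> n) - L (?X ^ j)) \<longlonglongrightarrow> 0"
      by (rule Lim_null_comparison[rotated])
        (use bd in \<open>auto intro!: eventually_sequentiallyI[of "Suc (2 * j)"]\<close>)
    then show ?thesis by (rule LIM_zero_cancel)
  qed
  \<comment> \<open>All masses sit in one bounded interval, so some subsequence converges weakly;
    its limit is the required law.\<close>
  have "tight \<mu>"
    unfolding tight_def
  proof (intro conjI allI impI rd)
    fix e :: real assume e: "e > 0"
    have "measure (\<mu> n) {-1<..1} = 1" for n
    proof -
      interpret real_distribution "\<mu> n" by (rule rd)
      have "AE x in \<mu> n. x \<in> {-1<..1}" using AE01[of n] by eventually_elim auto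
      then show ?thesis by (subst prob_eq_1) auto
    qed
    then show "\<exists>a b. a < b \<and> (\<forall>n. 1 - e < measure (\<mu> n) {a<..b})"
      using e by (intro exI[of _ "-1"] exI[of _ 1]) auto
  qed
  from tight_imp_convergent_subsubsequence[OF this strict_mono_id] obtain r M where
    r: "strict_mono r" and M: "real_distribution M" and wc: "weak_conv_m (\<mu> \<circ> id \<circ> r) M" by blast
  have wc: "weak_conv_m (\<lambda>n. \<mu> (r n)) M" using wc by (simp add: comp_def)
  interpret M: real_distribution M by fact
  \<comment> \<open>A bounded continuous function that vanishes exactly on the unit interval; its
    integral carries the support over to the weak limit.\<close>
  define f :: "real \<Rightarrow> real" where "f x = min 1 (max 0 (- x) + max 0 (x - 1))" for x
  have f_cont: "isCont f x" for x unfolding f_def by (intro continuous_intros)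
  have f01: "0 \<le> f x" "f x \<le> 1" for x by (auto simp: f_def)
  have f0: "f x = 0 \<longleftrightarrow> 0 \<le> x \<and> x \<le> 1" for x by (auto simp: f_def min_def max_def)
  have [measurable]: "f \<in> borel_measurable borel"
    by (intro borel_measurable_continuous_onI continuous_at_imp_continuous_on ballI f_cont)
  have "(\<lambda>n. \<integral>x. f x \<partial>\<mu> (r n)) \<longlonglongrightarrow> (\<integral>x. f x \<partial>M)"
    by (rule weak_conv_imp_integral_bdd_continuous_conv[OF rd M wc, where B=1])
      (use f_cont f01 in auto)
  moreover have "(\<integral>x. f x \<partial>\<mu> n) = 0" for n
  proof -
    have "AE x in \<mu> n. f x = 0" using AE01[of n] by eventually_elim (simp add: f0)
    then show ?thesis by (rule integral_eq_zero_AE)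
  qed
  ultimately have int0: "(\<integral>x. f x \<partial>M) = 0" by (simp add: LIMSEQ_const_iff)
  have "integrable M f"
    by (rule M.integrable_const_bound[where B=1]) (use f01 in auto)
  from integral_nonneg_eq_0_iff_AE[OF this] int0 f01 have "AE x in M. f x = 0" by blast
  then have AE: "AE x in M. 0 \<le> x \<and> x \<le> 1" by (simp only: f0)
  have lim1: "(\<lambda>n. \<integral>x. x ^ j \<partial>\<mu> (r n)) \<longlonglongrightarrow> (\<integral>x. x ^ j \<partial>M)" for j
  proof (rule moments_of_weak_conv_m[OF rd _ M _ wc, where R=1])
    show "AE x in \<mu> (r n). \<bar>x\<bar> \<le> 1" for n using AE01[of "r n"] by eventually_elim auto
    show "AE x in M. \<bar>x\<bar> \<le> 1" using AE by eventually_elim auto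
  qed simp
  have lim2: "(\<lambda>n. \<integral>x. x ^ j \<partial>\<mu> (r n)) \<longlonglongrightarrow> L (?X ^ j)" for j
    using LIMSEQ_subseq_LIMSEQ[OF conv r] by (simp add: comp_def)
  show ?thesis
    by (intro exI[of _ M] conjI allI M AE LIMSEQ_unique[OF lim1 lim2])
qed

section \<open>Polynomials of an operator and existence of its law\<close>

definition poly_bop :: "real poly \<Rightarrow> 'h :: complex_hilbert_space bop \<Rightarrow> 'h bop" where
  "poly_bop p T = fold_coeffs (\<lambda>a x. complex_of_real a *\<^sub>C 1 + T * x) p 0"

lemma poly_bop_0 [simp]: "poly_bop 0 T = 0"
  by (simp add: poly_bop_def)

lemma poly_bop_pCons [simp]: "poly_bop (pCons a p) T = complex_of_real a *\<^sub>C 1 + T * poly_bop p T"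
  by (cases "p = 0 \<and> a = 0") (auto simp: poly_bop_def bop_scaleC)

lemma poly_bop_1 [simp]: "poly_bop 1 T = 1"
  by (simp add: one_pCons bop_scaleC)

lemma poly_bop_add: "poly_bop (p + q) T = poly_bop p T + poly_bop q T"
  by (induction p q rule: poly_induct2) (simp_all add: bop_scaleC distrib_left algebra_simps)

lemma poly_bop_smult: "poly_bop (Polynomial.smult c p) T = complex_of_real c *\<^sub>C poly_bop p T"
  by (induction p) (simp_all add: bop_scaleC)

lemma poly_bop_mult: "poly_bop (p * q) T = poly_bop p T * poly_bop q T"
  by (induction p)
    (simp_all add: mult_pCons_left poly_bop_add poly_bop_smult bop_scaleC distrib_right mult.assoc)

lemma poly_bop_power: "poly_bop (p ^ n) T = poly_bop p T ^ n"
  by (induction n) (simp_all add: poly_bop_mult)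

lemma poly_bop_commute: "T * poly_bop p T = poly_bop p T * T"
proof (induction p)
  case (pCons a p)
  have "T * (T * poly_bop p T) = T * (poly_bop p T * T)" using pCons by simp
  also have "\<dots> = (T * poly_bop p T) * T" by (simp only: mult.assoc)
  finally have "T * (T * poly_bop p T) = (T * poly_bop p T) * T" .
  then show ?case by (simp add: bop_scaleC distrib_left distrib_right)
qed simp

lemma poly_bop_closed: "unital_subalgebra B \<Longrightarrow> T \<in> B \<Longrightarrow> poly_bop p T \<in> B"
  by (induction p) (auto intro: unital_subalgebraD unital_subalgebra_closed)

lemma self_adjoint_poly_bop:
  assumes "self_adjoint T" shows "self_adjoint (poly_bop p T)"
proof (induction p)
  case (pCons a p)
  have "is_adjoint (T * poly_bop p T) (poly_bop p T * T)"
    using assms pCons by (simp add: self_adjoint_def is_adjoint_times)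
  then have "self_adjoint (T * poly_bop p T)" by (simp add: self_adjoint_def poly_bop_commute)
  then show ?case by (simp add: self_adjoint_add self_adjoint_of_real self_adjoint_one)
qed (simp add: self_adjoint_zero)

lemma onorm_power_times_le:
  "onorm (bop_apply (T ^ n * W)) \<le> onorm (bop_apply T) ^ n * onorm (bop_apply (W :: 'h :: complex_hilbert_space bop))"
proof (induction n)
  case (Suc n)
  have bl: "bounded_linear (bop_apply (S :: 'h bop))" for S using bop_apply[of S] by simp
  have "onorm (bop_apply (T ^ Suc n * W)) = onorm (bop_apply T \<circ> bop_apply (T ^ n * W))"
    by (simp add: times_bop.rep_eq comp_def mult.assoc)
  also have "\<dots> \<le> onorm (bop_apply T) * onorm (bop_apply (T ^ n * W))" by (rule onorm_compose[OF bl bl])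
  also have "\<dots> \<le> onorm (bop_apply T) * (onorm (bop_apply T) ^ n * onorm (bop_apply W))"
    by (intro mult_left_mono Suc onorm_pos_le bl)
  finally show ?case by simp
qed simp

context free_probability_space
begin

lemma state_self_adjoint: "T \<in> A \<Longrightarrow> self_adjoint T \<Longrightarrow> \<phi> T = complex_of_real (Re (\<phi> T))"
  using state_adj[of T] by (simp add: self_adjoint_adj complex_eq_iff)

lemma has_nc_law_poly:
  assumes Q: "has_nc_law \<phi> T Q" and T: "T \<in> A"
  shows "\<phi> (poly_bop p T) = complex_of_real (\<integral>x. poly p x \<partial>Q)"
proof -
  \<comment> \<open>The additional power of \<open>x\<close> absorbs the factor that
    \<open>pCons\<close> peels off in the induction.\<close>
  have *: "integrable Q (\<lambda>x. x ^ n * poly p x) \<and>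
      \<phi> (T ^ n * poly_bop p T) = complex_of_real (\<integral>x. x ^ n * poly p x \<partial>Q)" for n
  proof (induction p arbitrary: n)
    case 0
    then show ?case by (simp add: state_zero)
  next
    case (pCons a p)
    have int: "integrable Q (\<lambda>x. x ^ n)" and m: "\<phi> (T ^ n) = complex_of_real (\<integral>x. x ^ n \<partial>Q)" for n
      using Q by (auto simp: has_nc_law_def)
    have eq: "x ^ n * poly (pCons a p) x = a * x ^ n + x ^ Suc n * poly p x" for x :: real
      by (simp add: algebra_simps)
    have "T ^ n * poly_bop (pCons a p) T = complex_of_real a *\<^sub>C T ^ n + T ^ Suc n * poly_bop p T"
      by (simp add: distrib_left bop_scaleC mult.assoc power_commutes flip: mult.assoc)
    then have "\<phi> (T ^ n * poly_bop (pCons a p) T) = a * \<phi> (T ^ n) + \<phi> (T ^ Suc n * poly_bop p T)"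
      using T by (simp add: state_add state_scaleC A_intros poly_bop_closed[OF subalgebra_A])
    then show ?case
      using pCons.IH[of "Suc n"] int[of n] m[of n] unfolding eq by simp
  qed
  from *[of 0] show ?thesis by simp
qed

text \<open>The functional sending \<open>p\<close> to the state of \<open>p(T)\<close> is
  nonnegative on squares. Its nonnegativity on products of powers of \<open>R + X\<close> and
  \<open>R - X\<close> is then extracted from the norm bound, and Hausdorff's theorem applies after
  an affine change of variable.\<close>

lemma has_nc_law_exists:
  assumes T: "T \<in> A" "self_adjoint T"
  shows "\<exists>Q. has_nc_law \<phi> T Q"
proof -
  define P where "P p = poly_bop p T" for p
  have PA: "P p \<in> A" for p unfolding P_def by (intro poly_bop_closed subalgebra_A T)
  have Psa: "adj (P p) = P p" for p unfolding P_def by (intro self_adjoint_adj self_adjoint_poly_bop T)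
  define L where "L p = Re (\<phi> (P p))" for p
  have L: "\<phi> (P p) = complex_of_real (L p)" for p
    unfolding L_def P_def by (intro state_self_adjoint self_adjoint_poly_bop T poly_bop_closed subalgebra_A)
  have Ladd: "L (p + q) = L p + L q" for p q
    using PA by (simp add: L_def P_def poly_bop_add state_add)
  have Lsmult: "L (Polynomial.smult c p) = c * L p" for c p
    using PA by (simp add: L_def P_def poly_bop_smult state_scaleC)
  have L1: "L 1 = 1" by (simp add: L_def P_def state_one)
  have norm2P: "(norm2 (P p))\<^sup>2 = L (p * p)" for p
    using norm2_sq[OF PA, of p] L[of "p * p"] unfolding Psa
    by (simp add: P_def poly_bop_mult flip: of_real_power)
  have Lsq: "0 \<le> L (p * p)" for p unfolding norm2P[symmetric] by simp
  have LCS: "(L (p * q))\<^sup>2 \<le> L (p * p) * L (q * q)" for p q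
  proof -
    have "\<bar>L (p * q)\<bar> \<le> norm2 (P p) * norm2 (P q)"
      using Cauchy_Schwarz[OF PA PA, of p q] L[of "p * q"] unfolding Psa
      by (simp add: P_def poly_bop_mult)
    then have "\<bar>L (p * q)\<bar>\<^sup>2 \<le> (norm2 (P p) * norm2 (P q))\<^sup>2" by (rule power_mono) simp
    then show ?thesis by (simp add: power_mult_distrib norm2P)
  qed
  obtain K where K: "K > 0" "\<And>S. S \<in> A \<Longrightarrow> cmod (\<phi> S) \<le> K * onorm (bop_apply S)"
    using state_norm_bound by blast
  define R where "R = onorm (bop_apply T) + 1"
  have onn: "0 \<le> onorm (bop_apply T)" using onorm_pos_le bop_apply[of T] by auto
  have R: "R > 0" "R \<ge> 1" "onorm (bop_apply T) \<le> R" using onn by (auto simp: R_def)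
  let ?X = "[:0, 1:] :: real poly"
  have PX: "P (?X ^ k * q) = T ^ k * P q" for k q
    by (simp add: P_def poly_bop_mult poly_bop_power bop_scaleC)
  have bound: "L (?X ^ k * q) \<le> (K * onorm (bop_apply (P q))) * R ^ k" for k q
  proof -
    have "L (?X ^ k * q) \<le> cmod (\<phi> (P (?X ^ k * q)))" unfolding L by simp
    also have "\<dots> \<le> K * onorm (bop_apply (T ^ k * P q))" unfolding PX[symmetric] by (intro K PA)
    also have "\<dots> \<le> K * (onorm (bop_apply T) ^ k * onorm (bop_apply (P q)))"
      using K by (intro mult_left_mono onorm_power_times_le) auto
    also have "\<dots> \<le> K * (R ^ k * onorm (bop_apply (P q)))"
      using K R onn onorm_pos_le bop_apply[of "P q"] by (intro mult_left_mono mult_right_mono power_mono) auto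
    finally show ?thesis by (simp add: mult_ac)
  qed
  \<comment> \<open>By Cauchy-Schwarz the numbers \<open>a k\<close> are log-convex. If
    \<open>a 1\<close> exceeded \<open>R\<^sup>2 * a 0\<close>, they would grow at a geometric rate
    above \<open>R\<^sup>2\<close>, against the bound of order \<open>R ^ (2 * k)\<close> from the
    operator norm.\<close>
  have LX2: "L (?X ^ 2 * (q * q)) \<le> R\<^sup>2 * L (q * q)" for q
  proof (rule ccontr)
    define a where "a k = L (?X ^ (2 * k) * (q * q))" for k
    assume "\<not> ?thesis"
    then have gt: "a 1 > R\<^sup>2 * a 0" by (simp add: a_def)
    have sqr: "?X ^ (2 * k) * (q * q) = (?X ^ k * q) * (?X ^ k * q)" for k
      by (simp add: power_mult power2_eq_square power_mult_distrib algebra_simps)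
    have ann: "a k \<ge> 0" for k unfolding a_def sqr by (rule Lsq)
    have aCS: "(a (Suc k))\<^sup>2 \<le> a k * a (Suc (Suc k))" for k
      using LCS[of "?X ^ k * q" "?X ^ Suc (Suc k) * q"] unfolding a_def sqr by (simp add: algebra_simps)
    have a0: "a 0 > 0"
    proof (rule ccontr)
      assume "\<not> a 0 > 0"
      then have "a 0 = 0" using ann[of 0] by simp
      with aCS[of 0] gt show False by simp
    qed
    define \<rho> where "\<rho> = a 1 / a 0"
    have \<rho>: "\<rho> > R\<^sup>2" using gt a0 by (simp add: \<rho>_def field_simps)
    then have \<rho>0: "\<rho> > 0" using R by (meson le_less_trans zero_le_power2)
    have step: "a k > 0 \<and> a (Suc k) \<ge> \<rho> * a k" for k
    proof (induction k)
      case 0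
      then show ?case using a0 by (simp add: \<rho>_def)
    next
      case (Suc k)
      then have p: "a (Suc k) > 0" using \<rho>0 by (meson less_le_trans mult_pos_pos)
      have "\<rho> * a k * a (Suc k) \<le> a (Suc k) * a (Suc k)" using Suc p by (intro mult_right_mono) auto
      also have "\<dots> \<le> a k * a (Suc (Suc k))" using aCS[of k] by (simp add: power2_eq_square)
      finally have "a k * (\<rho> * a (Suc k)) \<le> a k * a (Suc (Suc k))" by (simp add: mult_ac)
      then show ?case using p Suc by simp
    qed
    have low: "a k \<ge> \<rho> ^ k * a 0" for k
    proof (induction k)
      case (Suc k)
      have "\<rho> ^ Suc k * a 0 \<le> \<rho> * a k" using Suc \<rho>0 by simp
      also have "\<dots> \<le> a (Suc k)" using step by blast
      finally show ?case .
    qed simp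
    define D where "D = K * onorm (bop_apply (P (q * q)))"
    have le: "(\<rho> / R\<^sup>2) ^ k \<le> D / a 0" for k
    proof -
      have "\<rho> ^ k * a 0 \<le> D * R ^ (2 * k)"
        using low[of k] bound[of "2 * k" "q * q"] unfolding a_def D_def by linarith
      then show ?thesis using a0 R by (simp add: field_simps flip: power_mult)
    qed
    have "1 < \<rho> / R\<^sup>2" using \<rho> R by simp
    then obtain k where "D / a 0 < (\<rho> / R\<^sup>2) ^ k" using real_arch_pow by blast
    with le[of k] show False by simp
  qed
  let ?U = "[:R, 1:]" and ?V = "[:R, -1:]"
  have UpV: "?U + ?V = [:2 * R:]" by simp
  have UV: "0 \<le> L ((?U * ?V) * (q * q))" for q
  proof -
    have "(?U * ?V) * (q * q) = Polynomial.smult (R\<^sup>2) (q * q) + Polynomial.smult (-1) (?X ^ 2 * (q * q))"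
      by (simp add: power2_eq_square algebra_simps)
    then have "L ((?U * ?V) * (q * q)) = R\<^sup>2 * L (q * q) + (-1) * L (?X ^ 2 * (q * q))"
      by (simp only: Ladd Lsmult)
    then show ?thesis using LX2[of q] by linarith
  qed
  \<comment> \<open>Since \<open>?U + ?V\<close> is the constant \<open>2 * R\<close>, the product
    \<open>?U * (q * q)\<close> is a positive multiple of a square plus \<open>?U * ?V\<close> times
    a square.\<close>
  have U: "0 \<le> L (?U * (q * q))" for q
  proof -
    have "(?U + ?V) * (?U * (q * q)) = (?U * q) * (?U * q) + (?U * ?V) * (q * q)"
      by (simp only: distrib_left distrib_right ac_simps)
    then have "Polynomial.smult (2 * R) (?U * (q * q)) = (?U * q) * (?U * q) + (?U * ?V) * (q * q)"
      by (simp only: UpV mult_pCons_left mult_zero_left pCons_0_0 add_0_right)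
    then have "2 * R * L (?U * (q * q)) = L ((?U * q) * (?U * q)) + L ((?U * ?V) * (q * q))"
      by (metis Ladd Lsmult)
    then have "2 * R * L (?U * (q * q)) \<ge> 0" using Lsq UV by simp
    then show ?thesis using R by (simp add: zero_le_mult_iff)
  qed
  have V: "0 \<le> L (?V * (q * q))" for q
  proof -
    have "(?U + ?V) * (?V * (q * q)) = (?V * q) * (?V * q) + (?U * ?V) * (q * q)"
      by (simp only: distrib_left distrib_right ac_simps)
    then have "Polynomial.smult (2 * R) (?V * (q * q)) = (?V * q) * (?V * q) + (?U * ?V) * (q * q)"
      by (simp only: UpV mult_pCons_left mult_zero_left pCons_0_0 add_0_right)
    then have "2 * R * L (?V * (q * q)) = L ((?V * q) * (?V * q)) + L ((?U * ?V) * (q * q))"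
      by (metis Ladd Lsmult)
    then have "2 * R * L (?V * (q * q)) \<ge> 0" using Lsq UV by simp
    then show ?thesis using R by (simp add: zero_le_mult_iff)
  qed
  \<comment> \<open>Extracting squares reduces both exponents to 0 or 1, and these four cases are
    \<open>Lsq\<close>, \<open>U\<close>, \<open>V\<close> and \<open>UV\<close>.\<close>
  have pos: "0 \<le> L (?U ^ k * ?V ^ l)" for k l
  proof -
    define q where "q = ?U ^ (k div 2) * ?V ^ (l div 2)"
    have ev: "p ^ n = p ^ (n mod 2) * (p ^ (n div 2) * p ^ (n div 2))" for p :: "real poly" and n
      by (metis (no_types) div_mult_mod_eq mult.commute mult_2_right power_add)
    have eq: "?U ^ k * ?V ^ l = (?U ^ (k mod 2) * ?V ^ (l mod 2)) * (q * q)"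
      unfolding q_def by (subst ev[of ?U k], subst ev[of ?V l]) (simp only: ac_simps)
    have "k mod 2 = 0 \<or> k mod 2 = 1" "l mod 2 = 0 \<or> l mod 2 = 1" by auto
    then show ?thesis unfolding eq using Lsq[of q] U[of q] V[of q] UV[of q] by (elim disjE) simp_all
  qed
  \<comment> \<open>The substitution \<open>(R + x) / (2 * R)\<close>, which maps the interval from
    \<open>-R\<close> to \<open>R\<close> onto the unit interval and turns \<open>X\<close> and
    \<open>1 - X\<close> into multiples of \<open>?U\<close> and \<open>?V\<close>. The measure
    \<open>Q\<close> below is pushed forward by its inverse.\<close>
  let ?c = "[:1 / 2, 1 / (2 * R):]"
  define L' where "L' p = L (pcompose p ?c)" for p
  have pc_power: "pcompose (p ^ n) r = pcompose p r ^ n" for p r :: "real poly" and n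
    by (induction n) (simp_all add: pcompose_mult pcompose_1)
  have "\<exists>M. real_distribution M \<and> (AE x in M. 0 \<le> x \<and> x \<le> 1) \<and> (\<forall>j. (\<integral>x. x ^ j \<partial>M) = L' (?X ^ j))"
  proof (rule Hausdorff_moment_unit_interval)
    show "L' (p + q) = L' p + L' q" for p q by (simp add: L'_def pcompose_add Ladd)
    show "L' (Polynomial.smult c p) = c * L' p" for c p by (simp add: L'_def pcompose_smult Lsmult)
    show "L' 1 = 1" by (simp add: L'_def pcompose_1 L1)
    show "L' ([:0, 1:] ^ k * [:1, -1:] ^ l) \<ge> 0" for k l
    proof -
      have "pcompose [:0, 1:] ?c = Polynomial.smult (1 / (2 * R)) ?U" "pcompose [:1, -1:] ?c = Polynomial.smult (1 / (2 * R)) ?V"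
        using R by (auto simp: pcompose_pCons)
      then have "L' ([:0, 1:] ^ k * [:1, -1:] ^ l) = L (Polynomial.smult ((1 / (2 * R)) ^ k * (1 / (2 * R)) ^ l) (?U ^ k * ?V ^ l))"
        by (simp only: L'_def pcompose_mult pc_power smult_power mult_smult_left mult_smult_right smult_smult mult_ac)
      then show ?thesis using pos[of k l] R by (simp add: Lsmult)
    qed
  qed
  then obtain M where M: "real_distribution M" and M01: "AE x in M. 0 \<le> x \<and> x \<le> 1"
    and Mm: "\<And>j. (\<integral>x. x ^ j \<partial>M) = L' (?X ^ j)" by blast
  interpret M: real_distribution M by fact
  have M1: "AE x in M. \<bar>x\<bar> \<le> 1" using M01 by eventually_elim auto
  have Mp: "integrable M (\<lambda>x. x ^ n * poly p x) \<and> (\<integral>x. x ^ n * poly p x \<partial>M) = L' (?X ^ n * p)" for n p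
  proof (induction p arbitrary: n)
    case 0
    then show ?case using Lsmult[of 0 0] by (simp add: L'_def)
  next
    case (pCons a p)
    have int: "integrable M (\<lambda>x. x ^ n)" by (rule integrable_AE_bounded_power[OF M M1])
    have eq: "x ^ n * poly (pCons a p) x = a * x ^ n + x ^ Suc n * poly p x" for x :: real
      by (simp add: algebra_simps)
    have "?X ^ n * pCons a p = Polynomial.smult a (?X ^ n) + ?X ^ Suc n * p"
      by (simp add: mult_pCons_right mult.assoc)
    then have "L' (?X ^ n * pCons a p) = a * L' (?X ^ n) + L' (?X ^ Suc n * p)"
      by (simp only: L'_def pcompose_add pcompose_smult Ladd Lsmult)
    then show ?case using pCons.IH[of "Suc n"] int Mm[of n] unfolding eq by simp
  qed
  define Q where "Q = distr M borel (\<lambda>y. R * (2 * y - 1))"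
  have Q: "real_distribution Q" unfolding Q_def by (rule M.real_distribution_distr) simp
  interpret Q: real_distribution Q by fact
  have mom: "(\<integral>x. x ^ n \<partial>Q) = L (?X ^ n)" and Qint: "integrable Q (\<lambda>x. x ^ n)" for n
  proof -
    let ?p = "[:- R, 2 * R:] ^ n"
    have pp: "(R * (2 * y - 1)) ^ n = poly ?p y" for y by (simp add: poly_power algebra_simps)
    have "(\<integral>x. x ^ n \<partial>Q) = (\<integral>y. (R * (2 * y - 1)) ^ n \<partial>M)"
      unfolding Q_def by (rule integral_distr) auto
    also have "\<dots> = L' ?p" using Mp[of 0 ?p] unfolding pp by simp
    also have "pcompose [:- R, 2 * R:] ?c = ?X" using R by (simp add: pcompose_pCons)
    then have "L' ?p = L (?X ^ n)" by (simp only: L'_def pc_power)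
    finally show "(\<integral>x. x ^ n \<partial>Q) = L (?X ^ n)" .
    show "integrable Q (\<lambda>x. x ^ n)"
      unfolding Q_def by (subst integrable_distr_eq) (use Mp[of 0 ?p] pp in auto)
  qed
  have "\<phi> (T ^ n) = complex_of_real (\<integral>x. x ^ n \<partial>Q)" for n
    using L[of "?X ^ n"] PX[of n 1] by (simp add: mom P_def)
  then have "has_nc_law \<phi> T Q"
    unfolding has_nc_law_def using Qint Q.prob_space_axioms by simp
  then show ?thesis ..
qed

lemma has_nc_law_AE_bounded:
  assumes Q: "has_nc_law \<phi> T Q" and R: "R > 0" and bd: "\<And>n. cmod (\<phi> (T ^ n)) \<le> C * R ^ n"
  shows "real_distribution Q" "AE x in Q. \<bar>x\<bar> \<le> R"
proof -
  show "real_distribution Q"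
    using Q by (auto simp: has_nc_law_def real_distribution_def real_distribution_axioms_def)
  show "AE x in Q. \<bar>x\<bar> \<le> R"
  proof (rule AE_bounded_of_moments[OF _ _ _ _ R])
    show "\<bar>\<integral>x. x ^ n \<partial>Q\<bar> \<le> C * R ^ n" for n
      using bd[of n] Q by (simp add: has_nc_law_def)
  qed (use Q in \<open>auto simp: has_nc_law_def\<close>)
qed

text \<open>Uniqueness is what the definite description needs: the norm bound on the moments forces
  any two candidates onto the same compact interval, where moments determine the law.\<close>

lemma has_nc_law_nc_law:
  assumes T: "T \<in> A" "self_adjoint T"
  shows "has_nc_law \<phi> T (nc_law \<phi> T)"
proof -
  obtain K where K: "K > 0" "\<And>S. S \<in> A \<Longrightarrow> cmod (\<phi> S) \<le> K * onorm (bop_apply S)"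
    using state_norm_bound by blast
  define R where "R = onorm (bop_apply T) + 1"
  have onn: "0 \<le> onorm (bop_apply T)" using onorm_pos_le bop_apply[of T] by auto
  then have R: "R > 0" by (simp add: R_def)
  have bd: "cmod (\<phi> (T ^ n)) \<le> (K * onorm (bop_apply (1 :: 'h bop))) * R ^ n" for n
  proof -
    have "cmod (\<phi> (T ^ n)) \<le> K * onorm (bop_apply (T ^ n * 1))" using K T by (simp add: A_intros)
    also have "\<dots> \<le> K * (onorm (bop_apply T) ^ n * onorm (bop_apply (1 :: 'h bop)))"
      using K by (intro mult_left_mono onorm_power_times_le) auto
    also have "\<dots> \<le> K * (R ^ n * onorm (bop_apply (1 :: 'h bop)))"
      using K onn onorm_pos_le bop_apply[of "1 :: 'h bop"]
      by (intro mult_left_mono mult_right_mono power_mono) (auto simp: R_def)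
    finally show ?thesis by (simp add: mult_ac)
  qed
  obtain Q where Q: "has_nc_law \<phi> T Q" using has_nc_law_exists[OF T] by blast
  have "Q' = Q" if Q': "has_nc_law \<phi> T Q'" for Q'
  proof (rule real_distribution_eqI_moments)
    show "(\<integral>x. x ^ k \<partial>Q') = (\<integral>x. x ^ k \<partial>Q)" for k
      using Q Q' unfolding has_nc_law_def by (metis of_real_eq_iff)
  qed (rule has_nc_law_AE_bounded[OF Q R bd] has_nc_law_AE_bounded[OF Q' R bd])+
  with Q show ?thesis unfolding nc_law_def by (rule theI)
qed

end

section \<open>Moments as polynomials in the free cumulants\<close>

text \<open>
  The sum over the noncrossing partitions of \<open>k + a\<close> points whose first \<open>k\<close> points lie in one block,
  weighted by the products of the \<open>\<kappa>\<close> of the block sizes. The recursion looks for the next point of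
  that block. The arguments \<open>1\<close> stand for moments, see \<open>cumulant_path_rec\<close>.
\<close>

function cumulant_path :: "(nat \<Rightarrow> real) \<Rightarrow> nat \<Rightarrow> nat \<Rightarrow> real" where
  "cumulant_path \<kappa> k a = \<kappa> k * (if a = 0 then 1 else cumulant_path \<kappa> 1 (a - 1)) +
     (\<Sum>i<a. cumulant_path \<kappa> (Suc k) i * (if a - 1 - i = 0 then 1 else cumulant_path \<kappa> 1 (a - 1 - i - 1)))"
  by auto
termination by (relation "Wellfounded.measure (\<lambda>(\<kappa>, k, a). a)") auto

declare cumulant_path.simps [simp del]

text \<open>The moment-cumulant formula. The first point opens a block of current size 1, which
  leaves \<open>n - 1\<close> points.\<close>

definition free_moment :: "(nat \<Rightarrow> real) \<Rightarrow> nat \<Rightarrow> real" where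
  "free_moment \<kappa> n = (if n = 0 then 1 else cumulant_path \<kappa> 1 (n - 1))"

lemma free_moment_0: "free_moment \<kappa> 0 = 1"
  by (simp add: free_moment_def)

lemma free_moment_Suc: "free_moment \<kappa> (Suc n) = cumulant_path \<kappa> 1 n"
  by (simp add: free_moment_def)

text \<open>Either the block is complete with \<open>k\<close> points and the other \<open>a\<close>
  points are arbitrary, or it has a next point: \<open>a - 1 - i\<close> points are skipped before
  it and \<open>i\<close> points follow.\<close>

lemma cumulant_path_rec:
  "cumulant_path \<kappa> k a = \<kappa> k * free_moment \<kappa> a +
     (\<Sum>i<a. cumulant_path \<kappa> (Suc k) i * free_moment \<kappa> (a - 1 - i))"
  by (subst cumulant_path.simps) (auto simp: free_moment_def intro!: sum.cong)

text \<open>Paths and moments are defined through each other: a path with \<open>a\<close> points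
  left uses shorter paths and moments up to order \<open>a\<close>, and the moment of order
  \<open>Suc n\<close> is a path with \<open>n\<close> points left. The index \<open>k\<close> stays
  arbitrary because the recursion raises it.\<close>

lemma cumulant_path_induct:
  assumes "\<And>a. (\<And>k i. i < a \<Longrightarrow> 1 \<le> k \<Longrightarrow> P k i) \<Longrightarrow> (\<And>i. i \<le> a \<Longrightarrow> Q i) \<Longrightarrow> (\<And>k. 1 \<le> k \<Longrightarrow> P k a)"
    and "Q 0" and "\<And>n. P (1 :: nat) n \<Longrightarrow> Q (Suc n :: nat)"
  shows "(1 \<le> k \<longrightarrow> P k a) \<and> Q a"
proof -
  have "(\<forall>k\<ge>1. P k a) \<and> Q a" for a
  proof (induction a rule: less_induct)
    case (less a)
    have Q: "Q a"
    proof (cases a)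
      case (Suc n)
      then show ?thesis using less[of n] assms(3) by auto
    qed (simp add: assms(2))
    have "P k a" if "1 \<le> k" for k
    proof (rule assms(1)[OF _ _ that])
      show "P k' i" if "i < a" "1 \<le> k'" for k' i using less[OF that(1)] that(2) by blast
      show "Q i" if "i \<le> a" for i using less[of i] that Q by (cases "i = a") auto
    qed
    with Q show ?case by blast
  qed
  then show ?thesis by blast
qed

lemma cumulant_path_abs_le:
  assumes "\<And>k. 1 \<le> k \<Longrightarrow> \<bar>\<kappa> k\<bar> \<le> \<kappa>' k"
  shows "(1 \<le> k \<longrightarrow> \<bar>cumulant_path \<kappa> k a\<bar> \<le> cumulant_path \<kappa>' k a) \<and> \<bar>free_moment \<kappa> a\<bar> \<le> free_moment \<kappa>' a"
proof (rule cumulant_path_induct)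
  fix a k
  assume P: "\<And>k i. i < a \<Longrightarrow> 1 \<le> k \<Longrightarrow> \<bar>cumulant_path \<kappa> k i\<bar> \<le> cumulant_path \<kappa>' k i"
    and Q: "\<And>i. i \<le> a \<Longrightarrow> \<bar>free_moment \<kappa> i\<bar> \<le> free_moment \<kappa>' i" and k: "1 \<le> (k :: nat)"
  have "\<bar>\<kappa> k * free_moment \<kappa> a\<bar> \<le> \<kappa>' k * free_moment \<kappa>' a"
    unfolding abs_mult by (intro mult_mono assms Q k) (use assms[OF k] in auto)
  moreover have "\<bar>\<Sum>i<a. cumulant_path \<kappa> (Suc k) i * free_moment \<kappa> (a - 1 - i)\<bar> \<le>
      (\<Sum>i<a. cumulant_path \<kappa>' (Suc k) i * free_moment \<kappa>' (a - 1 - i))"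
  proof (rule order_trans[OF sum_abs sum_mono])
    fix i assume i: "i \<in> {..<a}"
    have *: "\<bar>cumulant_path \<kappa> (Suc k) i\<bar> \<le> cumulant_path \<kappa>' (Suc k) i" using P i by simp
    show "\<bar>cumulant_path \<kappa> (Suc k) i * free_moment \<kappa> (a - 1 - i)\<bar> \<le>
        cumulant_path \<kappa>' (Suc k) i * free_moment \<kappa>' (a - 1 - i)"
      unfolding abs_mult by (intro mult_mono * Q) (use * in auto)
  qed
  ultimately show "\<bar>cumulant_path \<kappa> k a\<bar> \<le> cumulant_path \<kappa>' k a"
    unfolding cumulant_path_rec[of _ k] by linarith
qed (simp_all add: free_moment_0 free_moment_Suc)

lemma cumulant_path_mono:
  assumes "\<And>k. 1 \<le> k \<Longrightarrow> 0 \<le> \<kappa>' k" "\<And>k. 1 \<le> k \<Longrightarrow> \<kappa>' k \<le> \<kappa> k"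
  shows "(1 \<le> k \<longrightarrow> 0 \<le> cumulant_path \<kappa>' k a \<and> cumulant_path \<kappa>' k a \<le> cumulant_path \<kappa> k a) \<and>
    0 \<le> free_moment \<kappa>' a \<and> free_moment \<kappa>' a \<le> free_moment \<kappa> a"
proof (rule cumulant_path_induct)
  fix a k
  assume P: "\<And>k i. i < a \<Longrightarrow> 1 \<le> k \<Longrightarrow> 0 \<le> cumulant_path \<kappa>' k i \<and> cumulant_path \<kappa>' k i \<le> cumulant_path \<kappa> k i"
    and Q: "\<And>i. i \<le> a \<Longrightarrow> 0 \<le> free_moment \<kappa>' i \<and> free_moment \<kappa>' i \<le> free_moment \<kappa> i"
    and k: "1 \<le> (k :: nat)"
  have "0 \<le> \<kappa>' k * free_moment \<kappa>' a" "\<kappa>' k * free_moment \<kappa>' a \<le> \<kappa> k * free_moment \<kappa> a"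
    using assms[OF k] Q[of a] by (auto intro: mult_mono)
  moreover have "0 \<le> (\<Sum>i<a. cumulant_path \<kappa>' (Suc k) i * free_moment \<kappa>' (a - 1 - i))"
    using P Q by (auto intro!: sum_nonneg)
  moreover have "(\<Sum>i<a. cumulant_path \<kappa>' (Suc k) i * free_moment \<kappa>' (a - 1 - i)) \<le>
      (\<Sum>i<a. cumulant_path \<kappa> (Suc k) i * free_moment \<kappa> (a - 1 - i))"
  proof (rule sum_mono)
    fix i assume i: "i \<in> {..<a}"
    then show "cumulant_path \<kappa>' (Suc k) i * free_moment \<kappa>' (a - 1 - i) \<le>
        cumulant_path \<kappa> (Suc k) i * free_moment \<kappa> (a - 1 - i)"
      using P[of i "Suc k"] Q[of "a - 1 - i"] by (intro mult_mono) auto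
  qed
  ultimately show "0 \<le> cumulant_path \<kappa>' k a \<and> cumulant_path \<kappa>' k a \<le> cumulant_path \<kappa> k a"
    unfolding cumulant_path_rec[of _ k] by linarith
qed (simp_all add: free_moment_0 free_moment_Suc)

text \<open>The partition into a single block contributes exactly the cumulant of the full order; it
  is found in the last summand of the recursion, and all other contributions are monotone.\<close>

lemma cumulant_path_diff_ge:
  assumes "\<And>k. 1 \<le> k \<Longrightarrow> 0 \<le> \<kappa>' k" "\<And>k. 1 \<le> k \<Longrightarrow> \<kappa>' k \<le> \<kappa> k" and "1 \<le> k"
  shows "\<kappa> (k + a) - \<kappa>' (k + a) \<le> cumulant_path \<kappa> k a - cumulant_path \<kappa>' k a"
  using \<open>1 \<le> k\<close>
proof (induction a arbitrary: k)
  case 0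
  then show ?case by (simp add: cumulant_path_rec[of _ k] free_moment_0)
next
  case (Suc a)
  note mono = cumulant_path_mono[of \<kappa>' \<kappa>, OF assms(1,2)]
  have "\<kappa>' k * free_moment \<kappa>' (Suc a) \<le> \<kappa> k * free_moment \<kappa> (Suc a)"
    using assms(1,2)[OF Suc.prems] mono[of k "Suc a"] by (intro mult_mono) auto
  moreover have "(\<Sum>i<a. cumulant_path \<kappa>' (Suc k) i * free_moment \<kappa>' (a - i)) \<le>
      (\<Sum>i<a. cumulant_path \<kappa> (Suc k) i * free_moment \<kappa> (a - i))"
  proof (rule sum_mono)
    show "cumulant_path \<kappa>' (Suc k) i * free_moment \<kappa>' (a - i) \<le>
        cumulant_path \<kappa> (Suc k) i * free_moment \<kappa> (a - i)" for i
      using mono[of "Suc k" i] mono[of 1 "a - i"] by (intro mult_mono) auto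
  qed
  moreover have "\<kappa> (Suc k + a) - \<kappa>' (Suc k + a) \<le> cumulant_path \<kappa> (Suc k) a - cumulant_path \<kappa>' (Suc k) a"
    by (rule Suc.IH) simp
  ultimately show ?case
    by (simp add: cumulant_path_rec[of _ k] free_moment_0)
qed

lemma free_moment_diff_ge:
  assumes "\<And>k. 1 \<le> k \<Longrightarrow> 0 \<le> \<kappa>' k" "\<And>k. 1 \<le> k \<Longrightarrow> \<kappa>' k \<le> \<kappa> k"
  shows "\<kappa> (Suc n) - \<kappa>' (Suc n) \<le> free_moment \<kappa> (Suc n) - free_moment \<kappa>' (Suc n)"
  using cumulant_path_diff_ge[of \<kappa>' \<kappa> 1 n, OF assms] by (simp add: free_moment_Suc)

text \<open>A vanishing first cumulant removes singletons; four points then allow one block or the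
  two noncrossing pairings.\<close>

lemma free_moment_small:
  assumes "\<kappa> 1 = 0" "\<kappa> 2 = 1"
  shows "free_moment \<kappa> 1 = 0" "free_moment \<kappa> 2 = 1" "free_moment \<kappa> 3 = \<kappa> 3" "free_moment \<kappa> 4 = \<kappa> 4 + 2"
proof -
  note simps = cumulant_path_rec[of _ _ 0] cumulant_path_rec[of _ _ "Suc 0"]
    cumulant_path_rec[of _ _ "Suc (Suc 0)"] cumulant_path_rec[of _ _ "Suc (Suc (Suc 0))"] free_moment_0 free_moment_Suc numeral_eq_Suc assms(1)[simplified]
    assms(2)[simplified numeral_2_eq_2] lessThan_Suc
  show 1: "free_moment \<kappa> 1 = 0" by (simp add: simps)
  show 2: "free_moment \<kappa> 2 = 1" by (simp add: simps)
  show 3: "free_moment \<kappa> 3 = \<kappa> 3" by (simp add: simps)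
  show "free_moment \<kappa> 4 = \<kappa> 4 + 2" by (simp add: simps)
qed

lemma free_moment_rec:
  assumes "\<kappa> 1 = 0"
  shows "free_moment \<kappa> (Suc (Suc n)) = (\<Sum>i\<le>n. cumulant_path \<kappa> 2 i * free_moment \<kappa> (n - i))"
  using assms by (simp add: free_moment_Suc cumulant_path_rec[of _ "Suc 0"] numeral_2_eq_2 lessThan_Suc_atMost)

text \<open>At order six the summand \<open>i = 1\<close> of the recursion is the product of
  \<open>\<kappa> 3\<close> with the third moment, again \<open>\<kappa> 3\<close>. The summand
  \<open>i = 0\<close> puts a pair of weight 1 in front and carries the gap to the next even
  order.\<close>

lemma free_moment_even_diff_ge_square:
  assumes nn: "\<And>k. 1 \<le> k \<Longrightarrow> 0 \<le> \<kappa>' k" "\<And>k. 1 \<le> k \<Longrightarrow> \<kappa>' k \<le> \<kappa> k"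
    and 1: "\<kappa>' 1 = 0" "\<kappa> 1 = 0" and 2: "\<kappa>' 2 = 1" "\<kappa> 2 = 1" and 3: "\<kappa>' 3 = 0" and r: "3 \<le> r"
  shows "(\<kappa> 3)\<^sup>2 \<le> free_moment \<kappa> (2 * r) - free_moment \<kappa>' (2 * r)"
  using r
proof (induction r rule: dec_induct)
  note mono = cumulant_path_mono[of \<kappa>' \<kappa>, OF nn]
  have le: "cumulant_path \<kappa>' 2 i * free_moment \<kappa>' j \<le> cumulant_path \<kappa> 2 i * free_moment \<kappa> j" for i j
    using mono[of 2 i] mono[of 2 j] by (intro mult_mono) auto
  {
    case base
    have T1: "cumulant_path \<kappa> 2 1 = \<kappa> 3"
      using 1 by (simp add: cumulant_path_rec[of _ _ "Suc 0"] cumulant_path_rec[of _ _ 0] free_moment_0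
          free_moment_small[of \<kappa>, OF 1(2) 2(2), simplified] numeral_eq_Suc)
    have "free_moment \<kappa> (Suc (Suc 4)) - free_moment \<kappa>' (Suc (Suc 4)) =
        (\<Sum>i\<le>4. cumulant_path \<kappa> 2 i * free_moment \<kappa> (4 - i) - cumulant_path \<kappa>' 2 i * free_moment \<kappa>' (4 - i))"
      by (simp only: free_moment_rec[of \<kappa>', OF 1(1)] free_moment_rec[of \<kappa>, OF 1(2)] sum_subtractf)
    also have "\<dots> \<ge> cumulant_path \<kappa> 2 1 * free_moment \<kappa> (4 - 1) - cumulant_path \<kappa>' 2 1 * free_moment \<kappa>' (4 - 1)"
      by (rule member_le_sum) (use le in auto)
    finally show ?case
      using T1 free_moment_small[of \<kappa>, OF 1(2) 2(2)] free_moment_small[of \<kappa>', OF 1(1) 2(1)] 3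
      by (simp add: power2_eq_square)
  next
    case (step r)
    have T0: "cumulant_path \<kappa> 2 0 = 1" "cumulant_path \<kappa>' 2 0 = 1"
      using 2 by (simp_all add: cumulant_path_rec[of _ _ 0] free_moment_0)
    have "free_moment \<kappa> (Suc (Suc (2 * r))) - free_moment \<kappa>' (Suc (Suc (2 * r))) =
        (\<Sum>i\<le>2 * r. cumulant_path \<kappa> 2 i * free_moment \<kappa> (2 * r - i) - cumulant_path \<kappa>' 2 i * free_moment \<kappa>' (2 * r - i))"
      by (simp only: free_moment_rec[of \<kappa>', OF 1(1)] free_moment_rec[of \<kappa>, OF 1(2)] sum_subtractf)
    also have "\<dots> \<ge> cumulant_path \<kappa> 2 0 * free_moment \<kappa> (2 * r - 0) - cumulant_path \<kappa>' 2 0 * free_moment \<kappa>' (2 * r - 0)"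
      by (rule member_le_sum) (use le in auto)
    finally show ?case using step.IH by (simp add: T0)
  }
qed

text \<open>
  With all cumulants equal to one the moments satisfy the recursion of the Catalan numbers, and the
  partial sums \<open>s\<close> of their generating function at \<open>1/4\<close> satisfy \<open>s \<le> 1 + s\<^sup>2 / 4\<close>.
\<close>

lemma free_moment_bound:
  assumes "\<And>k. 1 \<le> k \<Longrightarrow> \<bar>\<kappa> k\<bar> \<le> 1"
  shows "\<bar>free_moment \<kappa> n\<bar> \<le> 2 * 4 ^ n"
proof -
  define m where "m = free_moment (\<lambda>_. 1)"
  \<comment> \<open>When all cumulants are equal the weight no longer depends on the current block
    size.\<close>
  have indep: "cumulant_path (\<lambda>_. 1) k a = cumulant_path (\<lambda>_. 1) (Suc 0) a" for k a
  proof (induction a arbitrary: k rule: less_induct)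
    case (less a)
    have "(\<Sum>i<a. cumulant_path (\<lambda>_. 1) (Suc j) i * free_moment (\<lambda>_. 1) (a - 1 - i)) =
        (\<Sum>i<a. cumulant_path (\<lambda>_. 1) (Suc 0) i * free_moment (\<lambda>_. 1) (a - 1 - i))" for j
      using less[of _ "Suc j"] by (intro sum.cong) auto
    from this[of k] this[of "Suc 0"] show ?case by (simp add: cumulant_path_rec[of _ _ a])
  qed
  have rec: "m (Suc n) = (\<Sum>i\<le>n. m i * m (n - i))" for n
  proof -
    have "m (Suc n) = m n + (\<Sum>i<n. m (Suc i) * m (n - 1 - i))"
      unfolding m_def free_moment_Suc One_nat_def
      by (subst cumulant_path_rec) (simp add: indep[of "Suc (Suc 0)"])
    also have "\<dots> = (\<Sum>i<Suc n. m i * m (n - i))"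
      by (subst sum.lessThan_Suc_shift) (simp add: m_def free_moment_0)
    finally show ?thesis by (simp add: lessThan_Suc_atMost)
  qed
  have m0: "m n \<ge> 0" for n
    using cumulant_path_mono[of "\<lambda>_. 1" "\<lambda>_. 1" 1 n] by (simp add: m_def)
  \<comment> \<open>The number 2 is the fixed point of \<open>1 + s\<^sup>2 / 4\<close>, so the
    bound reproduces itself from one partial sum to the next.\<close>
  have "(\<Sum>n\<le>N. m n / 4 ^ n) \<le> 2" for N
  proof (induction N)
    case 0
    then show ?case by (simp add: m_def free_moment_0)
  next
    case (Suc N)
    let ?c = "\<lambda>n. m n / 4 ^ n"
    have c0: "0 \<le> ?c n" for n by (simp add: m0)
    have "(\<Sum>n\<le>Suc N. ?c n) = 1 + (\<Sum>n\<le>N. ?c (Suc n))"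
      by (subst sum.atMost_Suc_shift) (simp add: m_def free_moment_0)
    also have "(\<Sum>n\<le>N. ?c (Suc n)) = (\<Sum>n\<le>N. \<Sum>i\<le>n. ?c i * ?c (n - i)) / 4"
    proof -
      have "?c (Suc n) = (\<Sum>i\<le>n. ?c i * ?c (n - i)) / 4" for n
        by (simp add: rec sum_divide_distrib mult.commute flip: power_add)
      then show ?thesis by (simp only: sum_divide_distrib)
    qed
    also have "(\<Sum>n\<le>N. \<Sum>i\<le>n. ?c i * ?c (n - i)) \<le> (\<Sum>n\<le>N. ?c n) * (\<Sum>n\<le>N. ?c n)"
    proof -
      have "(\<Sum>n\<le>N. \<Sum>i\<le>n. ?c i * ?c (n - i)) = (\<Sum>(n, i)\<in>(SIGMA n:{..N}. {..n}). ?c i * ?c (n - i))"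
        by (rule sum.Sigma) auto
      also have "\<dots> = (\<Sum>(i, j)\<in>{(i, j). i + j \<le> N}. ?c i * ?c j)"
        by (rule sum.reindex_bij_witness[of _ "\<lambda>(i, j). (i + j, i)" "\<lambda>(n, i). (i, n - i)"]) auto
      also have "\<dots> \<le> (\<Sum>(i, j)\<in>{..N} \<times> {..N}. ?c i * ?c j)"
        by (rule sum_mono2) (auto simp: m0)
      also have "\<dots> = (\<Sum>n\<le>N. ?c n) * (\<Sum>n\<le>N. ?c n)"
        by (simp only: sum_product sum.cartesian_product)
      finally show ?thesis .
    qed
    also have "\<dots> \<le> 2 * 2" using Suc c0 by (intro mult_mono sum_nonneg) auto
    finally show ?case by simp
  qed
  then have "(\<Sum>n\<le>n. m n / 4 ^ n) \<le> 2" .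
  moreover have "m n / 4 ^ n \<le> (\<Sum>n\<le>n. m n / 4 ^ n)"
    by (rule member_le_sum) (auto simp: m0)
  ultimately have "m n / 4 ^ n \<le> 2" by linarith
  then have "m n \<le> 2 * 4 ^ n" by (simp add: field_simps)
  moreover have "\<bar>free_moment \<kappa> n\<bar> \<le> m n"
    using cumulant_path_abs_le[of \<kappa> "\<lambda>_. 1" 1 n] assms by (simp add: m_def)
  ultimately show ?thesis by linarith
qed

text \<open>Homogeneity: the cumulants in each contribution have total order \<open>k + a\<close>.
  It is applied to the normalization of the variance and, with \<open>c = -1\<close>, to the change
  of sign.\<close>

lemma cumulant_path_scale:
  "(1 \<le> k \<longrightarrow> cumulant_path (\<lambda>k. c ^ k * \<kappa> k) k a = c ^ (k + a) * cumulant_path \<kappa> k a) \<and>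
    free_moment (\<lambda>k. c ^ k * \<kappa> k) a = c ^ a * free_moment \<kappa> a"
proof (rule cumulant_path_induct)
  fix a k
  assume P: "\<And>k i. i < a \<Longrightarrow> 1 \<le> k \<Longrightarrow> cumulant_path (\<lambda>k. c ^ k * \<kappa> k) k i = c ^ (k + i) * cumulant_path \<kappa> k i"
    and Q: "\<And>i. i \<le> a \<Longrightarrow> free_moment (\<lambda>k. c ^ k * \<kappa> k) i = c ^ i * free_moment \<kappa> i"
    and k: "1 \<le> (k :: nat)"
  have "(\<Sum>i<a. cumulant_path (\<lambda>k. c ^ k * \<kappa> k) (Suc k) i * free_moment (\<lambda>k. c ^ k * \<kappa> k) (a - 1 - i)) =
      (\<Sum>i<a. c ^ (k + a) * (cumulant_path \<kappa> (Suc k) i * free_moment \<kappa> (a - 1 - i)))"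
  proof (rule sum.cong[OF refl])
    fix i assume i: "i \<in> {..<a}"
    then have "k + a = (Suc k + i) + (a - 1 - i)" by auto
    then have "c ^ (k + a) = c ^ (Suc k + i) * c ^ (a - 1 - i)" by (simp only: power_add)
    then show "cumulant_path (\<lambda>k. c ^ k * \<kappa> k) (Suc k) i * free_moment (\<lambda>k. c ^ k * \<kappa> k) (a - 1 - i) =
        c ^ (k + a) * (cumulant_path \<kappa> (Suc k) i * free_moment \<kappa> (a - 1 - i))"
      using P[of i "Suc k"] Q[of "a - 1 - i"] i by (simp only: lessThan_iff) (simp add: mult_ac)
  qed
  then show "cumulant_path (\<lambda>k. c ^ k * \<kappa> k) k a = c ^ (k + a) * cumulant_path \<kappa> k a"
    using Q[of a]
    by (simp add: cumulant_path_rec[of _ k a] distrib_left power_add mult_ac flip: sum_distrib_left)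
qed (simp_all add: free_moment_0 free_moment_Suc)

lemma tendsto_mult_diff_zero:
  fixes x y x' y' :: "nat \<Rightarrow> real"
  assumes "(\<lambda>n. x n - x' n) \<longlonglongrightarrow> 0" "(\<lambda>n. y n - y' n) \<longlonglongrightarrow> 0"
    and "\<And>n. \<bar>y n\<bar> \<le> B" "\<And>n. \<bar>x' n\<bar> \<le> B"
  shows "(\<lambda>n. x n * y n - x' n * y' n) \<longlonglongrightarrow> 0"
proof -
  have "(\<lambda>n. (x n - x' n) * y n + x' n * (y n - y' n)) \<longlonglongrightarrow> 0 + 0"
    by (intro tendsto_add lim_null_mult_right_bounded[where B=B] lim_null_mult_left_bounded[where B=B])
      (use assms in auto)
  then show ?thesis by (simp add: algebra_simps)
qed

text \<open>Moments are polynomials in the cumulants, uniformly continuous on bounded sets. The form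
  with differences is needed because it is also applied before either sequence is known to
  converge.\<close>

lemma cumulant_path_tendsto_diff:
  fixes \<kappa> \<kappa>' :: "nat \<Rightarrow> nat \<Rightarrow> real"
  assumes le: "\<And>n k. 1 \<le> k \<Longrightarrow> \<bar>\<kappa> n k\<bar> \<le> 1" "\<And>n k. 1 \<le> k \<Longrightarrow> \<bar>\<kappa>' n k\<bar> \<le> 1"
    and lim: "\<And>k. 1 \<le> k \<Longrightarrow> (\<lambda>n. \<kappa> n k - \<kappa>' n k) \<longlonglongrightarrow> 0"
  shows "(1 \<le> k \<longrightarrow> (\<lambda>n. cumulant_path (\<kappa> n) k a - cumulant_path (\<kappa>' n) k a) \<longlonglongrightarrow> 0) \<and>
    (\<lambda>n. free_moment (\<kappa> n) a - free_moment (\<kappa>' n) a) \<longlonglongrightarrow> 0"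
proof (rule cumulant_path_induct)
  note bd = cumulant_path_abs_le[of _ "\<lambda>_. 1"]
  fix a k
  assume P: "\<And>k i. i < a \<Longrightarrow> 1 \<le> k \<Longrightarrow> (\<lambda>n. cumulant_path (\<kappa> n) k i - cumulant_path (\<kappa>' n) k i) \<longlonglongrightarrow> 0"
    and Q: "\<And>i. i \<le> a \<Longrightarrow> (\<lambda>n. free_moment (\<kappa> n) i - free_moment (\<kappa>' n) i) \<longlonglongrightarrow> 0" and k: "1 \<le> (k :: nat)"
  have fm: "\<bar>free_moment (\<kappa> n) i\<bar> \<le> free_moment (\<lambda>_. 1) i" for n i
    using bd[of "\<kappa> n"] le(1) by blast
  have cp: "1 \<le> k \<Longrightarrow> \<bar>cumulant_path (\<kappa>' n) k i\<bar> \<le> cumulant_path (\<lambda>_. 1) k i" for n k i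
    using bd[of "\<kappa>' n"] le(2) by blast
  have 1: "(\<lambda>n. \<kappa> n k * free_moment (\<kappa> n) a - \<kappa>' n k * free_moment (\<kappa>' n) a) \<longlonglongrightarrow> 0"
    by (rule tendsto_mult_diff_zero[where B="max 1 (free_moment (\<lambda>_. 1) a)"])
      (use lim[OF k] Q[of a] le(2)[OF k] fm[of _ a] in \<open>auto simp: le_max_iff_disj\<close>)
  have 2: "(\<lambda>n. cumulant_path (\<kappa> n) (Suc k) i * free_moment (\<kappa> n) (a - 1 - i) -
      cumulant_path (\<kappa>' n) (Suc k) i * free_moment (\<kappa>' n) (a - 1 - i)) \<longlonglongrightarrow> 0" if "i \<in> {..<a}" for i
    by (rule tendsto_mult_diff_zero[where B="max (cumulant_path (\<lambda>_. 1) (Suc k) i) (free_moment (\<lambda>_. 1) (a - 1 - i))"])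
      (use that P[of i "Suc k"] Q[of "a - 1 - i"] cp[of "Suc k" _ i] fm[of _ "a - 1 - i"] in \<open>auto simp: le_max_iff_disj\<close>)
  have "(\<lambda>n. (\<kappa> n k * free_moment (\<kappa> n) a - \<kappa>' n k * free_moment (\<kappa>' n) a) +
      (\<Sum>i<a. cumulant_path (\<kappa> n) (Suc k) i * free_moment (\<kappa> n) (a - 1 - i) -
      cumulant_path (\<kappa>' n) (Suc k) i * free_moment (\<kappa>' n) (a - 1 - i))) \<longlonglongrightarrow> 0 + (\<Sum>i<a. 0)"
    by (intro tendsto_add 1 tendsto_sum 2)
  then show "(\<lambda>n. cumulant_path (\<kappa> n) k a - cumulant_path (\<kappa>' n) k a) \<longlonglongrightarrow> 0"
    unfolding cumulant_path_rec[of _ k] by (simp add: sum_subtractf algebra_simps)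
qed (simp_all add: free_moment_0 free_moment_Suc)

text \<open>The tangent at \<open>a\<close>, without and with a quadratic remainder. By the identity
  \<open>step\<close> the remainder for the next exponent is \<open>t\<close> times the previous one
  plus a nonnegative multiple of the square of \<open>t - a\<close>.\<close>

lemma power_tangent_le:
  fixes t a :: real
  assumes "0 \<le> t" "0 \<le> a"
  shows "a ^ Suc n + Suc n * a ^ n * (t - a) \<le> t ^ Suc n"
    and "a ^ Suc (Suc n) + Suc (Suc n) * a ^ Suc n * (t - a) + a ^ n * (t - a)\<^sup>2 \<le> t ^ Suc (Suc n)"
proof -
  have step: "t ^ Suc m - a ^ Suc m - Suc m * a ^ m * (t - a) =
      t * (t ^ m - a ^ m - m * a ^ (m - 1) * (t - a)) + m * a ^ (m - 1) * (t - a)\<^sup>2" for m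
    by (cases m) (simp_all add: power2_eq_square algebra_simps)
  show 1: "a ^ Suc n + Suc n * a ^ n * (t - a) \<le> t ^ Suc n" for n
  proof (induction n)
    case (Suc n)
    then have "0 \<le> t * (t ^ Suc n - a ^ Suc n - Suc n * a ^ n * (t - a)) + Suc n * a ^ n * (t - a)\<^sup>2"
      using assms by (intro add_nonneg_nonneg mult_nonneg_nonneg) auto
    then show ?case using step[of "Suc n"] by simp
  qed simp
  have "a ^ n * (t - a)\<^sup>2 \<le> Suc n * a ^ n * (t - a)\<^sup>2"
    using assms by (intro mult_right_mono) (auto simp: mult_le_cancel_right1)
  moreover have "0 \<le> t * (t ^ Suc n - a ^ Suc n - Suc n * a ^ n * (t - a))"
    using 1[of n] assms by (intro mult_nonneg_nonneg) auto
  ultimately show "a ^ Suc (Suc n) + Suc (Suc n) * a ^ Suc n * (t - a) + a ^ n * (t - a)\<^sup>2 \<le> t ^ Suc (Suc n)"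
    using step[of "Suc n"] by simp
qed

lemma abs_power_diff_le:
  fixes t a :: real
  assumes "0 \<le> t" "t \<le> 1" "0 \<le> a" "a \<le> 1"
  shows "\<bar>t ^ n - a ^ n\<bar> \<le> n * \<bar>t - a\<bar>"
  using norm_power_diff[of t a n] assms by simp

lemma power_even_odd_split:
  fixes x :: real
  shows "x ^ (2 * k + 2) = x\<^sup>2 * (x\<^sup>2) ^ k" and "x ^ (2 * k + 3) = x ^ 3 * (x\<^sup>2) ^ k"
    and "x ^ (2 * k + 6) = x\<^sup>2 * (x\<^sup>2) ^ (k + 2)" and "x ^ 4 = x\<^sup>2 * x\<^sup>2"
proof -
  show "x ^ (2 * k + 2) = x\<^sup>2 * (x\<^sup>2) ^ k" for k unfolding power_add power_mult by (rule mult.commute)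
  from this[of "k + 2"] show "x ^ (2 * k + 6) = x\<^sup>2 * (x\<^sup>2) ^ (k + 2)"
    by (simp only: add_mult_distrib2 add.assoc) simp
  show "x ^ (2 * k + 3) = x ^ 3 * (x\<^sup>2) ^ k" unfolding power_add power_mult by (rule mult.commute)
  show "x ^ 4 = x\<^sup>2 * x\<^sup>2" by (simp flip: power_add)
qed

section \<open>Eigenvalues with fourth cumulant near that of the tetilla law\<close>

text \<open>
  The coefficients of \<open>\<Sum>\<^sub>i x\<^sub>i (S\<^sub>i\<^sup>2 - 1)\<close>. They have sum zero because only off-diagonal
  rectangles enter the Wigner integral.
\<close>

locale eigenvalues =
  fixes x :: "nat \<Rightarrow> real" and N :: nat
  assumes sum_1: "(\<Sum>i<N. x i) = 0" and sum_2: "(\<Sum>i<N. (x i)\<^sup>2) = 1"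
begin

definition \<kappa> :: "nat \<Rightarrow> real" where "\<kappa> k = (\<Sum>i<N. x i ^ k)"

text \<open>The second moment of \<open>x\<^sup>2 - 1 / 2\<close> under the probability weights
  \<open>x\<^sup>2\<close>. It vanishes only if the nonzero eigenvalues are one
  \<open>1 / sqrt 2\<close> and one \<open>- 1 / sqrt 2\<close>, the spectrum of the tetilla
  law.\<close>

definition defect :: real where "defect = (\<Sum>i<N. (x i)\<^sup>2 * ((x i)\<^sup>2 - 1 / 2)\<^sup>2)"

lemma \<kappa>_1: "\<kappa> 1 = 0" and \<kappa>_2: "\<kappa> 2 = 1"
  using sum_1 sum_2 by (simp_all add: \<kappa>_def)

lemma sq_le_1: "i < N \<Longrightarrow> (x i)\<^sup>2 \<le> 1"
  using member_le_sum[of i "{..<N}" "\<lambda>i. (x i)\<^sup>2"] sum_2 by simp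

lemma abs_le_1: "i < N \<Longrightarrow> \<bar>x i\<bar> \<le> 1"
  using sq_le_1[of i] by (simp add: abs_square_le_1)

lemma abs_\<kappa>_le_1: assumes "1 \<le> k" shows "\<bar>\<kappa> k\<bar> \<le> 1"
proof (cases "k = 1")
  case True
  then show ?thesis by (simp only: \<kappa>_1)
next
  case False
  then obtain m where k: "k = 2 + m" using assms by (metis One_nat_def Suc_1 le_antisym le_Suc_ex not_less_eq_eq)
  have "\<bar>\<kappa> k\<bar> \<le> (\<Sum>i<N. (x i)\<^sup>2)"
    unfolding \<kappa>_def
  proof (rule order_trans[OF sum_abs sum_mono])
    fix i assume "i \<in> {..<N}"
    then have "(x i)\<^sup>2 * \<bar>x i\<bar> ^ m \<le> (x i)\<^sup>2 * 1" by (intro mult_left_mono power_le_one abs_le_1) auto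
    then show "\<bar>x i ^ k\<bar> \<le> (x i)\<^sup>2" by (simp only: k power_add abs_mult power_abs power2_abs mult_1_right)
  qed
  then show ?thesis by (simp add: sum_2)
qed

lemma defect_nonneg: "0 \<le> defect"
  unfolding defect_def by (intro sum_nonneg) simp

lemma sum_weighted_abs_le: "(\<Sum>i<N. (x i)\<^sup>2 * \<bar>(x i)\<^sup>2 - 1 / 2\<bar>) \<le> sqrt defect"
proof (rule real_le_rsqrt)
  have e1: "\<bar>u\<bar> * (\<bar>u\<bar> * v) = u\<^sup>2 * v" and e2: "(\<bar>u\<bar> * \<bar>v\<bar>)\<^sup>2 = u\<^sup>2 * v\<^sup>2" for u v :: real
    by (simp add: power2_eq_square flip: mult.assoc) (simp add: power_mult_distrib)
  have "(\<Sum>i<N. \<bar>x i\<bar> * (\<bar>x i\<bar> * \<bar>(x i)\<^sup>2 - 1 / 2\<bar>))\<^sup>2 \<le>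
      (\<Sum>i<N. \<bar>x i\<bar>\<^sup>2) * (\<Sum>i<N. (\<bar>x i\<bar> * \<bar>(x i)\<^sup>2 - 1 / 2\<bar>)\<^sup>2)"
    by (rule Cauchy_Schwarz_ineq_sum)
  then show "(\<Sum>i<N. (x i)\<^sup>2 * \<bar>(x i)\<^sup>2 - 1 / 2\<bar>)\<^sup>2 \<le> defect"
    by (simp only: e1 e2 sum_2 power2_abs mult_1_left defect_def)
qed

text \<open>The tangent of the \<open>k\<close>-th power at 1/2, averaged under the weights
  \<open>x\<^sup>2\<close>; the mean of the linear term is
  \<open>\<kappa> 4 - 1 / 2\<close>.\<close>

lemma even_\<kappa>_ge: "(1 / 2) ^ k - real k * \<bar>\<kappa> 4 - 1 / 2\<bar> \<le> \<kappa> (2 * k + 2)"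
proof -
  have "(\<Sum>i<N. (x i)\<^sup>2 * ((1 / 2) ^ k + k * (1 / 2) ^ (k - 1) * ((x i)\<^sup>2 - 1 / 2))) \<le> \<kappa> (2 * k + 2)"
    unfolding \<kappa>_def
  proof (rule sum_mono)
    fix i
    have "(1 / 2) ^ k + k * (1 / 2) ^ (k - 1) * ((x i)\<^sup>2 - 1 / 2) \<le> ((x i)\<^sup>2) ^ k"
      using power_tangent_le(1)[of "(x i)\<^sup>2" "1 / 2" "k - 1"] by (cases k) auto
    from mult_left_mono[OF this zero_le_power2]
    show "(x i)\<^sup>2 * ((1 / 2) ^ k + k * (1 / 2) ^ (k - 1) * ((x i)\<^sup>2 - 1 / 2)) \<le> x i ^ (2 * k + 2)"
      by (simp only: power_even_odd_split)
  qed
  moreover have "(\<Sum>i<N. (x i)\<^sup>2 * ((1 / 2) ^ k + k * (1 / 2) ^ (k - 1) * ((x i)\<^sup>2 - 1 / 2))) =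
      (1 / 2) ^ k * (\<Sum>i<N. (x i)\<^sup>2) + k * (1 / 2) ^ (k - 1) * (\<kappa> 4 - 1 / 2 * (\<Sum>i<N. (x i)\<^sup>2))"
    unfolding \<kappa>_def sum_distrib_left sum_subtractf[symmetric] sum.distrib[symmetric]
    by (intro sum.cong refl) (simp add: algebra_simps flip: power_add)
  moreover have "- (k * \<bar>\<kappa> 4 - 1 / 2\<bar>) \<le> k * (1 / 2) ^ (k - 1) * (\<kappa> 4 - 1 / 2)"
  proof -
    have "\<bar>k * (1 / 2) ^ (k - 1) * (\<kappa> 4 - 1 / 2)\<bar> = k * (1 / 2) ^ (k - 1) * \<bar>\<kappa> 4 - 1 / 2\<bar>"
      by (simp add: abs_mult)
    also have "\<dots> \<le> real k * 1 * \<bar>\<kappa> 4 - 1 / 2\<bar>"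
      by (intro mult_right_mono mult_left_mono power_le_one) auto
    finally have "\<bar>k * (1 / 2) ^ (k - 1) * (\<kappa> 4 - 1 / 2)\<bar> \<le> real k * 1 * \<bar>\<kappa> 4 - 1 / 2\<bar>" .
    then show ?thesis by linarith
  qed
  ultimately show ?thesis by (simp add: sum_2)
qed

text \<open>The same average with the quadratic remainder kept. It exists for exponents
  \<open>k + 2\<close> only, hence from the sixth cumulant on.\<close>

lemma defect_le:
  "(1 / 2) ^ k * defect \<le> \<kappa> (2 * k + 6) - (1 / 2) ^ (k + 2) + real (k + 2) * \<bar>\<kappa> 4 - 1 / 2\<bar>"
proof -
  have "(\<Sum>i<N. (x i)\<^sup>2 * ((1 / 2) ^ (k + 2) + (k + 2) * (1 / 2) ^ (k + 1) * ((x i)\<^sup>2 - 1 / 2) +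
      (1 / 2) ^ k * ((x i)\<^sup>2 - 1 / 2)\<^sup>2)) \<le> \<kappa> (2 * k + 6)"
    unfolding \<kappa>_def
  proof (rule sum_mono)
    fix i
    have "(1 / 2) ^ (k + 2) + (k + 2) * (1 / 2) ^ (k + 1) * ((x i)\<^sup>2 - 1 / 2) +
      (1 / 2) ^ k * ((x i)\<^sup>2 - 1 / 2)\<^sup>2 \<le> ((x i)\<^sup>2) ^ (k + 2)"
      using power_tangent_le(2)[of "(x i)\<^sup>2" "1 / 2" k] by simp
    from mult_left_mono[OF this zero_le_power2]
    show "(x i)\<^sup>2 * ((1 / 2) ^ (k + 2) + (k + 2) * (1 / 2) ^ (k + 1) * ((x i)\<^sup>2 - 1 / 2) +
      (1 / 2) ^ k * ((x i)\<^sup>2 - 1 / 2)\<^sup>2) \<le> x i ^ (2 * k + 6)"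
      by (simp only: power_even_odd_split)
  qed
  moreover have "(\<Sum>i<N. (x i)\<^sup>2 * ((1 / 2) ^ (k + 2) + (k + 2) * (1 / 2) ^ (k + 1) * ((x i)\<^sup>2 - 1 / 2) +
      (1 / 2) ^ k * ((x i)\<^sup>2 - 1 / 2)\<^sup>2)) =
      (1 / 2) ^ (k + 2) * (\<Sum>i<N. (x i)\<^sup>2) + (k + 2) * (1 / 2) ^ (k + 1) * (\<kappa> 4 - 1 / 2 * (\<Sum>i<N. (x i)\<^sup>2))
      + (1 / 2) ^ k * defect"
    unfolding \<kappa>_def defect_def sum_distrib_left sum_subtractf[symmetric] sum.distrib[symmetric]
    by (intro sum.cong refl) (simp add: algebra_simps flip: power_add)
  moreover have "- ((k + 2) * \<bar>\<kappa> 4 - 1 / 2\<bar>) \<le> (k + 2) * (1 / 2) ^ (k + 1) * (\<kappa> 4 - 1 / 2)"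
  proof -
    have "\<bar>real (k + 2) * (1 / 2) ^ (k + 1) * (\<kappa> 4 - 1 / 2)\<bar> = real (k + 2) * (1 / 2) ^ (k + 1) * \<bar>\<kappa> 4 - 1 / 2\<bar>"
      by (simp add: abs_mult)
    also have "\<dots> \<le> real (k + 2) * 1 * \<bar>\<kappa> 4 - 1 / 2\<bar>"
      by (intro mult_right_mono mult_left_mono power_le_one) auto
    finally have "\<bar>real (k + 2) * (1 / 2) ^ (k + 1) * (\<kappa> 4 - 1 / 2)\<bar> \<le> real (k + 2) * 1 * \<bar>\<kappa> 4 - 1 / 2\<bar>" .
    then show ?thesis by linarith
  qed
  ultimately show ?thesis by (simp add: sum_2)
qed

lemma even_\<kappa>_near: "\<bar>\<kappa> (2 * k + 2) - (1 / 2) ^ k\<bar> \<le> real k * sqrt defect"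
proof -
  have "\<kappa> (2 * k + 2) - (1 / 2) ^ k = (\<Sum>i<N. (x i)\<^sup>2 * (((x i)\<^sup>2) ^ k - (1 / 2) ^ k))"
    unfolding \<kappa>_def right_diff_distrib sum_subtractf sum_distrib_right[symmetric] sum_2 power_even_odd_split by simp
  also have "\<bar>\<dots>\<bar> \<le> (\<Sum>i<N. real k * ((x i)\<^sup>2 * \<bar>(x i)\<^sup>2 - 1 / 2\<bar>))"
  proof (rule order_trans[OF sum_abs sum_mono])
    fix i assume "i \<in> {..<N}"
    then have "\<bar>((x i)\<^sup>2) ^ k - (1 / 2) ^ k\<bar> \<le> k * \<bar>(x i)\<^sup>2 - 1 / 2\<bar>"
      by (intro abs_power_diff_le sq_le_1) auto
    from mult_left_mono[OF this, of "(x i)\<^sup>2"]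
    show "\<bar>(x i)\<^sup>2 * (((x i)\<^sup>2) ^ k - (1 / 2) ^ k)\<bar> \<le> real k * ((x i)\<^sup>2 * \<bar>(x i)\<^sup>2 - 1 / 2\<bar>)"
      by (simp add: abs_mult mult_ac)
  qed
  also have "\<dots> \<le> real k * sqrt defect"
    unfolding sum_distrib_left[symmetric] by (intro mult_left_mono sum_weighted_abs_le) simp
  finally show ?thesis .
qed

text \<open>The factor \<open>x ^ 3\<close> carries the sign and is dominated by
  \<open>x\<^sup>2\<close>, while the remaining even power is Lipschitz; all odd cumulants are thus
  governed by \<open>\<kappa> 3\<close>.\<close>

lemma odd_\<kappa>_near: "\<bar>\<kappa> (2 * k + 3) - (1 / 2) ^ k * \<kappa> 3\<bar> \<le> real k * sqrt defect"
proof -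
  have "\<kappa> (2 * k + 3) - (1 / 2) ^ k * \<kappa> 3 = (\<Sum>i<N. x i ^ 3 * (((x i)\<^sup>2) ^ k - (1 / 2) ^ k))"
    unfolding \<kappa>_def right_diff_distrib sum_subtractf sum_distrib_right[symmetric] power_even_odd_split by simp
  also have "\<bar>\<dots>\<bar> \<le> (\<Sum>i<N. real k * ((x i)\<^sup>2 * \<bar>(x i)\<^sup>2 - 1 / 2\<bar>))"
  proof (rule order_trans[OF sum_abs sum_mono])
    fix i assume i: "i \<in> {..<N}"
    then have "\<bar>((x i)\<^sup>2) ^ k - (1 / 2) ^ k\<bar> \<le> k * \<bar>(x i)\<^sup>2 - 1 / 2\<bar>"
      by (intro abs_power_diff_le sq_le_1) auto
    moreover have "\<bar>x i ^ 3\<bar> \<le> (x i)\<^sup>2"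
      using mult_left_mono[OF abs_le_1[of i], of "(x i)\<^sup>2"] i by (simp add: abs_mult power3_eq_cube power2_eq_square mult_ac)
    ultimately have "\<bar>x i ^ 3\<bar> * \<bar>((x i)\<^sup>2) ^ k - (1 / 2) ^ k\<bar> \<le> (x i)\<^sup>2 * (k * \<bar>(x i)\<^sup>2 - 1 / 2\<bar>)"
      by (intro mult_mono) auto
    then show "\<bar>x i ^ 3 * (((x i)\<^sup>2) ^ k - (1 / 2) ^ k)\<bar> \<le> real k * ((x i)\<^sup>2 * \<bar>(x i)\<^sup>2 - 1 / 2\<bar>)"
      by (simp add: abs_mult mult_ac)
  qed
  also have "\<dots> \<le> real k * sqrt defect"
    unfolding sum_distrib_left[symmetric] by (intro mult_left_mono sum_weighted_abs_le) simp
  finally show ?thesis .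
qed

text \<open>
  If \<open>\<kappa> 4\<close> is near \<open>1/2\<close>, the eigenvalue \<open>x m\<close> of largest modulus dominates all odd power sums, so
  these have nearly its sign.
\<close>

lemma odd_\<kappa>_ge:
  assumes m: "m < N" "0 \<le> x m" and max: "\<And>i. i < N \<Longrightarrow> \<bar>x i\<bar> \<le> x m"
  shows "- \<bar>2 * \<kappa> 4 - 1\<bar> \<le> \<kappa> (2 * j + 3)"
proof -
  let ?I = "{..<N} - {m}"
  define s where "s = (x m)\<^sup>2"
  define q where "q = \<kappa> 4"
  define T where "T = (\<Sum>i\<in>?I. \<bar>x i\<bar> ^ 3)"
  have rem: "(\<Sum>i<N. f i) = f m + (\<Sum>i\<in>?I. f i)" for f :: "nat \<Rightarrow> real"
    using m by (intro sum.remove) auto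
  have s: "0 \<le> s" "s \<le> 1" using sq_le_1[OF m(1)] by (auto simp: s_def)
  have sq_s: "(x i)\<^sup>2 \<le> s" if "i < N" for i
    unfolding s_def using power_mono[OF max[OF that], of 2] by simp
  \<comment> \<open>The largest square times the sum of all squares dominates the sum of fourth
    powers.\<close>
  have "q \<le> (\<Sum>i<N. s * (x i)\<^sup>2)"
    unfolding q_def \<kappa>_def
  proof (rule sum_mono)
    fix i assume "i \<in> {..<N}"
    then have "(x i)\<^sup>2 * (x i)\<^sup>2 \<le> s * (x i)\<^sup>2" by (intro mult_right_mono sq_s) auto
    then show "x i ^ 4 \<le> s * (x i)\<^sup>2" by (simp flip: power_add)
  qed
  also have "\<dots> = s" by (simp add: sum_2 flip: sum_distrib_left)
  finally have qs: "q \<le> s" .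
  have q: "0 \<le> q" "q \<le> 1" using qs s by (auto simp: q_def \<kappa>_def intro!: sum_nonneg)
  have T0: "0 \<le> T" unfolding T_def by (intro sum_nonneg) simp
  \<comment> \<open>Cauchy-Schwarz for the product of \<open>\<bar>x i\<bar>\<close> and its square;
    both sums over the other eigenvalues are known from \<open>s\<close> and
    \<open>q\<close>.\<close>
  have "T\<^sup>2 \<le> (\<Sum>i\<in>?I. \<bar>x i\<bar>\<^sup>2) * (\<Sum>i\<in>?I. (\<bar>x i\<bar>\<^sup>2)\<^sup>2)"
    using Cauchy_Schwarz_ineq_sum[of "\<lambda>i. \<bar>x i\<bar>" "\<lambda>i. \<bar>x i\<bar>\<^sup>2" ?I]
    by (simp only: T_def power3_eq_cube power2_eq_square mult.assoc)
  also have "\<dots> = (1 - s) * (q - s\<^sup>2)"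
  proof -
    have "(\<Sum>i\<in>?I. \<bar>x i\<bar>\<^sup>2) = 1 - s" using rem[of "\<lambda>i. (x i)\<^sup>2"] sum_2 by (simp add: s_def)
    moreover have "(\<Sum>i\<in>?I. (\<bar>x i\<bar>\<^sup>2)\<^sup>2) = q - s\<^sup>2"
      using rem[of "\<lambda>i. x i ^ 4"] by (simp add: s_def q_def \<kappa>_def flip: power_mult)
    ultimately show ?thesis by simp
  qed
  \<comment> \<open>Both factors decrease in \<open>s\<close>, and \<open>q\<close> is at most
    \<open>s\<close>.\<close>
  also have "\<dots> \<le> (1 - q) * (q - q\<^sup>2)"
  proof (rule mult_mono)
    show "q - s\<^sup>2 \<le> q - q\<^sup>2" using qs q by (simp add: power_mono)
    have "s\<^sup>2 \<le> q" using member_le_sum[of m "{..<N}" "\<lambda>i. x i ^ 4"] m(1)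
      by (simp add: s_def q_def \<kappa>_def flip: power_mult)
    then show "0 \<le> q - s\<^sup>2" by simp
  qed (use qs q in auto)
  also have "\<dots> = (sqrt q * (1 - q))\<^sup>2" using q by (simp add: power_mult_distrib power2_eq_square algebra_simps)
  finally have T: "T \<le> sqrt q * (1 - q)" by (rule power2_le_imp_le) (use q in simp)
  have "sqrt q * q \<le> sqrt s * s" using qs q s by (intro mult_mono) auto
  also have "\<dots> = x m ^ 3" using m by (simp add: s_def power3_eq_cube power2_eq_square)
  \<comment> \<open>The cube of the largest eigenvalue is at least \<open>q * sqrt q\<close>, so the
    difference to \<open>T\<close> is bounded below by an expression that vanishes at
    \<open>q = 1 / 2\<close>.\<close>
  finally have "sqrt q * (2 * q - 1) \<le> x m ^ 3 - T" using T by (simp add: algebra_simps)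
  moreover have "- \<bar>2 * q - 1\<bar> \<le> sqrt q * (2 * q - 1)"
  proof -
    have "\<bar>sqrt q * (2 * q - 1)\<bar> \<le> 1 * \<bar>2 * q - 1\<bar>"
      unfolding abs_mult using q by (intro mult_right_mono) auto
    then show ?thesis by (simp only: abs_le_iff mult_1_left minus_le_iff)
  qed
  ultimately have ge: "- \<bar>2 * q - 1\<bar> \<le> x m ^ 3 - T" by linarith
  \<comment> \<open>Higher odd orders reduce to the cubic case: the extra even power is
    \<open>s ^ j\<close> for the largest eigenvalue and at most \<open>s ^ j\<close> for the
    others.\<close>
  have "- \<bar>2 * q - 1\<bar> \<le> s ^ j * - \<bar>2 * q - 1\<bar>"
    using s by (simp add: mult_left_le_one_le power_le_one)
  also have "\<dots> \<le> s ^ j * (x m ^ 3 - T)" using s by (intro mult_left_mono ge) auto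
  also have "\<dots> = x m ^ (2 * j + 3) - (\<Sum>i\<in>?I. s ^ j * \<bar>x i\<bar> ^ 3)"
    by (simp add: T_def s_def right_diff_distrib sum_distrib_left power_add flip: power_mult)
  also have "\<dots> \<le> x m ^ (2 * j + 3) + (\<Sum>i\<in>?I. x i ^ (2 * j + 3))"
  proof -
    have "- (s ^ j * \<bar>x i\<bar> ^ 3) \<le> x i ^ (2 * j + 3)" if "i \<in> ?I" for i
    proof -
      have "\<bar>x i ^ (2 * j + 3)\<bar> = ((x i)\<^sup>2) ^ j * \<bar>x i\<bar> ^ 3"
        by (simp add: power_add abs_mult power_abs power_even_abs flip: power_mult)
      also have "\<dots> \<le> s ^ j * \<bar>x i\<bar> ^ 3" using that sq_s[of i] by (intro mult_right_mono power_mono) auto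
      finally show ?thesis by linarith
    qed
    then have "- (\<Sum>i\<in>?I. s ^ j * \<bar>x i\<bar> ^ 3) \<le> (\<Sum>i\<in>?I. x i ^ (2 * j + 3))"
      unfolding sum_negf[symmetric] by (rule sum_mono)
    then show ?thesis by linarith
  qed
  also have "\<dots> = \<kappa> (2 * j + 3)" unfolding \<kappa>_def by (rule rem[symmetric])
  finally show ?thesis by (simp add: q_def)
qed

end

text \<open>The power sums of the two numbers \<open>1 / sqrt 2\<close> and
  \<open>- 1 / sqrt 2\<close>.\<close>

definition tetilla_cumulant :: "nat \<Rightarrow> real" where
  "tetilla_cumulant k = (if even k then 2 * (1 / 2) ^ (k div 2) else 0)"

lemma tetilla_cumulant_simps:
  "tetilla_cumulant (2 * k + 2) = (1 / 2) ^ k" "tetilla_cumulant (2 * k + 3) = 0"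
  "tetilla_cumulant 1 = 0" "tetilla_cumulant 2 = 1" "tetilla_cumulant 3 = 0" "tetilla_cumulant 4 = 1 / 2"
  by (simp_all add: tetilla_cumulant_def power2_eq_square)

lemma index_cases:
  assumes "1 \<le> (k :: nat)"
  obtains "k = 1" | j where "k = 2 * j + 2" | j where "k = 2 * j + 3"
proof -
  have "k = 1 \<or> (\<exists>j. k = 2 * j + 2) \<or> (\<exists>j. k = 2 * j + 3)" using assms by presburger
  then show thesis by (elim disjE exE) (fact that)+
qed

lemma tetilla_cumulant_bounds:
  assumes "1 \<le> k" shows "0 \<le> tetilla_cumulant k" "tetilla_cumulant k \<le> 1"
proof -
  have "0 \<le> tetilla_cumulant k \<and> tetilla_cumulant k \<le> 1"
  proof (cases rule: index_cases[OF assms])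
    case 1
    then show ?thesis by (simp only: tetilla_cumulant_simps) simp
  next
    case (2 j)
    then show ?thesis by (simp only: tetilla_cumulant_simps) (simp add: power_le_one)
  next
    case (3 j)
    then show ?thesis by (simp only: tetilla_cumulant_simps) simp
  qed
  then show "0 \<le> tetilla_cumulant k" "tetilla_cumulant k \<le> 1" by simp_all
qed

lemma free_moment_even_minus: "free_moment (\<lambda>k. (- 1) ^ k * \<kappa> k) (2 * r) = free_moment \<kappa> (2 * r)"
  using cumulant_path_scale[of 1 "- 1" \<kappa> "2 * r"] by simp

lemma eigenvalues_minus: "eigenvalues x N \<Longrightarrow> eigenvalues (\<lambda>i. - x i) N"
  by (simp add: eigenvalues_def sum_negf)

text \<open>
  The modified cumulants \<open>\<kappa>'\<close> dominate those of the tetilla law and are asymptotic to \<open>\<kappa>\<close>, so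
  that the monotonicity of the moments applies.
\<close>

lemma positive_eigenvalues_cumulants_tendsto:
  fixes x :: "nat \<Rightarrow> nat \<Rightarrow> real" and N :: "nat \<Rightarrow> nat"
  assumes ev: "\<And>n. eigenvalues (x n) (N n)"
    and pos: "\<And>n. \<exists>m<N n. 0 \<le> x n m \<and> (\<forall>i<N n. \<bar>x n i\<bar> \<le> x n m)"
    and lim4: "(\<lambda>n. free_moment (eigenvalues.\<kappa> (x n) (N n)) 4) \<longlonglongrightarrow> 5 / 2"
    and limr: "(\<lambda>n. free_moment (eigenvalues.\<kappa> (x n) (N n)) (2 * r)) \<longlonglongrightarrow> free_moment tetilla_cumulant (2 * r)"
    and r: "3 \<le> r" and k: "1 \<le> k"
  shows "(\<lambda>n. eigenvalues.\<kappa> (x n) (N n) k) \<longlonglongrightarrow> tetilla_cumulant k"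
proof -
  interpret eigenvalues "x n" "N n" for n by (rule ev)
  define K where "K n = eigenvalues.\<kappa> (x n) (N n)" for n
  define d where "d n = \<bar>K n 4 - 1 / 2\<bar>" for n
  define K' where "K' n k = max (K n k) (tetilla_cumulant k)" for n k
  have K12: "K n 1 = 0" "K n 2 = 1" for n unfolding K_def by (rule \<kappa>_1, rule \<kappa>_2)
  have K1: "1 \<le> k \<Longrightarrow> \<bar>K n k\<bar> \<le> 1" for n k unfolding K_def by (rule abs_\<kappa>_le_1)
  have "free_moment (K n) 4 = K n 4 + 2" for n using free_moment_small(4)[of "K n"] K12 by simp
  then have "(\<lambda>n. K n 4 + 2 - 5 / 2) \<longlonglongrightarrow> 5 / 2 - 5 / 2"
    using lim4 unfolding K_def by (intro tendsto_diff tendsto_const) simp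
  then have "(\<lambda>n. K n 4 - 1 / 2) \<longlonglongrightarrow> 0" by (simp add: algebra_simps)
  then have d: "d \<longlonglongrightarrow> 0" unfolding d_def by (rule tendsto_rabs_zero)
  have K'1: "1 \<le> k \<Longrightarrow> \<bar>K' n k\<bar> \<le> 1" for n k
    using K1[of k n] tetilla_cumulant_bounds[of k] by (simp add: K'_def)
  \<comment> \<open>One constant for all cases: the even estimate loses \<open>j * d n\<close>, the
    odd one \<open>2 * d n\<close>.\<close>
  have close: "\<bar>K n k - K' n k\<bar> \<le> real k * 2 * d n" if "1 \<le> k" for n k
  proof -
    have d0: "0 \<le> d n" by (simp add: d_def)
    have "tetilla_cumulant k - real k * 2 * d n \<le> K n k"
    proof (cases rule: index_cases[OF that])
      case 1
      then show ?thesis using d0 by (simp add: K12[simplified] tetilla_cumulant_simps[simplified])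
    next
      case (2 j)
      have "real j * d n \<le> real k * 2 * d n" using 2 d0 by (intro mult_right_mono) auto
      then show ?thesis using even_\<kappa>_ge[of j n]
        unfolding 2 tetilla_cumulant_simps d_def K_def by linarith
    next
      case (3 j)
      obtain m where m: "m < N n" "0 \<le> x n m" "\<And>i. i < N n \<Longrightarrow> \<bar>x n i\<bar> \<le> x n m" using pos by blast
      have "2 * d n = \<bar>2 * K n 4 - 1\<bar>"
        using abs_mult[of 2 "K n 4 - 1 / 2"] by (simp add: d_def right_diff_distrib)
      moreover have "2 * d n \<le> real k * 2 * d n" using 3 d0 by (intro mult_right_mono) auto
      ultimately show ?thesis using odd_\<kappa>_ge[OF m, of j]
        unfolding 3 tetilla_cumulant_simps K_def by linarith
    qed
    then show ?thesis using d0 by (auto simp: K'_def max_def)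
  qed
  have diff: "(\<lambda>n. K n k - K' n k) \<longlonglongrightarrow> 0" if "1 \<le> k" for k
  proof (rule Lim_null_comparison)
    show "\<forall>\<^sub>F n in sequentially. norm (K n k - K' n k) \<le> real k * 2 * d n"
      using close[OF that] by simp
    show "(\<lambda>n. real k * 2 * d n) \<longlonglongrightarrow> 0" using tendsto_mult_right_zero[OF d] by blast
  qed
  have "(\<lambda>n. free_moment (K n) (2 * r) - free_moment (K' n) (2 * r)) \<longlonglongrightarrow> 0"
    using cumulant_path_tendsto_diff[of K K' 1 "2 * r", OF K1 K'1 diff] by blast
  from tendsto_diff[OF limr[folded K_def] this]
  have "(\<lambda>n. free_moment (K' n) (2 * r)) \<longlonglongrightarrow> free_moment tetilla_cumulant (2 * r)"
    by simp
  from tendsto_diff[OF this tendsto_const[of "free_moment tetilla_cumulant (2 * r)"]]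
  have D: "(\<lambda>n. free_moment (K' n) (2 * r) - free_moment tetilla_cumulant (2 * r)) \<longlonglongrightarrow> 0" by simp
  have dom: "tetilla_cumulant k \<le> K' n k" for n k by (simp add: K'_def)
  \<comment> \<open>The contribution of the one-block partition is squeezed between 0 and the
    vanishing gap \<open>D\<close> of the moments.\<close>
  have "(\<lambda>n. K' n (2 * r) - tetilla_cumulant (2 * r)) \<longlonglongrightarrow> 0"
  proof (rule Lim_null_comparison[OF _ D])
    have "K' n (Suc (2 * r - 1)) - tetilla_cumulant (Suc (2 * r - 1)) \<le>
        free_moment (K' n) (Suc (2 * r - 1)) - free_moment tetilla_cumulant (Suc (2 * r - 1))" for n
      by (rule free_moment_diff_ge[of tetilla_cumulant "K' n" "2 * r - 1", OF tetilla_cumulant_bounds(1) dom])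
    then show "\<forall>\<^sub>F n in sequentially. norm (K' n (2 * r) - tetilla_cumulant (2 * r)) \<le>
        free_moment (K' n) (2 * r) - free_moment tetilla_cumulant (2 * r)"
      using dom r by (intro always_eventually allI) simp
  qed
  from tendsto_add[OF this diff[of "2 * r"]] r
  have K2r: "(\<lambda>n. K n (2 * r) - tetilla_cumulant (2 * r)) \<longlonglongrightarrow> 0" by simp
  have "(\<lambda>n. (K' n 3)\<^sup>2) \<longlonglongrightarrow> 0"
  proof (rule Lim_null_comparison[OF _ D])
    have "(K' n 3)\<^sup>2 \<le> free_moment (K' n) (2 * r) - free_moment tetilla_cumulant (2 * r)" for n
      by (rule free_moment_even_diff_ge_square[OF tetilla_cumulant_bounds(1) dom _ _ _ _ _ r])
        (simp_all add: K'_def K12[simplified] tetilla_cumulant_simps[simplified])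
    then show "\<forall>\<^sub>F n in sequentially. norm ((K' n 3)\<^sup>2) \<le>
        free_moment (K' n) (2 * r) - free_moment tetilla_cumulant (2 * r)"
      by simp
  qed
  then have "(\<lambda>n. sqrt ((K' n 3)\<^sup>2)) \<longlonglongrightarrow> sqrt 0" by (rule tendsto_real_sqrt)
  then have "(\<lambda>n. K' n 3) \<longlonglongrightarrow> 0" by (simp add: tendsto_rabs_zero_iff)
  from tendsto_add[OF this diff[of 3]] have K3: "(\<lambda>n. K n 3) \<longlonglongrightarrow> 0" by simp
  have "(\<lambda>n. (1 / 2) ^ (r - 3) * eigenvalues.defect (x n) (N n)) \<longlonglongrightarrow> 0"
  proof (rule Lim_null_comparison)
    \<comment> \<open>The index \<open>r - 3\<close> makes the order \<open>2 * k + 6\<close> of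
      \<open>defect_le\<close> equal to \<open>2 * r\<close>, which is where
      \<open>3 \<le> r\<close> enters.\<close>
    have r2: "2 * (r - 3) + 6 = 2 * r" "2 * (r - 3 + 2) + 2 = 2 * r" using r by auto
    have t: "tetilla_cumulant (2 * r) = (1 / 2) ^ (r - 3 + 2)"
      using tetilla_cumulant_simps(1)[of "r - 3 + 2"] unfolding r2 .
    show "\<forall>\<^sub>F n in sequentially. norm ((1 / 2) ^ (r - 3) * eigenvalues.defect (x n) (N n)) \<le>
        (K n (2 * r) - tetilla_cumulant (2 * r)) + real (r - 3 + 2) * d n"
    proof (intro always_eventually allI)
      fix n
      have "(1 / 2) ^ (r - 3) * eigenvalues.defect (x n) (N n) \<le>
        (K n (2 * r) - tetilla_cumulant (2 * r)) + real (r - 3 + 2) * d n"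
        using defect_le[of "r - 3" n] unfolding r2 t K_def d_def .
      then show "norm ((1 / 2) ^ (r - 3) * eigenvalues.defect (x n) (N n)) \<le>
        (K n (2 * r) - tetilla_cumulant (2 * r)) + real (r - 3 + 2) * d n"
        using defect_nonneg[of n] by (simp only: real_norm_def abs_mult abs_of_nonneg zero_le_power)
    qed
    show "(\<lambda>n. (K n (2 * r) - tetilla_cumulant (2 * r)) + real (r - 3 + 2) * d n) \<longlonglongrightarrow> 0"
      using tendsto_add[OF K2r tendsto_mult_right_zero[OF d]] by simp
  qed
  from tendsto_mult_right_zero[OF this, of "2 ^ (r - 3)"]
  have "(\<lambda>n. eigenvalues.defect (x n) (N n)) \<longlonglongrightarrow> 0" by (simp add: power_one_over)
  then have "(\<lambda>n. sqrt (eigenvalues.defect (x n) (N n))) \<longlonglongrightarrow> sqrt 0" by (rule tendsto_real_sqrt)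
  then have sd: "(\<lambda>n. c * sqrt (eigenvalues.defect (x n) (N n))) \<longlonglongrightarrow> 0" for c
    using tendsto_mult_right_zero by simp
  have "(\<lambda>n. K n k - tetilla_cumulant k) \<longlonglongrightarrow> 0"
  proof (cases rule: index_cases[OF k])
    case 1
    then show ?thesis by (simp add: K12[simplified] tetilla_cumulant_simps[simplified])
  next
    case (2 j)
    have "\<forall>\<^sub>F n in sequentially. norm (K n k - tetilla_cumulant k) \<le> real j * sqrt (eigenvalues.defect (x n) (N n))"
      unfolding 2 tetilla_cumulant_simps K_def real_norm_def
      by (intro always_eventually allI even_\<kappa>_near)
    then show ?thesis by (rule Lim_null_comparison[OF _ sd])
  next
    case (3 j)
    have "\<forall>\<^sub>F n in sequentially. norm (K n k - (1 / 2) ^ j * K n 3) \<le> real j * sqrt (eigenvalues.defect (x n) (N n))"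
      unfolding 3 K_def real_norm_def by (intro always_eventually allI odd_\<kappa>_near)
    then have "(\<lambda>n. K n k - (1 / 2) ^ j * K n 3) \<longlonglongrightarrow> 0" by (rule Lim_null_comparison[OF _ sd])
    from tendsto_add[OF this tendsto_mult_right_zero[OF K3, of "(1 / 2) ^ j"]] show ?thesis
      by (simp add: 3 tetilla_cumulant_simps)
  qed
  then show ?thesis unfolding K_def by (rule LIM_zero_cancel)
qed

text \<open>For each \<open>n\<close> separately a sign makes the eigenvalue of largest modulus
  nonnegative. The even moments in the hypotheses do not see the signs.\<close>

lemma eigenvalues_moments_tendsto:
  fixes x :: "nat \<Rightarrow> nat \<Rightarrow> real" and N :: "nat \<Rightarrow> nat"
  assumes ev: "\<And>n. eigenvalues (x n) (N n)"
    and lim4: "(\<lambda>n. free_moment (eigenvalues.\<kappa> (x n) (N n)) 4) \<longlonglongrightarrow> 5 / 2"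
    and limr: "(\<lambda>n. free_moment (eigenvalues.\<kappa> (x n) (N n)) (2 * r)) \<longlonglongrightarrow> free_moment tetilla_cumulant (2 * r)"
    and r: "3 \<le> r"
  shows "(\<lambda>n. free_moment (eigenvalues.\<kappa> (x n) (N n)) k) \<longlonglongrightarrow> free_moment tetilla_cumulant k"
proof -
  have "\<exists>e::real. (e = 1 \<or> e = - 1) \<and> (\<exists>m<N n. 0 \<le> e * x n m \<and> (\<forall>i<N n. \<bar>e * x n i\<bar> \<le> e * x n m))" for n
  proof -
    interpret eigenvalues "x n" "N n" by (rule ev)
    have "N n > 0" using sum_2 by (cases "N n") auto
    define M where "M = Max ((\<lambda>i. \<bar>x n i\<bar>) ` {..<N n})"
    have "M \<in> (\<lambda>i. \<bar>x n i\<bar>) ` {..<N n}" unfolding M_def using \<open>N n > 0\<close> by (intro Max_in) auto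
    then obtain m where m: "m < N n" "\<bar>x n m\<bar> = M" by auto
    have "\<bar>x n i\<bar> \<le> \<bar>x n m\<bar>" if "i < N n" for i unfolding m(2) M_def using that by (intro Max_ge) auto
    then show ?thesis using m(1)
      by (intro exI[of _ "if 0 \<le> x n m then 1 else - 1"]) (auto intro!: exI[of _ m])
  qed
  from choice[OF allI[OF this]] obtain e :: "nat \<Rightarrow> real"
    where ex: "\<forall>n. (e n = 1 \<or> e n = - 1) \<and>
      (\<exists>m<N n. 0 \<le> e n * x n m \<and> (\<forall>i<N n. \<bar>e n * x n i\<bar> \<le> e n * x n m))" by (rule exE)
  note e = ex[rule_format, THEN conjunct1] and pos = ex[rule_format, THEN conjunct2]
  define y where "y n i = e n * x n i" for n i
  have evy: "eigenvalues (y n) (N n)" for n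
    using e[of n] ev[of n] eigenvalues_minus[OF ev[of n]] unfolding y_def by auto
  define K where "K n = eigenvalues.\<kappa> (x n) (N n)" for n
  define L where "L n = eigenvalues.\<kappa> (y n) (N n)" for n
  have L: "L n k = e n ^ k * K n k" for n k
    unfolding K_def L_def eigenvalues.\<kappa>_def[OF ev] eigenvalues.\<kappa>_def[OF evy]
    by (simp add: y_def power_mult_distrib sum_distrib_left)
  have even: "free_moment (L n) (2 * r) = free_moment (K n) (2 * r)" for n r
  proof -
    have "L n = (\<lambda>k. e n ^ k * K n k)" by (rule ext) (rule L)
    then show ?thesis using e[of n] free_moment_even_minus[of "K n" r] by auto
  qed
  have K1: "1 \<le> k \<Longrightarrow> \<bar>K n k\<bar> \<le> 1" for n k
    unfolding K_def by (rule eigenvalues.abs_\<kappa>_le_1[OF ev])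
  have T1: "1 \<le> k \<Longrightarrow> \<bar>tetilla_cumulant k\<bar> \<le> 1" for k using tetilla_cumulant_bounds[of k] by auto
  have limL: "(\<lambda>n. L n k) \<longlonglongrightarrow> tetilla_cumulant k" if "1 \<le> k" for k
    unfolding L_def
  proof (rule positive_eigenvalues_cumulants_tendsto[OF evy _ _ _ r that])
    show "\<exists>m<N n. 0 \<le> y n m \<and> (\<forall>i<N n. \<bar>y n i\<bar> \<le> y n m)" for n using pos by (simp add: y_def)
    show "(\<lambda>n. free_moment (eigenvalues.\<kappa> (y n) (N n)) 4) \<longlonglongrightarrow> 5 / 2"
      using lim4 even[of _ 2] by (simp add: K_def L_def)
    show "(\<lambda>n. free_moment (eigenvalues.\<kappa> (y n) (N n)) (2 * r)) \<longlonglongrightarrow> free_moment tetilla_cumulant (2 * r)"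
      using limr even[of _ r] by (simp add: K_def L_def)
  qed
  have limK: "(\<lambda>n. K n k - tetilla_cumulant k) \<longlonglongrightarrow> 0" if k: "1 \<le> k" for k
  proof (cases "even k")
    case True
    then have "e n ^ k = 1" for n using e[of n] by auto
    then show ?thesis using limL[OF k] L by (simp add: LIM_zero)
  next
    \<comment> \<open>The signs may vary with \<open>n\<close>, but odd cumulants of the tetilla law
      vanish, so convergence of the modulus suffices.\<close>
    case False
    have abs: "\<bar>L n k\<bar> = \<bar>K n k\<bar>" for n using e[of n] L[of n k] by (auto simp: abs_mult power_abs)
    have "(\<lambda>n. \<bar>L n k\<bar>) \<longlonglongrightarrow> 0"
      using tendsto_rabs[OF limL[OF k]] False by (simp add: tetilla_cumulant_def)
    then have "(\<lambda>n. K n k) \<longlonglongrightarrow> 0" unfolding abs by (simp add: tendsto_rabs_zero_iff)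
    then show ?thesis using False by (simp add: tetilla_cumulant_def)
  qed
  have "(\<lambda>n. free_moment (K n) k - free_moment tetilla_cumulant k) \<longlonglongrightarrow> 0"
    using cumulant_path_tendsto_diff[of K "\<lambda>_. tetilla_cumulant" 1 k, OF K1 T1 limK] by blast
  then show ?thesis unfolding K_def by (rule LIM_zero_cancel)
qed

section \<open>The Schwinger-Dyson equation for free semicircular families\<close>

text \<open>
  The sum of \<open>f u v\<close> over all factorizations \<open>w = u i v\<close>, that is, the free difference quotient of
  \<open>w\<close> with respect to the letter \<open>i\<close>.
\<close>

fun split_sum :: "'i \<Rightarrow> 'i list \<Rightarrow> ('i list \<Rightarrow> 'i list \<Rightarrow> complex) \<Rightarrow> complex" where
  "split_sum i [] f = 0"
| "split_sum i (x # w) f = (if x = i then f [] w else 0) + split_sum i w (\<lambda>u. f (x # u))"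

text \<open>The Leibniz rule of the free difference quotient.\<close>

lemma split_sum_append:
  "split_sum i (u @ v) f = split_sum i u (\<lambda>a b. f a (b @ v)) + split_sum i v (\<lambda>a. f (u @ a))"
  by (induction u arbitrary: f) auto

lemma split_sum_cong:
  "(\<And>u v. w = u @ i # v \<Longrightarrow> f u v = g u v) \<Longrightarrow> split_sum i w f = split_sum i w g"
proof (induction w arbitrary: f g)
  case (Cons x w)
  have "split_sum i w (\<lambda>u. f (x # u)) = split_sum i w (\<lambda>u. g (x # u))"
    by (rule Cons.IH) (use Cons.prems in auto)
  moreover have "x = i \<Longrightarrow> f [] w = g [] w" using Cons.prems[of "[]" w] by simp
  ultimately show ?case by simp
qed simp

lemma split_sum_add: "split_sum i w (\<lambda>u v. f u v + g u v) = split_sum i w f + split_sum i w g"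
  by (induction w arbitrary: f g) auto

lemma split_sum_zero: "split_sum i w (\<lambda>u v. 0) = 0"
  by (induction w) auto

lemma split_sum_cmult: "split_sum i w (\<lambda>u v. c * f u v) = c * split_sum i w f"
  by (induction w arbitrary: f) (auto simp: algebra_simps)

lemma split_sum_cmult_right: "split_sum i w (\<lambda>u v. f u v * c) = split_sum i w f * c"
  by (induction w arbitrary: f) (auto simp: algebra_simps)

lemma split_sum_swap:
  "split_sum i u (\<lambda>a b. split_sum j v (\<lambda>p q. g a b p q)) = split_sum j v (\<lambda>p q. split_sum i u (\<lambda>a b. g a b p q))"
  by (induction u arbitrary: g) (auto simp: split_sum_zero split_sum_add)

text \<open>Coassociativity: both sides run over the factorizations of \<open>w\<close> as
  \<open>a i p j q\<close>.\<close>

lemma split_sum_assoc: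
  "split_sum i w (\<lambda>a b. split_sum j b (\<lambda>p q. g a p q)) = split_sum j w (\<lambda>c q. split_sum i c (\<lambda>a p. g a p q))"
  by (induction w arbitrary: g) (auto simp: split_sum_add split_sum_zero)

text \<open>
  The trace property allows rotating an occurrence of the largest letter to the front. The terms
  are then matched by applying the equation for \<open>i\<close> to shorter words.
\<close>

lemma Schwinger_Dyson_of_max_letter:
  fixes m :: "nat list \<Rightarrow> complex"
  assumes tr: "\<And>u v. m (u @ v) = m (v @ u)"
    and max: "\<And>k w. set w \<subseteq> {..k} \<Longrightarrow> k < N \<Longrightarrow> m (k # w) = split_sum k w (\<lambda>a b. m a * m b)"
    and "i < N" "set w \<subseteq> {..<N}"
  shows "m (i # w) = split_sum i w (\<lambda>a b. m a * m b)"
  using assms(3,4)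
proof (induction "length w" arbitrary: w rule: less_induct)
  case less
  define k where "k = Max (set (i # w))"
  have kin: "k \<in> set (i # w)" unfolding k_def by (rule Max_in) auto
  have kmax: "set (i # w) \<subseteq> {..k}" unfolding k_def by (auto intro!: Max_ge)
  have kN: "k < N" using kin less.prems by auto
  have Mk: "m (k # u) = split_sum k u (\<lambda>a b. m a * m b)" if "set u \<subseteq> set (i # w)" for u
    using that kmax kN by (intro max) auto
  show ?case
  proof (cases "i = k")
    case True
    then show ?thesis using Mk[of w] by auto
  next
    case False
    then obtain w1 w2 where w: "w = w1 @ k # w2" using kin by (auto dest: split_list)
    have IH: "m (i # u) = split_sum i u (\<lambda>a b. m a * m b)" if "length u < length w" "set u \<subseteq> set w" for u
      using less.hyps[OF that(1)] that(2) less.prems by auto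
    have "m (i # w) = m (k # w2 @ i # w1)" using tr[of "i # w1" "k # w2"] by (simp add: w)
    also have "\<dots> = split_sum k (w2 @ i # w1) (\<lambda>a b. m a * m b)" by (rule Mk) (auto simp: w)
    also have "\<dots> = split_sum k w2 (\<lambda>p q. m p * m (q @ i # w1)) + split_sum k w1 (\<lambda>p q. m (w2 @ i # p) * m q)"
      using False by (simp add: split_sum_append)
    also have "split_sum k w2 (\<lambda>p q. m p * m (q @ i # w1)) = split_sum k w2 (\<lambda>p q.
        split_sum i w1 (\<lambda>a b. m p * (m a * m (q @ b))) + split_sum i q (\<lambda>a b. m p * m (a @ w1) * m b))"
    proof (rule split_sum_cong)
      fix p q assume pq: "w2 = p @ k # q"
      have "m (q @ i # w1) = m (i # w1 @ q)" using tr[of q "i # w1"] by simp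
      also have "\<dots> = split_sum i (w1 @ q) (\<lambda>a b. m a * m b)" by (rule IH) (auto simp: w pq)
      also have "\<dots> = split_sum i w1 (\<lambda>a b. m a * m (q @ b)) + split_sum i q (\<lambda>a b. m (a @ w1) * m b)"
        by (simp only: split_sum_append tr[of w1] tr[of _ q])
      finally show "m p * m (q @ i # w1) =
        split_sum i w1 (\<lambda>a b. m p * (m a * m (q @ b))) + split_sum i q (\<lambda>a b. m p * m (a @ w1) * m b)"
        by (simp add: split_sum_cmult distrib_left mult.assoc)
    qed
    also have "split_sum k w1 (\<lambda>p q. m (w2 @ i # p) * m q) = split_sum k w1 (\<lambda>p q.
        split_sum i p (\<lambda>a b. m a * (m (w2 @ b) * m q)) + split_sum i w2 (\<lambda>a b. m (a @ p) * m q * m b))"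
    proof (rule split_sum_cong)
      fix p q assume pq: "w1 = p @ k # q"
      have "m (w2 @ i # p) = m (i # p @ w2)" using tr[of w2 "i # p"] by simp
      also have "\<dots> = split_sum i (p @ w2) (\<lambda>a b. m a * m b)" by (rule IH) (auto simp: w pq)
      also have "\<dots> = split_sum i p (\<lambda>a b. m a * m (w2 @ b)) + split_sum i w2 (\<lambda>a b. m (a @ p) * m b)"
        by (simp only: split_sum_append tr[of p] tr[of _ w2])
      finally have *: "m (w2 @ i # p) = split_sum i p (\<lambda>a b. m a * m (w2 @ b)) + split_sum i w2 (\<lambda>a b. m (a @ p) * m b)" .
      have "split_sum i p (\<lambda>a b. m a * (m (w2 @ b) * m q)) = split_sum i p (\<lambda>a b. m a * m (w2 @ b)) * m q"
        by (simp only: split_sum_cmult_right[symmetric] mult.assoc)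
      moreover have "split_sum i w2 (\<lambda>a b. m (a @ p) * m q * m b) = split_sum i w2 (\<lambda>a b. m (a @ p) * m b) * m q"
        by (simp only: split_sum_cmult_right[symmetric]) (simp only: mult_ac)
      ultimately show "m (w2 @ i # p) * m q =
        split_sum i p (\<lambda>a b. m a * (m (w2 @ b) * m q)) + split_sum i w2 (\<lambda>a b. m (a @ p) * m q * m b)"
        by (simp only: * distrib_right)
    qed
    \<comment> \<open>The four sums run over the noncrossing choices of a partner for the leading
      \<open>i\<close> and for the \<open>k\<close> between \<open>w1\<close> and \<open>w2\<close>.
      Expanding at \<open>i\<close> first, as done below, produces the same choices in the other
      order.\<close>
    finally have lhs: "m (i # w) =
        split_sum i w1 (\<lambda>a b. split_sum k w2 (\<lambda>p q. m p * (m a * m (q @ b)))) +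
        split_sum i w2 (\<lambda>c b. split_sum k c (\<lambda>p a. m p * m (a @ w1) * m b)) +
        (split_sum i w1 (\<lambda>a c. split_sum k c (\<lambda>b q. m a * (m (w2 @ b) * m q))) +
         split_sum i w2 (\<lambda>a b. split_sum k w1 (\<lambda>p q. m (a @ p) * m q * m b)))"
      unfolding split_sum_add split_sum_assoc[of k w2 i]
        split_sum_assoc[of i w1 k "\<lambda>a b q. m a * (m (w2 @ b) * m q)"]
        split_sum_swap[of k w2 i w1] split_sum_swap[of k w1 i w2] .
    have "split_sum i w (\<lambda>a b. m a * m b) = split_sum i w1 (\<lambda>a b. m a * m (b @ k # w2)) +
        split_sum i w2 (\<lambda>a b. m (w1 @ k # a) * m b)"
      using False by (simp add: w split_sum_append)
    also have "split_sum i w1 (\<lambda>a b. m a * m (b @ k # w2)) = split_sum i w1 (\<lambda>a b.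
        split_sum k w2 (\<lambda>p q. m p * (m a * m (q @ b))) + split_sum k b (\<lambda>p q. m a * (m (w2 @ p) * m q)))"
    proof (rule split_sum_cong)
      fix a b assume ab: "w1 = a @ i # b"
      have "m (b @ k # w2) = m (k # w2 @ b)" using tr[of b "k # w2"] by simp
      also have "\<dots> = split_sum k (w2 @ b) (\<lambda>a b. m a * m b)" by (rule Mk) (auto simp: w ab)
      also have "\<dots> = split_sum k w2 (\<lambda>p q. m p * m (q @ b)) + split_sum k b (\<lambda>p q. m (w2 @ p) * m q)"
        by (simp only: split_sum_append)
      finally show "m a * m (b @ k # w2) =
        split_sum k w2 (\<lambda>p q. m p * (m a * m (q @ b))) + split_sum k b (\<lambda>p q. m a * (m (w2 @ p) * m q))"
        by (simp add: split_sum_cmult distrib_left mult.left_commute[of _ "m a"])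
    qed
    also have "split_sum i w2 (\<lambda>a b. m (w1 @ k # a) * m b) = split_sum i w2 (\<lambda>a b.
        split_sum k a (\<lambda>p q. m p * m (q @ w1) * m b) + split_sum k w1 (\<lambda>p q. m (a @ p) * m q * m b))"
    proof (rule split_sum_cong)
      fix a b assume ab: "w2 = a @ i # b"
      have "m (w1 @ k # a) = m (k # a @ w1)" using tr[of w1 "k # a"] by simp
      also have "\<dots> = split_sum k (a @ w1) (\<lambda>a b. m a * m b)" by (rule Mk) (auto simp: w ab)
      also have "\<dots> = split_sum k a (\<lambda>p q. m p * m (q @ w1)) + split_sum k w1 (\<lambda>p q. m (a @ p) * m q)"
        by (simp only: split_sum_append)
      finally show "m (w1 @ k # a) * m b =
        split_sum k a (\<lambda>p q. m p * m (q @ w1) * m b) + split_sum k w1 (\<lambda>p q. m (a @ p) * m q * m b)"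
        by (simp add: split_sum_cmult_right distrib_right)
    qed
    finally show ?thesis unfolding lhs by (simp only: split_sum_add add_ac)
  qed
qed

text \<open>Chebyshev polynomials of the second kind in the variable \<open>2 * cos t\<close>,
  orthogonal for the semicircle law of variance 1. Their free difference quotient is the sum over
  \<open>m < n\<close> of the tensor products of number \<open>m\<close> and number
  \<open>n - 1 - m\<close>.\<close>

fun chebyshev :: "nat \<Rightarrow> real poly" where
  "chebyshev 0 = 1"
| "chebyshev (Suc 0) = [:0, 1:]"
| "chebyshev (Suc (Suc n)) = [:0, 1:] * chebyshev (Suc n) - chebyshev n"

text \<open>A word in the semicircular element, through its Chebyshev polynomials, and other elements.\<close>

datatype 'a letter = Coef 'a | Cheb nat

fun is_Cheb :: "'a letter \<Rightarrow> bool" where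
  "is_Cheb (Cheb n) = True" | "is_Cheb (Coef b) = False"

text \<open>The semicircle law of \<open>X\<close> enters only through the centering of its
  Chebyshev polynomials. In the application \<open>B\<close> contains the letters smaller than the
  one of \<open>X\<close>.\<close>

locale free_chebyshev = free_probability_space A \<phi>
  for A :: "'h :: complex_hilbert_space bop set" and \<phi> +
  fixes X :: "'h bop" and C B :: "'h bop set"
  assumes C: "unital_subalgebra C" "C \<subseteq> A" and B: "unital_subalgebra B" "B \<subseteq> A"
    and X: "X \<in> C"
    and centered: "\<And>n. 1 \<le> n \<Longrightarrow> \<phi> (poly_bop (chebyshev n) X) = 0"
    and free: "free_algebras \<phi> (UNIV :: bool set) (\<lambda>b. if b then C else B)"
begin

definition U :: "nat \<Rightarrow> 'h bop" where "U n = poly_bop (chebyshev n) X"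

lemma U_C: "U n \<in> C" unfolding U_def by (intro poly_bop_closed C X)

lemma U_A: "U n \<in> A" using U_C C by blast

lemma X_A: "X \<in> A" using X C by blast

lemma B_A: "b \<in> B \<Longrightarrow> b \<in> A" using B by blast

lemma U_0: "U 0 = 1" and U_1: "U (Suc 0) = X"
  by (simp_all add: U_def bop_scaleC)

lemma U_rec: "X * U (Suc n) = U (Suc (Suc n)) + U n"
proof -
  have "chebyshev (Suc (Suc n)) + chebyshev n = [:0, 1:] * chebyshev (Suc n)" by simp
  then have "U (Suc (Suc n)) + U n = poly_bop ([:0, 1:] * chebyshev (Suc n)) X"
    unfolding U_def poly_bop_add[symmetric] by (simp only:)
  then show ?thesis by (simp only: poly_bop_mult U_def) (simp add: bop_scaleC)
qed

fun letter :: "'h bop letter \<Rightarrow> 'h bop" where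
  "letter (Coef b) = b" | "letter (Cheb n) = U n"

fun val :: "'h bop letter list \<Rightarrow> 'h bop" where
  "val [] = 1" | "val (t # ts) = letter t * val ts"

definition letter_ok :: "'h bop letter \<Rightarrow> bool" where
  "letter_ok t \<longleftrightarrow> (case t of Coef b \<Rightarrow> b \<in> B | Cheb n \<Rightarrow> True)"

definition alternating :: "'h bop letter list \<Rightarrow> bool" where
  "alternating ts \<longleftrightarrow> (\<forall>t\<in>set ts. case t of Coef b \<Rightarrow> b \<in> B \<and> \<phi> b = 0 | Cheb n \<Rightarrow> 1 \<le> n) \<and>
     distinct_adj (map is_Cheb ts)"

lemma val_append: "val (ts @ us) = val ts * val us"
  by (induction ts) (auto simp: mult.assoc)

lemma letter_A: "letter_ok t \<Longrightarrow> letter t \<in> A"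
  by (cases t) (auto simp: letter_ok_def U_A B_A)

lemma val_A: "list_all letter_ok ts \<Longrightarrow> val ts \<in> A"
  by (induction ts) (auto intro: A_intros letter_A)

lemma alternating_ok: "alternating ts \<Longrightarrow> list_all letter_ok ts"
  unfolding alternating_def list_all_iff letter_ok_def by (auto split: letter.splits)

lemma alternating_val_A: "alternating ts \<Longrightarrow> val ts \<in> A"
  by (intro val_A alternating_ok)

lemma alternating_state:
  assumes "alternating ts" "ts \<noteq> []"
  shows "\<phi> (val ts) = 0"
proof -
  define w where "w = map (\<lambda>t. (is_Cheb t, letter t)) ts"
  have "val us = prod_list (map letter us)" for us by (induction us) auto
  then have "val ts = prod_list (map snd w)" by (simp add: w_def comp_def)
  moreover have "\<phi> (prod_list (map snd w)) = 0"
  proof (rule free[unfolded free_algebras_def, rule_format], intro conjI ballI)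
    show "w \<noteq> []" using assms by (simp add: w_def)
    show "distinct_adj (map fst w)" using assms by (simp add: w_def alternating_def comp_def)
    fix p assume "p \<in> set w"
    then obtain t where t: "t \<in> set ts" "p = (is_Cheb t, letter t)" by (auto simp: w_def)
    with assms show "case p of (i, a) \<Rightarrow> i \<in> UNIV \<and> a \<in> (if i then C else B) \<and> \<phi> a = 0"
      using U_C centered by (cases t) (force simp: alternating_def U_def)+
  qed
  ultimately show ?thesis by simp
qed

lemma alternating_Nil: "alternating []" by (simp add: alternating_def)

lemma alternating_Cons_Cheb:
  "alternating (Cheb n # ts) \<longleftrightarrow> 1 \<le> n \<and> alternating ts \<and> (ts = [] \<or> \<not> is_Cheb (hd ts))"
  by (cases ts) (auto simp: alternating_def)

lemma alternating_Cons_Coef: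
  "alternating (Coef b # ts) \<longleftrightarrow> b \<in> B \<and> \<phi> b = 0 \<and> alternating ts \<and> (ts = [] \<or> is_Cheb (hd ts))"
  by (cases ts) (auto simp: alternating_def)

lemma distinct_adj_append_bool:
  "distinct_adj (xs @ y # ys) \<longleftrightarrow> distinct_adj (xs @ [y]) \<and> distinct_adj (y # ys)"
  by (induction xs rule: induct_list012) auto

lemma alternating_append_Cons:
  "alternating (ts @ t # us) \<longleftrightarrow> alternating (ts @ [t]) \<and> alternating (t # us)"
  using distinct_adj_append_bool[of "map is_Cheb ts" "is_Cheb t" "map is_Cheb us"]
  by (auto simp: alternating_def)

lemma alternating_appendD: "alternating (ts @ us) \<Longrightarrow> alternating ts"
  unfolding alternating_def by (auto simp: distinct_adj_append_iff)

text \<open>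
  The free difference quotient of a word with respect to \<open>X\<close>, evaluated by the state in both
  tensor factors after multiplying the left factor by \<open>L\<close>.
\<close>

fun diff_quotient :: "'h bop letter list \<Rightarrow> 'h bop \<Rightarrow> complex" where
  "diff_quotient [] L = 0"
| "diff_quotient (Coef b # ts) L = diff_quotient ts (L * b)"
| "diff_quotient (Cheb n # ts) L =
     (\<Sum>m<n. \<phi> (L * U m) * \<phi> (U (n - 1 - m) * val ts)) + diff_quotient ts (L * U n)"

text \<open>Every left tensor factor is the value of a nonempty alternating word: the prefix,
  possibly followed by a Chebyshev letter of smaller positive degree, or by
  \<open>U 0 = 1\<close>.\<close>

lemma diff_quotient_zero:
  "alternating (ps @ ts) \<Longrightarrow> ps \<noteq> [] \<Longrightarrow> diff_quotient ts (val ps) = 0"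
proof (induction ts arbitrary: ps)
  case (Cons t ts)
  have IH: "diff_quotient ts (val ps * letter t) = 0"
    using Cons.IH[of "ps @ [t]"] Cons.prems by (simp add: val_append)
  show ?case
  proof (cases t)
    case (Coef b)
    then show ?thesis using IH by simp
  next
    case (Cheb n)
    have "\<phi> (val ps * U m) = 0" for m
    proof (cases m)
      case 0
      then show ?thesis using alternating_state[of ps] alternating_appendD Cons.prems by (simp add: U_0)
    next
      case (Suc m')
      have "alternating (ps @ [Cheb n])" using Cons.prems Cheb by (metis alternating_append_Cons)
      then have "alternating (ps @ [Cheb m])" using Suc by (auto simp: alternating_def)
      from alternating_state[OF this] show ?thesis by (simp add: val_append)
    qed
    then show ?thesis using IH Cheb by simp
  qed
qed simp

text \<open>In front of a coefficient, \<open>X\<close> lengthens the alternating word and both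
  sides vanish. In front of \<open>U n\<close> the three-term recursion leaves
  \<open>U (n - 1)\<close>, which is the only surviving summand, \<open>m = 0\<close>, of the
  difference quotient.\<close>

lemma alternating_Schwinger_Dyson:
  assumes "alternating ts" shows "\<phi> (X * val ts) = diff_quotient ts 1"
proof (cases ts)
  case Nil
  then show ?thesis using alternating_state[of "[Cheb 1]"] by (simp add: alternating_Cons_Cheb alternating_Nil U_1)
next
  case (Cons t us)
  show ?thesis
  proof (cases t)
    case (Coef b)
    have "alternating (Cheb 1 # ts)" using assms Cons Coef by (simp add: alternating_Cons_Cheb)
    from alternating_state[OF this] have "\<phi> (X * val ts) = 0" by (simp add: U_1)
    moreover have "diff_quotient us (val [Coef b]) = 0"
      using assms Cons Coef by (intro diff_quotient_zero) auto
    ultimately show ?thesis by (simp add: Cons Coef)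
  next
    case (Cheb n)
    then obtain k where n: "n = Suc k" using assms Cons by (cases n) (auto simp: alternating_Cons_Cheb)
    have us: "alternating us" "us = [] \<or> \<not> is_Cheb (hd us)"
      using assms Cons Cheb by (auto simp: alternating_Cons_Cheb)
    have "alternating (Cheb (Suc n) # us)" using us by (simp add: alternating_Cons_Cheb)
    from alternating_state[OF this] have z: "\<phi> (U (Suc n) * val us) = 0" by simp
    have "X * val ts = U (Suc n) * val us + U k * val us"
      by (simp add: Cons Cheb n U_rec distrib_right flip: mult.assoc)
    then have "\<phi> (X * val ts) = \<phi> (U k * val us)"
      using z us by (simp add: state_add A_intros U_A alternating_val_A)
    moreover have "diff_quotient us (val [Cheb n]) = 0"
      using assms Cons Cheb by (intro diff_quotient_zero) auto
    moreover have "\<phi> (U m) = (if m = 0 then 1 else 0)" for m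
      using centered[of m] by (auto simp: U_def state_one)
    ultimately show ?thesis
      by (simp add: Cons Cheb n sum.lessThan_Suc_shift del: sum.lessThan_Suc)
  qed
qed

lemma diff_quotient_linear:
  assumes "list_all letter_ok ts" "L \<in> A" "M \<in> A"
  shows "diff_quotient ts (L + c *\<^sub>C M) = diff_quotient ts L + c * diff_quotient ts M"
  using assms
proof (induction ts arbitrary: L M)
  case (Cons t ts)
  have ok: "list_all letter_ok ts" "letter t \<in> A" using Cons.prems letter_A by auto
  show ?case
  proof (cases t)
    case (Coef b)
    then show ?thesis
      using Cons.IH[OF ok(1), of "L * b" "M * b"] Cons.prems ok
      by (simp add: distrib_right bop_scaleC A_intros)
  next
    case (Cheb n)
    have "diff_quotient ts ((L + c *\<^sub>C M) * U n) = diff_quotient ts (L * U n) + c * diff_quotient ts (M * U n)"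
      using Cons.IH[OF ok(1), of "L * U n" "M * U n"] Cons.prems by (simp add: distrib_right bop_scaleC A_intros U_A)
    moreover have "\<phi> ((L + c *\<^sub>C M) * U m) = \<phi> (L * U m) + c * \<phi> (M * U m)" for m
      using Cons.prems by (simp add: distrib_right bop_scaleC A_intros U_A state_add state_scaleC)
    ultimately show ?thesis
      by (simp add: Cheb distrib_right sum.distrib sum_distrib_left algebra_simps)
  qed
qed simp

text \<open>
  \<open>rep W E\<close> says that \<open>E L\<close> is the difference quotient of the element \<open>W\<close> computed from some
  representation of \<open>W\<close> as a combination of alternating products, which need not be unique.
\<close>

inductive rep :: "'h bop \<Rightarrow> ('h bop \<Rightarrow> complex) \<Rightarrow> bool" where
  rep_alternating: "alternating ts \<Longrightarrow> rep (val ts) (diff_quotient ts)"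
| rep_add: "rep W E \<Longrightarrow> rep W' E' \<Longrightarrow> rep (W + W') (\<lambda>L. E L + E' L)"
| rep_scaleC: "rep W E \<Longrightarrow> rep (c *\<^sub>C W) (\<lambda>L. c * E L)"
| rep_cong: "rep W E \<Longrightarrow> (\<And>L. L \<in> A \<Longrightarrow> E L = E' L) \<Longrightarrow> rep W E'"

lemma rep_eqI: "rep W E \<Longrightarrow> W = W' \<Longrightarrow> (\<And>L. L \<in> A \<Longrightarrow> E L = E' L) \<Longrightarrow> rep W' E'"
  using rep_cong by blast

text \<open>The value at \<open>L = 1\<close> is fixed by \<open>W\<close>, so the choice of the
  representation does no harm.\<close>

lemma rep_Schwinger_Dyson: "rep W E \<Longrightarrow> W \<in> A \<and> \<phi> (X * W) = E 1"
proof (induction rule: rep.induct)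
  case (rep_alternating ts)
  then show ?case by (simp add: alternating_Schwinger_Dyson alternating_val_A)
qed (auto simp: A_intros distrib_left bop_scaleC state_add state_scaleC X_A)

text \<open>The difference quotient of \<open>b\<close> is zero, so \<open>b\<close> only moves into
  the left factor. To stay among alternating words, \<open>b\<close> is merged with a leading
  coefficient and split into its centered part and a scalar.\<close>

lemma rep_Coef_times:
  assumes b: "b \<in> B" shows "rep W E \<Longrightarrow> rep (b * W) (\<lambda>L. E (L * b))"
proof (induction rule: rep.induct)
  case (rep_alternating ts)
  have center: "rep (d * val us) (\<lambda>L. diff_quotient us (L * d))"
    if d: "d \<in> B" and us: "alternating us" "us = [] \<or> is_Cheb (hd us)" for d us
  proof -
    define d' where "d' = d - \<phi> d *\<^sub>C 1"
    have d': "d' \<in> B" unfolding d'_def by (intro unital_subalgebra_closed[OF B(1)] unital_subalgebraD[OF B(1)] d)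
    have z: "\<phi> d' = 0"
      using d by (simp add: d'_def state_diff state_scaleC state_one A_intros B_A)
    have alt: "alternating (Coef d' # us)" using us d' z by (simp add: alternating_Cons_Coef)
    have d_eq: "d = d' + \<phi> d *\<^sub>C 1" by (simp add: d'_def)
    show ?thesis
    proof (rule rep_eqI[OF rep_add[OF rep.rep_alternating[OF alt] rep_scaleC[OF rep.rep_alternating[OF us(1)], of "\<phi> d"]]])
      show "val (Coef d' # us) + \<phi> d *\<^sub>C val us = d * val us"
        by (subst (2) d_eq) (simp add: distrib_right bop_scaleC)
      fix L assume L: "L \<in> A"
      have "L * d = L * d' + \<phi> d *\<^sub>C L" by (subst d_eq) (simp add: distrib_left bop_scaleC)
      then show "diff_quotient (Coef d' # us) L + \<phi> d * diff_quotient us L = diff_quotient us (L * d)"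
        using diff_quotient_linear[OF alternating_ok[OF us(1)], of "L * d'" L "\<phi> d"] L d'
        by (simp add: A_intros B_A)
    qed
  qed
  show ?case
  proof (cases ts)
    case Nil
    then show ?thesis using center[OF b, of ts] rep_alternating by simp
  next
    case (Cons t us)
    show ?thesis
    proof (cases t)
      case (Cheb n)
      then show ?thesis using center[OF b, of ts] rep_alternating Cons by simp
    next
      case (Coef c)
      have c: "c \<in> B" "alternating us" "us = [] \<or> is_Cheb (hd us)"
        using rep_alternating Cons Coef by (auto simp: alternating_Cons_Coef)
      have "b * c \<in> B" by (intro unital_subalgebraD[OF B(1)] b c)
      from center[OF this c(2,3)] show ?thesis by (simp add: Cons Coef mult.assoc)
    qed
  qed
next
  case (rep_add W E W' E')
  from rep.rep_add[OF rep_add.IH] show ?case by (simp add: distrib_left)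
next
  case (rep_scaleC W E c)
  from rep.rep_scaleC[OF rep_scaleC.IH, of c] show ?case by (simp add: bop_scaleC)
next
  case (rep_cong W E E')
  show ?case
    by (rule rep.rep_cong[OF rep_cong.IH]) (use rep_cong.hyps b in \<open>simp add: A_intros B_A\<close>)
qed

text \<open>The Leibniz rule, with the tensor product of 1 and \<open>W\<close> as the derivative of
  the new factor \<open>X\<close>. A leading \<open>U n\<close> is absorbed by the three-term
  recursion.\<close>

lemma rep_X_times: "rep W E \<Longrightarrow> rep (X * W) (\<lambda>L. \<phi> L * \<phi> W + E (L * X))"
proof (induction rule: rep.induct)
  case (rep_alternating ts)
  have base: ?case if "ts = [] \<or> \<not> is_Cheb (hd ts)"
  proof -
    have alt: "alternating (Cheb 1 # ts)" using that rep_alternating by (simp add: alternating_Cons_Cheb)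
    show ?thesis
      by (rule rep_eqI[OF rep.rep_alternating[OF alt]]) (simp_all add: U_1 U_0)
  qed
  show ?case
  proof (cases "ts = [] \<or> \<not> is_Cheb (hd ts)")
    case True
    then show ?thesis by (rule base)
  next
    case False
    then obtain n us where ts: "ts = Cheb n # us" by (cases ts; cases "hd ts") auto
    then obtain k where n: "n = Suc k" using rep_alternating by (cases n) (auto simp: alternating_Cons_Cheb)
    have us: "alternating us" "us = [] \<or> \<not> is_Cheb (hd us)"
      using rep_alternating ts by (auto simp: alternating_Cons_Cheb)
    have alt: "alternating (Cheb (Suc n) # us)" using us by (simp add: alternating_Cons_Cheb)
    have val: "X * val ts = U (Suc n) * val us + U k * val us"
      by (simp add: ts n U_rec distrib_right flip: mult.assoc)
    let ?P = "\<lambda>m L. \<phi> (L * U m)" and ?Q = "\<lambda>m. \<phi> (U m * val us)"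
    \<comment> \<open>For \<open>k = 0\<close> the letter \<open>U 0 = 1\<close> disappears, since
      alternating words admit positive degrees only; the formula still holds.\<close>
    have lower: "rep (U k * val us) (\<lambda>L. (\<Sum>m<k. ?P m L * ?Q (k - 1 - m)) + diff_quotient us (L * U k))"
    proof (cases k)
      case 0
      then show ?thesis using rep.rep_alternating[OF us(1)] by (simp add: U_0)
    next
      case (Suc k')
      have "alternating (Cheb k # us)" using us Suc by (simp add: alternating_Cons_Cheb)
      from rep.rep_alternating[OF this] show ?thesis
        by (rule rep_eqI) simp_all
    qed
    show ?thesis
    proof (rule rep_eqI[OF rep_add[OF rep.rep_alternating[OF alt] lower]])
      show "val (Cheb (Suc n) # us) + U k * val us = X * val ts" by (simp add: val)
      fix L assume L: "L \<in> A"
      have LU: "\<phi> (L * X * U (Suc m)) = ?P (Suc (Suc m)) L + ?P m L" for m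
        using L by (simp add: mult.assoc U_rec distrib_left state_add A_intros U_A)
      \<comment> \<open>Applying the recursion to \<open>X * U m\<close> under the sum splits it
        into the difference quotients of \<open>U (Suc n)\<close> without its summand
        \<open>m = 0\<close> and of \<open>U k\<close>.\<close>
      have "(\<Sum>m<n. \<phi> (L * X * U m) * ?Q (n - 1 - m)) =
          ?P 1 L * ?Q k + (\<Sum>m<k. (?P (Suc (Suc m)) L + ?P m L) * ?Q (k - 1 - m))"
        unfolding n sum.lessThan_Suc_shift LU by (simp add: U_0 U_1)
      also have "\<dots> = (\<Sum>m<n. ?P (Suc m) L * ?Q (k - m)) + (\<Sum>m<k. ?P m L * ?Q (k - 1 - m))"
        unfolding n sum.lessThan_Suc_shift[of _ k] by (simp add: distrib_right sum.distrib)
      finally have s: "(\<Sum>m<n. \<phi> (L * X * U m) * ?Q (n - 1 - m)) =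
          (\<Sum>m<n. ?P (Suc m) L * ?Q (k - m)) + (\<Sum>m<k. ?P m L * ?Q (k - 1 - m))" .
      have d: "diff_quotient us (L * X * U n) = diff_quotient us (L * U (Suc n)) + diff_quotient us (L * U k)"
        using diff_quotient_linear[OF alternating_ok[OF us(1)], of "L * U (Suc n)" "L * U k" 1] L
        by (simp add: mult.assoc n U_rec distrib_left bop_scaleC A_intros U_A)
      show "diff_quotient (Cheb (Suc n) # us) L +
          ((\<Sum>m<k. ?P m L * ?Q (k - 1 - m)) + diff_quotient us (L * U k)) =
          \<phi> L * \<phi> (val ts) + diff_quotient ts (L * X)"
        unfolding ts diff_quotient.simps s d
        by (simp add: sum.lessThan_Suc_shift[of _ "Suc k"] U_0 n del: sum.lessThan_Suc)
    qed
  qed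
next
  case (rep_add W E W' E')
  have "\<phi> (W + W') = \<phi> W + \<phi> W'" using rep_Schwinger_Dyson rep_add.hyps by (simp add: state_add)
  then show ?case
    by (intro rep_eqI[OF rep.rep_add[OF rep_add.IH]]) (simp_all add: distrib_left algebra_simps)
next
  case (rep_scaleC W E c)
  have "\<phi> (c *\<^sub>C W) = c * \<phi> W" using rep_Schwinger_Dyson rep_scaleC.hyps by (simp add: state_scaleC)
  then show ?case
    by (intro rep_eqI[OF rep.rep_scaleC[OF rep_scaleC.IH, of c]]) (simp_all add: bop_scaleC algebra_simps)
next
  case (rep_cong W E E')
  show ?case
    by (rule rep.rep_cong[OF rep_cong.IH]) (use rep_cong.hyps in \<open>simp add: A_intros X_A\<close>)
qed

lemma rep_word:
  fixes Y :: "nat \<Rightarrow> 'h bop"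
  assumes Y: "\<And>j. j < k \<Longrightarrow> Y j \<in> B" "Y k = X"
  shows "set w \<subseteq> {..k} \<Longrightarrow> rep (prod_list (map Y w))
    (\<lambda>L. split_sum k w (\<lambda>u v. \<phi> (L * prod_list (map Y u)) * \<phi> (prod_list (map Y v))))"
proof (induction w)
  case Nil
  have "diff_quotient [] = (\<lambda>L. 0)" by (rule ext) simp
  then show ?case using rep.rep_alternating[OF alternating_Nil] by simp
next
  case (Cons i w)
  then have IH: "rep (prod_list (map Y w))
    (\<lambda>L. split_sum k w (\<lambda>u v. \<phi> (L * prod_list (map Y u)) * \<phi> (prod_list (map Y v))))" by simp
  show ?case
  proof (cases "i = k")
    case True
    show ?thesis
      by (rule rep_eqI[OF rep_X_times[OF IH]]) (simp_all add: True Y mult.assoc)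
  next
    case False
    with Cons.prems have "i < k" by (simp add: le_neq_implies_less)
    then have "Y i \<in> B" by (rule Y)
    show ?thesis
      by (rule rep_eqI[OF rep_Coef_times[OF \<open>Y i \<in> B\<close> IH]]) (use False in \<open>simp_all add: mult.assoc\<close>)
  qed
qed

lemma Schwinger_Dyson_last_letter:
  fixes Y :: "nat \<Rightarrow> 'h bop"
  assumes "\<And>j. j < k \<Longrightarrow> Y j \<in> B" "Y k = X" "set w \<subseteq> {..k}"
  shows "\<phi> (prod_list (map Y (k # w))) =
    split_sum k w (\<lambda>u v. \<phi> (prod_list (map Y u)) * \<phi> (prod_list (map Y v)))"
  using rep_Schwinger_Dyson[OF rep_word[of k Y w, OF assms]] assms(2) by simp

end

section \<open>Chebyshev polynomials integrated against the semicircle law\<close>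

lemma chebyshev_2_cos: "poly (chebyshev n) (2 * cos t) * sin t = sin (real (Suc n) * t)"
proof (induction n rule: chebyshev.induct)
  case 1
  then show ?case by simp
next
  case 2
  then show ?case by (simp add: sin_double)
next
  case (3 n)
  have "sin (real (Suc (Suc (Suc n))) * t) + sin (real (Suc n) * t) = 2 * cos t * sin (real (Suc (Suc n)) * t)"
    using sin_add[of "real (Suc (Suc n)) * t" t] sin_diff[of "real (Suc (Suc n)) * t" t]
    by (simp add: algebra_simps)
  then show ?case using 3 by (simp add: algebra_simps)
qed

lemma integral_chebyshev_semicircle:
  assumes v: "v > 0" and n: "1 \<le> n"
  shows "(\<integral>x. poly (chebyshev n) (x / sqrt v) \<partial>semicircle_law v) = 0"
proof -
  define p where "p = poly (chebyshev n)"
  define a where "a = 2 * sqrt v"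
  have a: "a > 0" "a\<^sup>2 = 4 * v" "a / sqrt v = 2" using v by (auto simp: a_def power_mult_distrib)
  define f where "f x = sqrt (4 * v - x\<^sup>2) / (2 * pi * v) * p (x / sqrt v)" for x
  \<comment> \<open>The minus sign makes the substitution increasing, as the substitution rule
    demands; it reappears as \<open>pi - t\<close> below.\<close>
  define g where "g t = - (a * cos t)" for t
  define g' where "g' t = a * sin t" for t
  have pcont: "continuous_on S (\<lambda>x. p (h x))" if "continuous_on S h" for S and h :: "real \<Rightarrow> real"
    unfolding p_def by (intro continuous_on_poly that)
  have [measurable]: "p \<in> borel_measurable borel"
    using pcont[of UNIV id] by (intro borel_measurable_continuous_onI) (simp add: id_def)
  have "(\<integral>x. p (x / sqrt v) \<partial>semicircle_law v) =
      (LBINT x. (indicator {- 2 * sqrt v .. 2 * sqrt v} x * sqrt (4 * v - x\<^sup>2) / (2 * pi * v)) *\<^sub>R p (x / sqrt v))"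
    unfolding semicircle_law_def
  proof (rule integral_density)
    show "AE x in lborel. 0 \<le> indicator {- 2 * sqrt v .. 2 * sqrt v} x * sqrt (4 * v - x\<^sup>2) / (2 * pi * v)"
    proof (rule AE_I2)
      fix x :: real
      have "0 \<le> sqrt (4 * v - x\<^sup>2)" if "- a \<le> x" "x \<le> a"
        using power_mono[of "\<bar>x\<bar>" a 2] that a by simp
      then show "0 \<le> indicator {- 2 * sqrt v .. 2 * sqrt v} x * sqrt (4 * v - x\<^sup>2) / (2 * pi * v)"
        using v by (auto simp: indicator_def a_def)
    qed
  qed measurable
  also have "\<dots> = (LBINT x. f x * indicator {g 0..g pi} x)"
    by (intro Bochner_Integration.integral_cong refl) (simp add: f_def g_def a_def)
  also have "\<dots> = (LBINT t. f (g t) * g' t * indicator {0..pi} t)"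
  proof (rule integral_substitution)
    have "continuous_on {g 0..g pi} f"
      unfolding f_def using v by (intro continuous_intros pcont) auto
    then show "set_integrable lborel {g 0..g pi} f" by (rule borel_integrable_atLeastAtMost')
    show "(g has_real_derivative g' t) (at t)" for t
      unfolding g_def g'_def by (auto intro!: derivative_eq_intros)
    show "continuous_on {0..pi} g'" unfolding g'_def by (intro continuous_intros)
    show "0 \<le> g' t" if "t \<in> {0..pi}" for t using that a by (auto simp: g'_def sin_ge_zero)
  qed simp
  also have "\<dots> = (LBINT t. (2 / pi * (sin (pi - t) * sin (real (Suc n) * (pi - t)))) * indicator {0..pi} t)"
  proof (rule Bochner_Integration.integral_cong[OF refl])
    fix t :: real
    have "f (g t) * g' t = 2 / pi * (sin (pi - t) * sin (real (Suc n) * (pi - t)))" if t: "0 \<le> t" "t \<le> pi"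
    proof -
      have s: "0 \<le> sin t" using t by (rule sin_ge_zero)
      have "4 * v - (g t)\<^sup>2 = (a * sin t)\<^sup>2"
        using a(2) by (simp add: g_def power_mult_distrib sin_squared_eq algebra_simps)
      then have "sqrt (4 * v - (g t)\<^sup>2) = a * sin t" using s a by simp
      moreover have "g t / sqrt v = 2 * cos (pi - t)" using a(3) v by (simp add: g_def a_def)
      ultimately have "f (g t) * g' t = (a * a) / (2 * pi * v) * (sin t * (p (2 * cos (pi - t)) * sin (pi - t)))"
        by (simp add: f_def g'_def)
      also have "\<dots> = 2 / pi * (sin (pi - t) * sin (real (Suc n) * (pi - t)))"
        using a(2) v unfolding p_def chebyshev_2_cos by (simp add: power2_eq_square field_simps)
      finally show ?thesis .
    qed
    then show "f (g t) * g' t * indicator {0..pi} t =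
        (2 / pi * (sin (pi - t) * sin (real (Suc n) * (pi - t)))) * indicator {0..pi} t"
      by (auto simp: indicator_def)
  qed
  also have "\<dots> = 0"
  proof -
    \<comment> \<open>Antiderivative after writing the product of sines as half the difference of
      cosines with frequencies \<open>n\<close> and \<open>n + 2\<close>; \<open>n\<close> is
      positive, so the division is legitimate.\<close>
    define G where "G t = - (2 / pi * (sin (real n * (pi - t)) / (2 * real n)
      - sin (real (n + 2) * (pi - t)) / (2 * real (n + 2))))" for t
    have "(G has_real_derivative 2 / pi * (sin (pi - t) * sin (real (Suc n) * (pi - t)))) (at t)" for t
    proof -
      have "cos (real n * (pi - t)) - cos (real (n + 2) * (pi - t)) = 2 * (sin (pi - t) * sin (real (Suc n) * (pi - t)))"
        using cos_add[of "real (Suc n) * (pi - t)" "pi - t"] cos_diff[of "real (Suc n) * (pi - t)" "pi - t"]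
        by (simp add: algebra_simps)
      then have eq: "2 / pi * (sin (pi - t) * sin (real (Suc n) * (pi - t))) =
          - (2 / pi * (- cos (real n * (pi - t)) / 2 - (- cos (real (n + 2) * (pi - t)) / 2)))"
        by (simp add: field_simps)
      have h: "((\<lambda>t. sin (c * (pi - t)) / (2 * c)) has_real_derivative - cos (c * (pi - t)) / 2) (at t)"
        if "c \<noteq> 0" for c t using that by (auto intro!: derivative_eq_intros)
      show ?thesis
        unfolding G_def eq by (intro DERIV_minus DERIV_cmult DERIV_diff h) (use n in auto)
    qed
    then have "(LBINT t. (2 / pi * (sin (pi - t) * sin (real (Suc n) * (pi - t)))) * indicator {0..pi} t) = G pi - G 0"
      by (intro integral_FTC_Icc_real) (auto intro!: continuous_intros)
    also have "\<dots> = 0"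
      using sin_npi[of n] sin_npi[of "n + 2"] by (simp add: G_def)
    finally show ?thesis .
  qed
  finally show ?thesis by (simp add: p_def)
qed

lemma poly_bop_scale:
  "poly_bop p (complex_of_real c *\<^sub>C T) = poly_bop (pcompose p [:0, c:]) T"
  by (induction p) (simp_all add: pcompose_pCons poly_bop_add poly_bop_mult poly_bop_smult bop_scaleC)

context free_probability_space
begin

lemma semicircular_chebyshev:
  assumes X: "X \<in> A" "semicircular \<phi> v X" and v: "v > 0" and n: "1 \<le> n"
  shows "\<phi> (poly_bop (chebyshev n) (complex_of_real (1 / sqrt v) *\<^sub>C X)) = 0"
proof -
  have law: "has_nc_law \<phi> X (semicircle_law v)" using X by (simp add: semicircular_def)
  have "\<phi> (poly_bop (chebyshev n) (complex_of_real (1 / sqrt v) *\<^sub>C X)) =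
      complex_of_real (\<integral>x. poly (pcompose (chebyshev n) [:0, 1 / sqrt v:]) x \<partial>semicircle_law v)"
    unfolding poly_bop_scale by (rule has_nc_law_poly[OF law X(1)])
  also have "(\<integral>x. poly (pcompose (chebyshev n) [:0, 1 / sqrt v:]) x \<partial>semicircle_law v) =
      (\<integral>x. poly (chebyshev n) (x / sqrt v) \<partial>semicircle_law v)"
    by (simp add: poly_pcompose)
  also have "\<dots> = 0" by (rule integral_chebyshev_semicircle[OF v n])
  finally show ?thesis by simp
qed

text \<open>Freeness of each variable from the algebra of the earlier ones yields the equation when
  the leading letter is the largest; the trace property extends it to all letters.\<close>

lemma Schwinger_Dyson_of_free:
  fixes X :: "nat \<Rightarrow> 'h bop" and v :: "nat \<Rightarrow> real"
  assumes X: "\<And>i. i < N \<Longrightarrow> X i \<in> A" and v: "\<And>i. i < N \<Longrightarrow> v i > 0"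
    and semi: "\<And>i. i < N \<Longrightarrow> semicircular \<phi> (v i) (X i)"
    and Z: "\<And>i. i < N \<Longrightarrow> Z i \<subseteq> A" "\<And>i j. j < i \<Longrightarrow> i < N \<Longrightarrow> X j \<in> generated_unital_algebra (Z i)"
    and free: "\<And>i. i < N \<Longrightarrow> freely_independent \<phi> {X i} (Z i)"
    and Y: "\<And>i. Y i = complex_of_real (1 / sqrt (v i)) *\<^sub>C X i"
    and i: "i < N" and w: "set w \<subseteq> {..<N}"
  shows "\<phi> (Y i * prod_list (map Y w)) =
    split_sum i w (\<lambda>a b. \<phi> (prod_list (map Y a)) * \<phi> (prod_list (map Y b)))"
proof -
  have YA: "Y i \<in> A" if "i < N" for i unfolding Y using X that by (simp add: A_intros)
  \<comment> \<open>Words with letters outside the index range get the value 0, so that invariance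
    under rotation holds for all words.\<close>
  define m where "m u = (if set u \<subseteq> {..<N} then \<phi> (prod_list (map Y u)) else 0)" for u
  have "m (i # w) = split_sum i w (\<lambda>a b. m a * m b)"
  proof (rule Schwinger_Dyson_of_max_letter[OF _ _ i w])
    show "m (u @ w) = m (w @ u)" for u w
    proof (cases "set u \<subseteq> {..<N} \<and> set w \<subseteq> {..<N}")
      case True
      have "prod_list (map Y x) \<in> A" if "set x \<subseteq> {..<N}" for x
        using that YA by (intro A_intros) auto
      then show ?thesis using True by (simp add: m_def state_trace)
    qed (auto simp: m_def)
    fix k w assume kw: "set w \<subseteq> {..k}" "k < N"
    interpret free_chebyshev A \<phi> "Y k" "generated_unital_algebra {X k}" "generated_unital_algebra (Z k)"
    proof unfold_locales
      show "generated_unital_algebra {X k} \<subseteq> A" "generated_unital_algebra (Z k) \<subseteq> A"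
        using X[OF kw(2)] generated_unital_algebra_subset[OF subalgebra_A Z(1)[OF kw(2)]]
          generated_unital_algebra_subset[OF subalgebra_A, of "{X k}"] by auto
      show "Y k \<in> generated_unital_algebra {X k}" unfolding Y by (intro generated_unital_algebra.intros) simp
      show "\<phi> (poly_bop (chebyshev n) (Y k)) = 0" if "1 \<le> n" for n
        unfolding Y by (rule semicircular_chebyshev[OF X semi v that]) (use kw in auto)
      show "free_algebras \<phi> UNIV (\<lambda>b. if b then generated_unital_algebra {X k} else generated_unital_algebra (Z k))"
      proof -
        have "(\<lambda>b. generated_unital_algebra (if b then {X k} else Z k)) =
            (\<lambda>b. if b then generated_unital_algebra {X k} else generated_unital_algebra (Z k))" by (rule ext) simp
        then show ?thesis using free[OF kw(2)] by (simp add: freely_independent_def)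
      qed
    qed (rule unital_subalgebra_generated)+
    have "Y j \<in> generated_unital_algebra (Z k)" if "j < k" for j
      unfolding Y by (intro generated_unital_algebra.intros(5) Z that kw)
    from Schwinger_Dyson_last_letter[of k Y w, OF this refl kw(1)]
    have "\<phi> (prod_list (map Y (k # w))) =
      split_sum k w (\<lambda>u v. \<phi> (prod_list (map Y u)) * \<phi> (prod_list (map Y v)))" .
    moreover have "set (k # w) \<subseteq> {..<N}" using kw by auto
    moreover have "split_sum k w (\<lambda>u v. \<phi> (prod_list (map Y u)) * \<phi> (prod_list (map Y v))) =
        split_sum k w (\<lambda>a b. m a * m b)"
      by (rule split_sum_cong) (use \<open>set (k # w) \<subseteq> {..<N}\<close> in \<open>auto simp: m_def\<close>)
    ultimately show "m (k # w) = split_sum k w (\<lambda>a b. m a * m b)" by (simp add: m_def)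
  qed
  moreover have "split_sum i w (\<lambda>a b. \<phi> (prod_list (map Y a)) * \<phi> (prod_list (map Y b))) =
      split_sum i w (\<lambda>a b. m a * m b)"
    by (rule split_sum_cong) (use w in \<open>auto simp: m_def\<close>)
  ultimately show ?thesis using i w by (simp add: m_def)
qed

end

section \<open>Quadratic forms in semicircular families\<close>

fun kernel_power :: "(nat \<Rightarrow> nat \<Rightarrow> real) \<Rightarrow> nat \<Rightarrow> nat \<Rightarrow> nat \<Rightarrow> nat \<Rightarrow> real" where
  "kernel_power c N 0 i j = (if i = j then 1 else 0)"
| "kernel_power c N (Suc k) i j = (\<Sum>l<N. kernel_power c N k i l * c l j)"

lemma mat_trace_commute:
  fixes X Y :: "complex mat"
  assumes "X \<in> carrier_mat N N" "Y \<in> carrier_mat N N"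
  shows "(\<Sum>i<N. (X * Y) $$ (i, i)) = (\<Sum>i<N. (Y * X) $$ (i, i))"
proof -
  have "(\<Sum>i<N. (X * Y) $$ (i, i)) = (\<Sum>i<N. \<Sum>j<N. X $$ (i, j) * Y $$ (j, i))"
    using assms by (intro sum.cong refl) (simp add: scalar_prod_def atLeast0LessThan)
  also have "\<dots> = (\<Sum>j<N. \<Sum>i<N. X $$ (i, j) * Y $$ (j, i))" by (rule sum.swap)
  also have "\<dots> = (\<Sum>i<N. (Y * X) $$ (i, i))"
    using assms by (intro sum.cong refl) (simp add: scalar_prod_def atLeast0LessThan mult.commute)
  finally show ?thesis .
qed

lemma upper_triangular_power:
  fixes B :: "complex mat"
  assumes B: "B \<in> carrier_mat N N" "upper_triangular B"
  shows "B ^\<^sub>m k \<in> carrier_mat N N \<and> (\<forall>i<N. (B ^\<^sub>m k) $$ (i, i) = (B $$ (i, i)) ^ k) \<and>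
    (\<forall>i<N. \<forall>j<i. (B ^\<^sub>m k) $$ (i, j) = 0)"
proof (induction k)
  case 0
  then show ?case using B by simp
next
  case (Suc k)
  have low: "B $$ (i, j) = 0" if "j < i" "i < N" for i j using B that by auto
  have entry: "(B ^\<^sub>m Suc k) $$ (i, j) = (\<Sum>l<N. (B ^\<^sub>m k) $$ (i, l) * B $$ (l, j))" if "i < N" "j < N" for i j
    using Suc B that by (simp add: scalar_prod_def atLeast0LessThan)
  have "(B ^\<^sub>m Suc k) $$ (i, i) = (B $$ (i, i)) ^ Suc k" if i: "i < N" for i
  proof -
    have "(\<Sum>l<N. (B ^\<^sub>m k) $$ (i, l) * B $$ (l, i)) = (\<Sum>l\<in>{i}. (B ^\<^sub>m k) $$ (i, l) * B $$ (l, i))"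
    proof (rule sum.mono_neutral_right)
      show "\<forall>l\<in>{..<N} - {i}. (B ^\<^sub>m k) $$ (i, l) * B $$ (l, i) = 0"
      proof
        fix l assume "l \<in> {..<N} - {i}"
        then have "l < i \<or> i < l \<and> l < N" by auto
        then show "(B ^\<^sub>m k) $$ (i, l) * B $$ (l, i) = 0" using Suc low i by auto
      qed
    qed (use i in auto)
    then show ?thesis using Suc i entry[OF i i] by simp
  qed
  moreover have "(B ^\<^sub>m Suc k) $$ (i, j) = 0" if i: "i < N" and j: "j < i" for i j
  proof -
    have "(B ^\<^sub>m k) $$ (i, l) * B $$ (l, j) = 0" if "l < N" for l
    proof (cases "l < i")
      case True
      then show ?thesis using Suc i by simp
    next
      case False
      then show ?thesis using low[of j l] that j by simp
    qed
    then have "(\<Sum>l<N. (B ^\<^sub>m k) $$ (i, l) * B $$ (l, j)) = 0" by (intro sum.neutral) blast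
    then show ?thesis using entry[of i j] i j by simp
  qed
  ultimately show ?case using Suc B by auto
qed

text \<open>
  Only the eigenvalues of a symmetric matrix are needed, so that a triangular form suffices.
\<close>

lemma symmetric_kernel_eigenvalues:
  fixes c :: "nat \<Rightarrow> nat \<Rightarrow> real"
  assumes sym: "\<And>i j. i < N \<Longrightarrow> j < N \<Longrightarrow> c i j = c j i"
  shows "\<exists>x :: nat \<Rightarrow> real. \<forall>k. (\<Sum>i<N. kernel_power c N k i i) = (\<Sum>i<N. x i ^ k)"
proof -
  define M where "M = mat N N (\<lambda>(i, j). complex_of_real (c i j))"
  have M: "M \<in> carrier_mat N N" by (simp add: M_def)
  have Mpow: "M ^\<^sub>m k \<in> carrier_mat N N \<and> (\<forall>i<N. \<forall>j<N. (M ^\<^sub>m k) $$ (i, j) = complex_of_real (kernel_power c N k i j))" for k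
  proof (induction k)
    case 0
    then show ?case using M by auto
  next
    case (Suc k)
    have "(M ^\<^sub>m Suc k) $$ (i, j) = complex_of_real (kernel_power c N (Suc k) i j)" if "i < N" "j < N" for i j
    proof -
      have "(M ^\<^sub>m Suc k) $$ (i, j) = (\<Sum>l<N. (M ^\<^sub>m k) $$ (i, l) * M $$ (l, j))"
        using Suc M that by (simp add: scalar_prod_def atLeast0LessThan)
      also have "\<dots> = (\<Sum>l<N. complex_of_real (kernel_power c N k i l * c l j))"
        using Suc that by (intro sum.cong refl) (simp add: M_def)
      finally show ?thesis by simp
    qed
    then show ?case using mult_carrier_mat[of "M ^\<^sub>m k" N N M N] Suc M by simp
  qed
  obtain es where es: "char_poly M = (\<Prod>a\<leftarrow>es. [:- a, 1:])" using char_poly_factorized[OF M] by blast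
  obtain B P Q where "schur_decomposition M es = (B, P, Q)" by (cases "schur_decomposition M es") auto
  from schur_decomposition[OF M es this] have wit: "similar_mat_wit M B P Q"
    and ut: "upper_triangular B" and diag: "diag_mat B = es" by auto
  from similar_mat_witD2[OF M wit] have B: "B \<in> carrier_mat N N" and P: "P \<in> carrier_mat N N"
    and Q: "Q \<in> carrier_mat N N" and QP: "Q * P = 1\<^sub>m N" by auto
  have real: "B $$ (i, i) \<in> \<real>" if i: "i < N" for i
  proof -
    define e where "e = B $$ (i, i)"
    have "e \<in> set es" using i B unfolding diag[symmetric] e_def diag_mat_def by auto
    then have "poly (char_poly M) e = 0" unfolding es poly_prod_list by (auto simp: prod_list_zero_iff)
    then have "eigenvalue M e" using eigenvalue_root_char_poly[OF M] by blast
    then obtain v where v: "v \<in> carrier_vec N" "v \<noteq> 0\<^sub>v N" "M *\<^sub>v v = e \<cdot>\<^sub>v v"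
      using M unfolding eigenvalue_def eigenvector_def by auto
    have row: "(\<Sum>l<N. complex_of_real (c j l) * v $ l) = e * v $ j" if "j < N" for j
    proof -
      have "(M *\<^sub>v v) $ j = (\<Sum>l<N. M $$ (j, l) * v $ l)"
        using M v(1) that by (simp add: scalar_prod_def atLeast0LessThan)
      moreover have "(M *\<^sub>v v) $ j = e * v $ j" unfolding v(3) using v(1) that by simp
      ultimately show ?thesis using that by (simp add: M_def)
    qed
    define s where "s = (\<Sum>j<N. cnj (v $ j) * v $ j)"
    \<comment> \<open>The value of the Hermitian form at the eigenvector, hence real. It equals
      \<open>e * s\<close> with \<open>s\<close> positive, so \<open>e\<close> is real.\<close>
    define h where "h = (\<Sum>j<N. \<Sum>l<N. complex_of_real (c j l) * (cnj (v $ j) * v $ l))"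
    have "h = (\<Sum>j<N. cnj (v $ j) * (\<Sum>l<N. complex_of_real (c j l) * v $ l))"
      unfolding h_def by (simp add: sum_distrib_left mult_ac)
    also have "\<dots> = (\<Sum>j<N. cnj (v $ j) * (e * v $ j))" by (intro sum.cong refl) (simp add: row)
    also have "\<dots> = e * s" by (simp add: s_def sum_distrib_left mult_ac)
    finally have hs: "h = e * s" .
    have "cnj h = (\<Sum>j<N. \<Sum>l<N. complex_of_real (c l j) * (cnj (v $ l) * v $ j))"
      unfolding h_def by (auto intro!: sum.cong simp: sym)
    also have "\<dots> = h" unfolding h_def by (rule sum.swap)
    finally have "cnj h = h" .
    moreover have "cnj s = s" by (simp add: s_def mult.commute)
    ultimately have "cnj e * s = e * s" using hs by (metis complex_cnj_mult)
    moreover have "s \<noteq> 0"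
    proof -
      obtain j where j: "j < N" "v $ j \<noteq> 0" using v by (metis eq_vecI carrier_vecD index_zero_vec)
      have "s = complex_of_real (\<Sum>j<N. (cmod (v $ j))\<^sup>2)"
        unfolding s_def of_real_sum complex_norm_square by (simp add: mult.commute)
      moreover have "0 < (\<Sum>j<N. (cmod (v $ j))\<^sup>2)"
        using j by (intro sum_pos2[of _ j]) auto
      ultimately show ?thesis by (metis less_irrefl of_real_eq_0_iff)
    qed
    ultimately show ?thesis by (simp add: e_def Reals_cnj_iff)
  qed
  have "(\<Sum>i<N. kernel_power c N k i i) = (\<Sum>i<N. (Re (B $$ (i, i))) ^ k)" for k
  proof -
    have Bk: "B ^\<^sub>m k \<in> carrier_mat N N" using B by simp
    have "complex_of_real (\<Sum>i<N. kernel_power c N k i i) = (\<Sum>i<N. (M ^\<^sub>m k) $$ (i, i))" using Mpow by simp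
    also have "M ^\<^sub>m k = P * (B ^\<^sub>m k * Q)"
      using similar_mat_wit_pow_id[OF wit, of k] P Bk Q by (simp add: assoc_mult_mat)
    also have "(\<Sum>i<N. (P * (B ^\<^sub>m k * Q)) $$ (i, i)) = (\<Sum>i<N. ((B ^\<^sub>m k * Q) * P) $$ (i, i))"
      using P Bk Q by (intro mat_trace_commute) auto
    also have "(B ^\<^sub>m k * Q) * P = B ^\<^sub>m k"
      using assoc_mult_mat[OF Bk Q P] right_mult_one_mat[OF Bk] by (simp add: QP)
    also have "(\<Sum>i<N. (B ^\<^sub>m k) $$ (i, i)) = (\<Sum>i<N. complex_of_real ((Re (B $$ (i, i))) ^ k))"
      using upper_triangular_power[OF B ut, of k] real by (intro sum.cong refl) simp
    finally have "complex_of_real (\<Sum>i<N. kernel_power c N k i i) = complex_of_real (\<Sum>i<N. (Re (B $$ (i, i))) ^ k)"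
      by simp
    then show ?thesis by (simp only: of_real_eq_iff)
  qed
  then show ?thesis by (intro exI[of _ "\<lambda>i. Re (B $$ (i, i))"]) simp
qed

lemma sum_rotate:
  "(\<Sum>j\<in>J. \<Sum>l\<in>L. \<Sum>b\<in>B. f j l b) = (\<Sum>b\<in>B. \<Sum>j\<in>J. \<Sum>l\<in>L. f j l b)"
proof -
  have "(\<Sum>j\<in>J. \<Sum>l\<in>L. \<Sum>b\<in>B. f j l b) = (\<Sum>j\<in>J. \<Sum>b\<in>B. \<Sum>l\<in>L. f j l b)"
    by (intro sum.cong refl) (rule sum.swap)
  also have "\<dots> = (\<Sum>b\<in>B. \<Sum>j\<in>J. \<Sum>l\<in>L. f j l b)" by (rule sum.swap)
  finally show ?thesis .
qed

text \<open>Orthonormality and freeness enter only through the Schwinger-Dyson equation.\<close>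

locale semicircular_family = free_probability_space A \<phi>
  for A :: "'h :: complex_hilbert_space bop set" and \<phi> +
  fixes Y :: "nat \<Rightarrow> 'h bop" and N :: nat
  assumes Y: "\<And>i. i < N \<Longrightarrow> Y i \<in> A" "\<And>i. i < N \<Longrightarrow> self_adjoint (Y i)"
    and Schwinger_Dyson: "\<And>i w. i < N \<Longrightarrow> set w \<subseteq> {..<N} \<Longrightarrow> \<phi> (Y i * prod_list (map Y w)) =
      split_sum i w (\<lambda>a b. \<phi> (prod_list (map Y a)) * \<phi> (prod_list (map Y b)))"
begin

abbreviation ev :: "nat list \<Rightarrow> 'h bop" where "ev w \<equiv> prod_list (map Y w)"

lemma ev_A: "set w \<subseteq> {..<N} \<Longrightarrow> ev w \<in> A"
  using Y by (intro A_intros) auto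

text \<open>Removing two equal letters leaves two shorter words of odd total length, so one of them
  is odd.\<close>

lemma odd_word: "odd (length w) \<Longrightarrow> set w \<subseteq> {..<N} \<Longrightarrow> \<phi> (ev w) = 0"
proof (induction "length w" arbitrary: w rule: less_induct)
  case less
  then obtain i u where w: "w = i # u" by (cases w) auto
  have "split_sum i u (\<lambda>a b. \<phi> (ev a) * \<phi> (ev b)) = split_sum i u (\<lambda>a b. 0)"
  proof (rule split_sum_cong)
    fix a b assume u: "u = a @ i # b"
    have "odd (length a) \<or> odd (length b)" using less.prems w u by auto
    then show "\<phi> (ev a) * \<phi> (ev b) = 0" using less w u by auto
  qed
  then show ?case using Schwinger_Dyson[of i u] less.prems w by (simp add: split_sum_zero)
qed

lemma state_pair: "i < N \<Longrightarrow> j < N \<Longrightarrow> \<phi> (Y i * Y j) = (if i = j then 1 else 0)"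
  using Schwinger_Dyson[of i "[j]"] by (simp add: state_one)

text \<open>The two noncrossing pairings of four points; the crossing one is absent.\<close>

lemma state_four:
  "i < N \<Longrightarrow> j < N \<Longrightarrow> k < N \<Longrightarrow> l < N \<Longrightarrow> \<phi> (Y i * (Y j * (Y k * Y l))) =
    (if i = j then 1 else 0) * (if k = l then 1 else 0) + (if i = l then 1 else 0) * (if j = k then 1 else 0)"
  using Schwinger_Dyson[of i "[j, k, l]"] odd_word[of "[l]"] odd_word[of "[j]"]
  by (simp add: state_one state_pair)

definition quadratic :: "(nat \<Rightarrow> nat \<Rightarrow> real) \<Rightarrow> 'h bop" where
  "quadratic c = (\<Sum>i<N. \<Sum>j<N. complex_of_real (c i j) *\<^sub>C (Y i * Y j))"

lemma quadratic_A: "quadratic c \<in> A"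
  unfolding quadratic_def using Y by (intro A_intros) auto

end

text \<open>Trace zero makes the form centered, so no multiple of 1 has to be subtracted.\<close>

locale quadratic_form = semicircular_family +
  fixes c :: "nat \<Rightarrow> nat \<Rightarrow> real"
  assumes sym: "\<And>i j. i < N \<Longrightarrow> j < N \<Longrightarrow> c i j = c j i" and trace: "(\<Sum>i<N. c i i) = 0"
begin

abbreviation G :: "'a bop" where "G \<equiv> quadratic c"

lemma G_A: "G ^ n \<in> A"
  by (intro A_intros quadratic_A)

lemma state_times_G:
  assumes "u \<in> A" "v \<in> A"
  shows "\<phi> (u * (G * v)) = (\<Sum>j<N. \<Sum>l<N. complex_of_real (c j l) * \<phi> (u * (Y j * (Y l * v))))"
proof -
  have "u * (G * v) = (\<Sum>j<N. \<Sum>l<N. complex_of_real (c j l) *\<^sub>C (u * (Y j * (Y l * v))))"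
    unfolding quadratic_def by (simp add: sum_distrib_left sum_distrib_right bop_scaleC mult.assoc)
  also have "\<phi> \<dots> = (\<Sum>j<N. \<Sum>l<N. complex_of_real (c j l) * \<phi> (u * (Y j * (Y l * v))))"
  proof -
    have A: "u * (Y j * (Y l * v)) \<in> A" if "j < N" "l < N" for j l
      using assms Y that by (intro A_intros) auto
    have "\<phi> (\<Sum>l<N. complex_of_real (c j l) *\<^sub>C (u * (Y j * (Y l * v)))) =
        (\<Sum>l<N. complex_of_real (c j l) * \<phi> (u * (Y j * (Y l * v))))" if "j < N" for j
      using that by (subst state_sum) (auto simp: state_scaleC A A_intros(4))
    then show ?thesis
      by (subst state_sum) (auto intro!: A_intros(9,4) A)
  qed
  finally show ?thesis .
qed

lemma odd_word_G: "odd (length w) \<Longrightarrow> set w \<subseteq> {..<N} \<Longrightarrow> \<phi> (ev w * G ^ a) = 0"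
proof (induction a arbitrary: w)
  case 0
  then show ?case using odd_word by simp
next
  case (Suc a)
  have "\<phi> (ev w * (Y j * (Y l * G ^ a))) = 0" if "j < N" "l < N" for j l
    using Suc.IH[of "w @ [j, l]"] Suc.prems that by (simp add: mult.assoc)
  then show ?case using state_times_G[OF ev_A G_A, of w a] Suc.prems by simp
qed

text \<open>The Leibniz rule for \<open>G ^ a\<close>. By symmetry of \<open>c\<close>, the
  difference quotient of \<open>G\<close> in direction \<open>i\<close> is the sum over
  \<open>l\<close> of \<open>c i l\<close> times both tensor products of 1 and \<open>Y l\<close>.
  The word \<open>w\<close> is there for the induction: expanding one \<open>G\<close> appends two
  letters to it.\<close>

lemma Schwinger_Dyson_G:
  assumes i: "i < N" and w: "set w \<subseteq> {..<N}"
  shows "\<phi> (Y i * (ev w * G ^ a)) = split_sum i w (\<lambda>u v. \<phi> (ev u) * \<phi> (ev v * G ^ a)) +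
    (\<Sum>b<a. \<Sum>l<N. complex_of_real (c i l) * (\<phi> (ev w * G ^ b) * \<phi> (Y l * G ^ (a - 1 - b)) +
       \<phi> (ev w * (G ^ b * Y l)) * \<phi> (G ^ (a - 1 - b))))"
  using w
proof (induction a arbitrary: w)
  case 0
  then show ?case using Schwinger_Dyson[OF i] by simp
next
  case (Suc a)
  let ?c = "\<lambda>j l. complex_of_real (c j l)"
  let ?R = "\<lambda>W b l. \<phi> (W * G ^ b) * \<phi> (Y l * G ^ (a - 1 - b)) + \<phi> (W * (G ^ b * Y l)) * \<phi> (G ^ (a - 1 - b))"
  have word: "set (w @ [j, l]) \<subseteq> {..<N}" if "j < N" "l < N" for j l using Suc.prems that by auto
  have evjl: "ev (w @ [j, l]) * Z = ev w * (Y j * (Y l * Z))" for j l Z by (simp add: mult.assoc)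
  have "\<phi> (Y i * (ev w * G ^ Suc a)) = \<phi> ((Y i * ev w) * (G * G ^ a))" by (simp add: mult.assoc)
  also have "\<dots> = (\<Sum>j<N. \<Sum>l<N. ?c j l * \<phi> ((Y i * ev w) * (Y j * (Y l * G ^ a))))"
    by (rule state_times_G) (use i Suc.prems Y in \<open>auto intro!: A_intros ev_A G_A\<close>)
  also have "\<dots> = (\<Sum>j<N. \<Sum>l<N. ?c j l * (split_sum i w (\<lambda>u v. \<phi> (ev u) * \<phi> (ev v * (Y j * (Y l * G ^ a)))) +
      ((if j = i then \<phi> (ev w) * \<phi> (Y l * G ^ a) else 0) + (if l = i then \<phi> (ev w * Y j) * \<phi> (G ^ a) else 0)) +
      (\<Sum>b<a. \<Sum>l'<N. ?c i l' * ?R (ev w * (Y j * Y l)) b l')))"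
  proof (intro sum.cong refl)
    fix j l assume "j \<in> {..<N}" "l \<in> {..<N}"
    then have jl: "j < N" "l < N" by auto
    have "\<phi> ((Y i * ev w) * (Y j * (Y l * G ^ a))) = \<phi> (Y i * (ev (w @ [j, l]) * G ^ a))"
      unfolding evjl by (simp only: mult.assoc)
    also have "\<dots> = split_sum i (w @ [j, l]) (\<lambda>u v. \<phi> (ev u) * \<phi> (ev v * G ^ a)) +
        (\<Sum>b<a. \<Sum>l'<N. ?c i l' * ?R (ev (w @ [j, l])) b l')"
      by (rule Suc.IH[OF word[OF jl]])
    also have "split_sum i (w @ [j, l]) (\<lambda>u v. \<phi> (ev u) * \<phi> (ev v * G ^ a)) =
        split_sum i w (\<lambda>u v. \<phi> (ev u) * \<phi> (ev v * (Y j * (Y l * G ^ a)))) +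
        ((if j = i then \<phi> (ev w) * \<phi> (Y l * G ^ a) else 0) + (if l = i then \<phi> (ev w * Y j) * \<phi> (G ^ a) else 0))"
      by (simp add: split_sum_append mult.assoc)
    also have "ev (w @ [j, l]) = ev w * (Y j * Y l)" by simp
    finally show "?c j l * \<phi> ((Y i * ev w) * (Y j * (Y l * G ^ a))) =
      ?c j l * (split_sum i w (\<lambda>u v. \<phi> (ev u) * \<phi> (ev v * (Y j * (Y l * G ^ a)))) +
      ((if j = i then \<phi> (ev w) * \<phi> (Y l * G ^ a) else 0) + (if l = i then \<phi> (ev w * Y j) * \<phi> (G ^ a) else 0)) +
      (\<Sum>b<a. \<Sum>l'<N. ?c i l' * ?R (ev w * (Y j * Y l)) b l'))" by simp
  qed
  also have "\<dots> = (\<Sum>j<N. \<Sum>l<N. ?c j l * split_sum i w (\<lambda>u v. \<phi> (ev u) * \<phi> (ev v * (Y j * (Y l * G ^ a))))) +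
      (\<Sum>j<N. \<Sum>l<N. ?c j l * ((if j = i then \<phi> (ev w) * \<phi> (Y l * G ^ a) else 0) +
        (if l = i then \<phi> (ev w * Y j) * \<phi> (G ^ a) else 0))) +
      (\<Sum>j<N. \<Sum>l<N. ?c j l * (\<Sum>b<a. \<Sum>l'<N. ?c i l' * ?R (ev w * (Y j * Y l)) b l'))"
    by (simp only: distrib_left sum.distrib)
  also have "(\<Sum>j<N. \<Sum>l<N. ?c j l * split_sum i w (\<lambda>u v. \<phi> (ev u) * \<phi> (ev v * (Y j * (Y l * G ^ a))))) =
      split_sum i w (\<lambda>u v. \<phi> (ev u) * \<phi> (ev v * G ^ Suc a))"
  proof -
    have ss: "split_sum i w (\<lambda>u v. \<Sum>x\<in>I. f x u v) = (\<Sum>x\<in>I. split_sum i w (f x))" for f and I :: "nat set"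
      by (induction I rule: infinite_finite_induct) (simp_all add: split_sum_zero split_sum_add)
    have "split_sum i w (\<lambda>u v. \<phi> (ev u) * \<phi> (ev v * G ^ Suc a)) =
        split_sum i w (\<lambda>u v. \<Sum>j<N. \<Sum>l<N. ?c j l * (\<phi> (ev u) * \<phi> (ev v * (Y j * (Y l * G ^ a)))))"
    proof (rule split_sum_cong)
      fix u v assume "w = u @ i # v"
      then have "ev v \<in> A" using Suc.prems by (intro ev_A) auto
      from state_times_G[OF this G_A, of a]
      show "\<phi> (ev u) * \<phi> (ev v * G ^ Suc a) = (\<Sum>j<N. \<Sum>l<N. ?c j l * (\<phi> (ev u) * \<phi> (ev v * (Y j * (Y l * G ^ a)))))"
        by (simp add: sum_distrib_left mult_ac)
    qed
    then show ?thesis by (simp only: ss split_sum_cmult)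
  qed
  \<comment> \<open>The letter \<open>i\<close> is contracted with one of the two new letters;
    symmetry of \<open>c\<close> gives both contractions the same coefficient.\<close>
  also have "(\<Sum>j<N. \<Sum>l<N. ?c j l * ((if j = i then \<phi> (ev w) * \<phi> (Y l * G ^ a) else 0) +
        (if l = i then \<phi> (ev w * Y j) * \<phi> (G ^ a) else 0))) =
      (\<Sum>l<N. ?c i l * (\<phi> (ev w) * \<phi> (Y l * G ^ a) + \<phi> (ev w * Y l) * \<phi> (G ^ a)))"
  proof -
    have "(\<Sum>j<N. \<Sum>l<N. ?c j l * (if j = i then \<phi> (ev w) * \<phi> (Y l * G ^ a) else 0)) =
        (\<Sum>j<N. if j = i then \<Sum>l<N. ?c j l * (\<phi> (ev w) * \<phi> (Y l * G ^ a)) else 0)"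
      by (intro sum.cong refl) auto
    also have "\<dots> = (\<Sum>l<N. ?c i l * (\<phi> (ev w) * \<phi> (Y l * G ^ a)))" using i by simp
    moreover have "(\<Sum>j<N. \<Sum>l<N. ?c j l * (if l = i then \<phi> (ev w * Y j) * \<phi> (G ^ a) else 0)) =
        (\<Sum>j<N. ?c j i * (\<phi> (ev w * Y j) * \<phi> (G ^ a)))"
      using i by (simp add: if_distrib[of "\<lambda>x. _ * x"] cong: if_cong)
    moreover have "\<dots> = (\<Sum>j<N. ?c i j * (\<phi> (ev w * Y j) * \<phi> (G ^ a)))"
      using i sym by (intro sum.cong refl) simp
    ultimately show ?thesis by (simp only: distrib_left sum.distrib)
  qed
  also have "(\<Sum>j<N. \<Sum>l<N. ?c j l * (\<Sum>b<a. \<Sum>l'<N. ?c i l' * ?R (ev w * (Y j * Y l)) b l')) =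
      (\<Sum>b<a. \<Sum>l'<N. ?c i l' * ?R (ev w * G) b l')"
  proof -
    have "(\<Sum>j<N. \<Sum>l<N. ?c j l * (\<Sum>b<a. \<Sum>l'<N. ?c i l' * ?R (ev w * (Y j * Y l)) b l')) =
       (\<Sum>j<N. \<Sum>l<N. \<Sum>b<a. \<Sum>l'<N. ?c j l * (?c i l' * ?R (ev w * (Y j * Y l)) b l'))"
      by (simp only: sum_distrib_left)
    also have "\<dots> = (\<Sum>b<a. \<Sum>j<N. \<Sum>l<N. \<Sum>l'<N. ?c j l * (?c i l' * ?R (ev w * (Y j * Y l)) b l'))"
      by (rule sum_rotate)
    also have "\<dots> = (\<Sum>b<a. \<Sum>l'<N. ?c i l' * ?R (ev w * G) b l')"
    proof (rule sum.cong[OF refl])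
      fix b
      have st: "\<phi> ((ev w * G) * Z) = (\<Sum>j<N. \<Sum>l<N. ?c j l * \<phi> ((ev w * (Y j * Y l)) * Z))" if "Z \<in> A" for Z
        using state_times_G[OF ev_A[OF Suc.prems] that] by (simp only: mult.assoc)
      have "(\<Sum>j<N. \<Sum>l<N. \<Sum>l'<N. ?c j l * (?c i l' * ?R (ev w * (Y j * Y l)) b l')) =
          (\<Sum>l'<N. \<Sum>j<N. \<Sum>l<N. ?c j l * (?c i l' * ?R (ev w * (Y j * Y l)) b l'))"
        by (rule sum_rotate)
      also have "\<dots> = (\<Sum>l'<N. ?c i l' * ?R (ev w * G) b l')"
      proof (rule sum.cong[OF refl])
        fix l' assume l': "l' \<in> {..<N}"
        have "G ^ b * Y l' \<in> A" using l' Y by (intro A_intros G_A) auto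
        from st[OF G_A, of b] st[OF this]
        show "(\<Sum>j<N. \<Sum>l<N. ?c j l * (?c i l' * ?R (ev w * (Y j * Y l)) b l')) = ?c i l' * ?R (ev w * G) b l'"
          by (simp add: sum_distrib_left sum_distrib_right sum.distrib algebra_simps)
      qed
      finally show "(\<Sum>j<N. \<Sum>l<N. \<Sum>l'<N. ?c j l * (?c i l' * ?R (ev w * (Y j * Y l)) b l')) =
        (\<Sum>l'<N. ?c i l' * ?R (ev w * G) b l')" .
    qed
    finally show ?thesis .
  qed
  \<comment> \<open>The contractions with the new letters are the summand \<open>b = 0\<close> of
    the shifted sum.\<close>
  also have "split_sum i w (\<lambda>u v. \<phi> (ev u) * \<phi> (ev v * G ^ Suc a)) +
      (\<Sum>l<N. ?c i l * (\<phi> (ev w) * \<phi> (Y l * G ^ a) + \<phi> (ev w * Y l) * \<phi> (G ^ a))) +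
      (\<Sum>b<a. \<Sum>l'<N. ?c i l' * ?R (ev w * G) b l') =
      split_sum i w (\<lambda>u v. \<phi> (ev u) * \<phi> (ev v * G ^ Suc a)) +
      (\<Sum>b<Suc a. \<Sum>l<N. ?c i l * (\<phi> (ev w * G ^ b) * \<phi> (Y l * G ^ (Suc a - 1 - b)) +
       \<phi> (ev w * (G ^ b * Y l)) * \<phi> (G ^ (Suc a - 1 - b))))"
    unfolding sum.lessThan_Suc_shift by (simp add: mult.assoc)
  finally show ?case .
qed

text \<open>Traces of matrix powers; they turn out to be the free cumulants of
  \<open>G\<close>.\<close>

definition \<gamma> :: "nat \<Rightarrow> real" where "\<gamma> k = (\<Sum>i<N. kernel_power c N k i i)"

text \<open>The equation for the one-letter word \<open>j\<close>: the terms with an odd number of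
  letters beside powers of \<open>G\<close> vanish, and the trace property restores the shape of the
  left-hand side.\<close>

lemma pair_G:
  assumes i: "i < N" and j: "j < N"
  shows "\<phi> (Y i * (Y j * G ^ a)) = (if i = j then \<phi> (G ^ a) else 0) +
    (\<Sum>b<a. \<phi> (G ^ (a - 1 - b)) * (\<Sum>l<N. complex_of_real (c i l) * \<phi> (Y l * (Y j * G ^ b))))"
proof -
  have odd: "\<phi> (Y j * G ^ b) = 0" for b using odd_word_G[of "[j]" b] j by simp
  have tr: "\<phi> (Y j * (G ^ b * Y l)) = \<phi> (Y l * (Y j * G ^ b))" if "l < N" for b l
    using state_trace[of "Y j * G ^ b" "Y l"] that j Y G_A by (simp add: mult.assoc A_intros)
  have "\<phi> (Y i * (Y j * G ^ a)) = (if i = j then \<phi> (G ^ a) else 0) +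
      (\<Sum>b<a. \<Sum>l<N. complex_of_real (c i l) * (\<phi> (Y j * (G ^ b * Y l)) * \<phi> (G ^ (a - 1 - b))))"
    using Schwinger_Dyson_G[OF i, of "[j]" a] j by (auto simp: odd state_one)
  also have "(\<Sum>b<a. \<Sum>l<N. complex_of_real (c i l) * (\<phi> (Y j * (G ^ b * Y l)) * \<phi> (G ^ (a - 1 - b)))) =
      (\<Sum>b<a. \<phi> (G ^ (a - 1 - b)) * (\<Sum>l<N. complex_of_real (c i l) * \<phi> (Y l * (Y j * G ^ b))))"
    unfolding sum_distrib_left by (intro sum.cong refl) (simp add: tr mult_ac)
  finally show ?thesis .
qed

text \<open>Contracting \<open>pair_G\<close> with the \<open>k\<close>-th matrix power turns the
  term \<open>i = j\<close> into \<open>\<gamma> k\<close> times a moment, and in the other terms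
  one more factor \<open>c\<close> raises \<open>k\<close> to \<open>Suc k\<close>. This is
  \<open>cumulant_path_rec\<close>.\<close>

lemma state_pair_power_G:
  "(1 \<le> k \<longrightarrow> (\<Sum>i<N. \<Sum>j<N. complex_of_real (kernel_power c N k j i) * \<phi> (Y i * (Y j * G ^ a))) =
      complex_of_real (cumulant_path \<gamma> k a)) \<and>
    \<phi> (G ^ a) = complex_of_real (free_moment \<gamma> a)"
proof (rule cumulant_path_induct)
  fix a k
  assume P: "\<And>k i. i < a \<Longrightarrow> 1 \<le> k \<Longrightarrow>
      (\<Sum>x<N. \<Sum>j<N. complex_of_real (kernel_power c N k j x) * \<phi> (Y x * (Y j * G ^ i))) =
      complex_of_real (cumulant_path \<gamma> k i)"
    and Q: "\<And>i. i \<le> a \<Longrightarrow> \<phi> (G ^ i) = complex_of_real (free_moment \<gamma> i)" and k: "1 \<le> (k :: nat)"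
  let ?K = "\<lambda>k j i. complex_of_real (kernel_power c N k j i)"
  have "(\<Sum>i<N. \<Sum>j<N. ?K k j i * \<phi> (Y i * (Y j * G ^ a))) =
      (\<Sum>i<N. \<Sum>j<N. ?K k j i * (if i = j then \<phi> (G ^ a) else 0)) +
      (\<Sum>i<N. \<Sum>j<N. \<Sum>b<a. ?K k j i * (\<phi> (G ^ (a - 1 - b)) * (\<Sum>l<N. complex_of_real (c i l) * \<phi> (Y l * (Y j * G ^ b)))))"
    unfolding sum.distrib[symmetric] sum_distrib_left[symmetric] distrib_left[symmetric]
    by (intro sum.cong refl arg_cong2[where f="(*)"] pair_G) auto
  also have "(\<Sum>i<N. \<Sum>j<N. ?K k j i * (if i = j then \<phi> (G ^ a) else 0)) = complex_of_real (\<gamma> k * free_moment \<gamma> a)"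
    using Q[of a] by (simp add: \<gamma>_def if_distrib[of "\<lambda>x. _ * x"] sum_distrib_right cong: if_cong)
  also have "(\<Sum>i<N. \<Sum>j<N. \<Sum>b<a. ?K k j i * (\<phi> (G ^ (a - 1 - b)) * (\<Sum>l<N. complex_of_real (c i l) * \<phi> (Y l * (Y j * G ^ b))))) =
      (\<Sum>b<a. \<phi> (G ^ (a - 1 - b)) * (\<Sum>l<N. \<Sum>j<N. ?K (Suc k) j l * \<phi> (Y l * (Y j * G ^ b))))"
  proof -
    have "(\<Sum>i<N. \<Sum>j<N. \<Sum>b<a. ?K k j i * (\<phi> (G ^ (a - 1 - b)) * (\<Sum>l<N. complex_of_real (c i l) * \<phi> (Y l * (Y j * G ^ b))))) =
        (\<Sum>b<a. \<Sum>i<N. \<Sum>j<N. ?K k j i * (\<phi> (G ^ (a - 1 - b)) * (\<Sum>l<N. complex_of_real (c i l) * \<phi> (Y l * (Y j * G ^ b)))))"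
      by (rule sum_rotate)
    also have "\<dots> = (\<Sum>b<a. \<phi> (G ^ (a - 1 - b)) * (\<Sum>l<N. \<Sum>j<N. ?K (Suc k) j l * \<phi> (Y l * (Y j * G ^ b))))"
    proof (rule sum.cong[OF refl])
      fix b
      have "(\<Sum>i<N. \<Sum>j<N. ?K k j i * (\<phi> (G ^ (a - 1 - b)) * (\<Sum>l<N. complex_of_real (c i l) * \<phi> (Y l * (Y j * G ^ b))))) =
        (\<Sum>i<N. \<Sum>j<N. \<Sum>l<N. \<phi> (G ^ (a - 1 - b)) * (?K k j i * complex_of_real (c i l) * \<phi> (Y l * (Y j * G ^ b))))"
        by (simp add: sum_distrib_left mult_ac)
      also have "\<dots> = (\<Sum>j<N. \<Sum>l<N. \<Sum>i<N. \<phi> (G ^ (a - 1 - b)) * (?K k j i * complex_of_real (c i l) * \<phi> (Y l * (Y j * G ^ b))))"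
        by (subst sum_rotate, subst sum_rotate) (rule refl)
      also have "\<dots> = (\<Sum>l<N. \<Sum>j<N. \<Sum>i<N. \<phi> (G ^ (a - 1 - b)) * (?K k j i * complex_of_real (c i l) * \<phi> (Y l * (Y j * G ^ b))))"
        by (rule sum.swap)
      also have "\<dots> = \<phi> (G ^ (a - 1 - b)) * (\<Sum>l<N. \<Sum>j<N. ?K (Suc k) j l * \<phi> (Y l * (Y j * G ^ b)))"
        by (simp add: sum_distrib_left sum_distrib_right)
      finally show "(\<Sum>i<N. \<Sum>j<N. ?K k j i * (\<phi> (G ^ (a - 1 - b)) * (\<Sum>l<N. complex_of_real (c i l) * \<phi> (Y l * (Y j * G ^ b))))) =
        \<phi> (G ^ (a - 1 - b)) * (\<Sum>l<N. \<Sum>j<N. ?K (Suc k) j l * \<phi> (Y l * (Y j * G ^ b)))" .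
    qed
    finally show ?thesis .
  qed
  also have "\<dots> = (\<Sum>b<a. complex_of_real (cumulant_path \<gamma> (Suc k) b * free_moment \<gamma> (a - 1 - b)))"
  proof (rule sum.cong[OF refl])
    fix b assume "b \<in> {..<a}"
    then show "\<phi> (G ^ (a - 1 - b)) * (\<Sum>l<N. \<Sum>j<N. ?K (Suc k) j l * \<phi> (Y l * (Y j * G ^ b))) =
        complex_of_real (cumulant_path \<gamma> (Suc k) b * free_moment \<gamma> (a - 1 - b))"
      using P[of b "Suc k"] Q[of "a - 1 - b"] by simp
  qed
  finally show "(\<Sum>i<N. \<Sum>j<N. ?K k j i * \<phi> (Y i * (Y j * G ^ a))) = complex_of_real (cumulant_path \<gamma> k a)"
    by (simp add: cumulant_path_rec[of _ k a])
next
  show "\<phi> (G ^ 0) = complex_of_real (free_moment \<gamma> 0)" by (simp add: state_one free_moment_0)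
next
  fix n
  assume 1: "(\<Sum>i<N. \<Sum>j<N. complex_of_real (kernel_power c N 1 j i) * \<phi> (Y i * (Y j * G ^ n))) =
      complex_of_real (cumulant_path \<gamma> 1 n)"
  have K1: "kernel_power c N 1 j i = c i j" if "i < N" "j < N" for i j
    using that sym[of i j] by (simp add: if_distrib[of "\<lambda>x. x * _"] cong: if_cong)
  have "\<phi> (G ^ Suc n) = (\<Sum>i<N. \<Sum>j<N. complex_of_real (c i j) * \<phi> (Y i * (Y j * G ^ n)))"
    using state_times_G[OF A_intros(1) G_A, of n] by simp
  also have "\<dots> = (\<Sum>i<N. \<Sum>j<N. complex_of_real (kernel_power c N 1 j i) * \<phi> (Y i * (Y j * G ^ n)))"
    by (intro sum.cong refl) (simp add: K1[simplified])
  finally show "\<phi> (G ^ Suc n) = complex_of_real (free_moment \<gamma> (Suc n))" by (simp only: 1 free_moment_Suc)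
qed

lemma state_power_G: "\<phi> (G ^ a) = complex_of_real (free_moment \<gamma> a)"
  using state_pair_power_G by blast

lemma \<gamma>_1: "\<gamma> 1 = 0"
  using trace by (simp add: \<gamma>_def if_distrib[of "\<lambda>x. x * _"] cong: if_cong)

end

section \<open>Continuity of moments under convergence in L2\<close>

context free_probability_space
begin

lemma norm2_power: "T \<in> A \<Longrightarrow> self_adjoint T \<Longrightarrow> (norm2 (T ^ i))\<^sup>2 = Re (\<phi> (T ^ (2 * i)))"
  using norm2_sq[of "T ^ i"] self_adjoint_adj[OF self_adjoint_power, of T i]
  by (simp add: A_intros mult_2 power_add)

text \<open>The powers are exchanged one factor at a time, so each step contains
  \<open>F - G n\<close> once. Cauchy-Schwarz isolates its L2-norm; the uniformly bounded moments
  control the other factor.\<close>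

lemma state_power_tendsto:
  assumes F: "F \<in> A" "self_adjoint F" and G: "\<And>n :: nat. G n \<in> A" "\<And>n. self_adjoint (G n)"
    and lim: "(\<lambda>n. norm2 (F - G n)) \<longlonglongrightarrow> 0"
    and bd: "\<And>k. \<exists>B. \<forall>n. cmod (\<phi> (G n ^ k)) \<le> B"
  shows "(\<lambda>n. \<phi> (G n ^ k)) \<longlonglongrightarrow> \<phi> (F ^ k)"
proof -
  have diff: "(\<lambda>n. \<phi> (G n ^ i * F ^ Suc j) - \<phi> (G n ^ Suc i * F ^ j)) \<longlonglongrightarrow> 0" for i j
  proof -
    obtain B where B: "\<And>n. cmod (\<phi> (G n ^ (4 * i))) \<le> B" using bd by blast
    \<comment> \<open>A bound for the L2-norm of \<open>F ^ j * G n ^ i\<close>: its square is the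
      state of \<open>F ^ (2 * j) * G n ^ (2 * i)\<close> by the trace property, and a second
      Cauchy-Schwarz separates the powers.\<close>
    define C where "C = sqrt (norm2 (F ^ (2 * j)) * sqrt B)"
    have le: "cmod (\<phi> (G n ^ i * F ^ Suc j) - \<phi> (G n ^ Suc i * F ^ j)) \<le> norm2 (F - G n) * C" for n
    proof -
      have D: "F - G n \<in> A" "adj (F - G n) = F - G n"
        using F G[of n] by (auto intro!: A_intros self_adjoint_adj self_adjoint_diff)
      have W: "F ^ j * G n ^ i \<in> A" using F G by (intro A_intros)
      have "\<phi> (G n ^ i * F ^ Suc j) - \<phi> (G n ^ Suc i * F ^ j) = \<phi> (G n ^ i * ((F - G n) * F ^ j))"
      proof -
        have "G n ^ i * ((F - G n) * F ^ j) = G n ^ i * F ^ Suc j - G n ^ Suc i * F ^ j"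
          by (simp only: power_Suc[of F j] power_Suc2[of "G n" i] left_diff_distrib right_diff_distrib mult.assoc)
        then show ?thesis using F G[of n] by (simp add: state_diff A_intros del: power_Suc)
      qed
      also have "\<dots> = \<phi> (((F - G n) * F ^ j) * G n ^ i)"
        using F G[of n] by (intro state_trace A_intros)
      also have "\<dots> = \<phi> (adj (F - G n) * (F ^ j * G n ^ i))" by (simp add: D mult.assoc)
      also have "cmod \<dots> \<le> norm2 (F - G n) * norm2 (F ^ j * G n ^ i)" by (rule Cauchy_Schwarz[OF D(1) W])
      also have "norm2 (F ^ j * G n ^ i) \<le> C"
        unfolding C_def
      proof (rule real_le_rsqrt)
        have Fj: "adj (F ^ j) = F ^ j" "adj (F ^ (2 * j)) = F ^ (2 * j)" and Gi: "adj (G n ^ i) = G n ^ i"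
          using F G by (auto intro!: self_adjoint_adj self_adjoint_power)
        have "complex_of_real ((norm2 (F ^ j * G n ^ i))\<^sup>2) = \<phi> ((G n ^ i * F ^ j) * (F ^ j * G n ^ i))"
          using norm2_sq[OF W] F G[of n] by (simp add: adj_times Fj Gi A_intros)
        also have "(G n ^ i * F ^ j) * (F ^ j * G n ^ i) = G n ^ i * (F ^ (2 * j) * G n ^ i)"
          by (simp add: mult_2 power_add mult.assoc)
        also have "\<phi> \<dots> = \<phi> ((F ^ (2 * j) * G n ^ i) * G n ^ i)"
          using F G[of n] by (intro state_trace A_intros)
        also have "\<dots> = \<phi> (adj (F ^ (2 * j)) * G n ^ (2 * i))"
          unfolding Fj by (simp only: mult_2 power_add mult.assoc)
        finally have "(norm2 (F ^ j * G n ^ i))\<^sup>2 = cmod (\<phi> (adj (F ^ (2 * j)) * G n ^ (2 * i)))"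
          by (metis abs_of_nonneg norm_of_real zero_le_power2)
        also have "\<dots> \<le> norm2 (F ^ (2 * j)) * norm2 (G n ^ (2 * i))"
          using F G[of n] by (intro Cauchy_Schwarz A_intros)
        also have "norm2 (G n ^ (2 * i)) \<le> sqrt B"
        proof (rule real_le_rsqrt)
          have "(norm2 (G n ^ (2 * i)))\<^sup>2 = Re (\<phi> (G n ^ (4 * i)))" using norm2_power[OF G(1,2), of n "2 * i"] by simp
          also have "\<dots> \<le> B" using B[of n] complex_Re_le_cmod order_trans by blast
          finally show "(norm2 (G n ^ (2 * i)))\<^sup>2 \<le> B" .
        qed
        finally show "(norm2 (F ^ j * G n ^ i))\<^sup>2 \<le> norm2 (F ^ (2 * j)) * sqrt B"
          using F by (simp add: mult_left_mono norm2_nonneg A_intros)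
      qed
      finally show ?thesis using D(1) by (simp add: mult_left_mono norm2_nonneg)
    qed
    have "(\<lambda>n. norm2 (F - G n) * C) \<longlonglongrightarrow> 0" using tendsto_mult_left_zero[OF lim] by simp
    then show ?thesis by (rule Lim_null_comparison[rotated]) (use le in auto)
  qed
  have "\<phi> (F ^ k) - \<phi> (G n ^ k) = (\<Sum>i<k. \<phi> (G n ^ i * F ^ Suc (k - Suc i)) - \<phi> (G n ^ Suc i * F ^ (k - Suc i)))" for n
  proof -
    have "(\<Sum>i<k. \<phi> (G n ^ i * F ^ Suc (k - Suc i)) - \<phi> (G n ^ Suc i * F ^ (k - Suc i))) =
        (\<Sum>i<k. \<phi> (G n ^ i * F ^ (k - i)) - \<phi> (G n ^ Suc i * F ^ (k - Suc i)))"
      by (intro sum.cong refl) (simp add: Suc_diff_Suc)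
    also have "\<dots> = \<phi> (F ^ k) - \<phi> (G n ^ k)"
      using sum_lessThan_telescope'[of "\<lambda>i. \<phi> (G n ^ i * F ^ (k - i))" k] by simp
    finally show ?thesis ..
  qed
  moreover have "(\<lambda>n. \<Sum>i<k. \<phi> (G n ^ i * F ^ Suc (k - Suc i)) - \<phi> (G n ^ Suc i * F ^ (k - Suc i))) \<longlonglongrightarrow> (\<Sum>i<k. 0)"
    by (intro tendsto_sum diff)
  ultimately have "(\<lambda>n. \<phi> (F ^ k) - \<phi> (G n ^ k)) \<longlonglongrightarrow> 0" by simp
  from tendsto_diff[OF tendsto_const[of "\<phi> (F ^ k)"] this] show ?thesis by simp
qed

end

section \<open>The isometry for quadratic forms\<close>

context semicircular_family
begin

lemma adj_quadratic: "is_adjoint (quadratic d) (\<Sum>i<N. \<Sum>j<N. complex_of_real (d i j) *\<^sub>C (Y j * Y i))"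
proof -
  have s: "is_adjoint (\<Sum>i\<in>I. f i) (\<Sum>i\<in>I. g i)" if "\<And>i. i \<in> I \<Longrightarrow> is_adjoint (f i) (g i)"
    for f g :: "nat \<Rightarrow> 'h bop" and I
    using that
  proof (induction I rule: infinite_finite_induct)
    case (insert x I)
    then show ?case by (simp add: is_adjoint_add)
  qed (use self_adjoint_zero in \<open>auto simp: self_adjoint_def\<close>)
  show ?thesis unfolding quadratic_def
  proof (intro s)
    fix i j assume "i \<in> {..<N}" "j \<in> {..<N}"
    then have "is_adjoint (Y i * Y j) (Y j * Y i)"
      using Y(2) by (intro is_adjoint_times) (auto simp: self_adjoint_def)
    from is_adjoint_scaleC[OF this, of "complex_of_real (d i j)"]
    show "is_adjoint (complex_of_real (d i j) *\<^sub>C (Y i * Y j)) (complex_of_real (d i j) *\<^sub>C (Y j * Y i))" by simp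
  qed
qed

lemma quadratic_transpose: "adj (quadratic d) = quadratic (\<lambda>i j. d j i)"
  unfolding adj_eqI[OF adj_quadratic] unfolding quadratic_def by (rule sum.swap)

lemma quadratic_add: "quadratic d + quadratic e = quadratic (\<lambda>i j. d i j + e i j)"
  by (simp add: quadratic_def bop_scaleC sum.distrib)

lemma quadratic_scale: "complex_of_real r *\<^sub>C quadratic d = quadratic (\<lambda>i j. r * d i j)"
  by (simp add: quadratic_def bop_scaleC bop_scaleC_sum)

text \<open>Of the two pairings in \<open>state_four\<close> one gives the squared trace, which is
  zero, and the other the Hilbert-Schmidt norm of the matrix.\<close>

lemma state_quadratic_pair:
  assumes tr: "(\<Sum>i<N. d i i) = 0"
  shows "(norm2 (quadratic d))\<^sup>2 = (\<Sum>i<N. \<Sum>j<N. (d i j)\<^sup>2)"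
proof -
  let ?c = "\<lambda>i j k l. complex_of_real (d i j * d k l)"
  have A: "Y j * (Y i * (Y k * Y l)) \<in> A" if "i < N" "j < N" "k < N" "l < N" for i j k l
    using Y that by (intro A_intros) auto
  have s: "\<phi> (\<Sum>i<N. c i *\<^sub>C f i) = (\<Sum>i<N. c i * \<phi> (f i))" if "\<And>i. i < N \<Longrightarrow> f i \<in> A" for f and c :: "nat \<Rightarrow> complex"
    using that by (subst state_sum) (auto simp: state_scaleC A_intros(4))
  have s1: "\<phi> (\<Sum>i<N. f i) = (\<Sum>i<N. \<phi> (f i))" if "\<And>i. i < N \<Longrightarrow> f i \<in> A" for f
    using that by (intro state_sum) auto
  have "complex_of_real ((norm2 (quadratic d))\<^sup>2) = \<phi> (adj (quadratic d) * quadratic d)"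
    by (simp only: norm2_sq[OF quadratic_A])
  also have "adj (quadratic d) * quadratic d =
      (\<Sum>i<N. \<Sum>j<N. \<Sum>k<N. \<Sum>l<N. ?c i j k l *\<^sub>C (Y j * (Y i * (Y k * Y l))))"
    unfolding adj_eqI[OF adj_quadratic] unfolding quadratic_def
    by (simp only: sum_distrib_right) (simp add: sum_distrib_left bop_scaleC mult.assoc mult.commute)
  also have "\<phi> \<dots> = (\<Sum>i<N. \<Sum>j<N. \<Sum>k<N. \<Sum>l<N. ?c i j k l * \<phi> (Y j * (Y i * (Y k * Y l))))"
    by (subst s1, (auto intro!: A_intros(9,4) A)[1], intro sum.cong refl,
      subst s1, (auto intro!: A_intros(9,4) A)[1], intro sum.cong refl,
      subst s1, (auto intro!: A_intros(9,4) A)[1], intro sum.cong refl,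
      subst s, (auto intro!: A)[1], rule refl)
  also have "\<dots> = (\<Sum>i<N. \<Sum>j<N. \<Sum>k<N. \<Sum>l<N. (if j = i then if k = l then ?c i j k l else 0 else 0) +
      (if j = l then if i = k then ?c i j k l else 0 else 0))"
    by (intro sum.cong refl) (auto simp: state_four)
  also have "\<dots> = (\<Sum>i<N. \<Sum>k<N. ?c i i k k) + (\<Sum>i<N. \<Sum>j<N. ?c i j i j)"
  proof -
    have "(\<Sum>i<N. \<Sum>j<N. \<Sum>k<N. \<Sum>l<N. (if j = i then if k = l then ?c i j k l else 0 else 0)) =
        (\<Sum>i<N. \<Sum>j<N. if j = i then \<Sum>k<N. ?c i j k k else 0)"
      by (intro sum.cong refl) (simp del: of_real_mult)
    moreover have "(\<Sum>i<N. \<Sum>j<N. \<Sum>k<N. \<Sum>l<N. (if j = l then if i = k then ?c i j k l else 0 else 0)) =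
        (\<Sum>i<N. \<Sum>j<N. \<Sum>k<N. if i = k then ?c i j k j else 0)"
      by (intro sum.cong refl) (simp del: of_real_mult)
    ultimately show ?thesis by (simp add: sum.distrib del: of_real_mult)
  qed
  also have "(\<Sum>i<N. \<Sum>k<N. ?c i i k k) = complex_of_real ((\<Sum>i<N. d i i) * (\<Sum>k<N. d k k))"
    by (simp add: sum_product)
  also have "\<dots> + (\<Sum>i<N. \<Sum>j<N. ?c i j i j) = complex_of_real (\<Sum>i<N. \<Sum>j<N. (d i j)\<^sup>2)"
    by (simp add: tr power2_eq_square)
  finally show ?thesis by (simp only: of_real_eq_iff)
qed

end

section \<open>Wigner integrals of step kernels\<close>

lemma sum_increments:
  fixes f :: "real \<Rightarrow> 'a :: ab_group_add"
  assumes ts: "sorted_wrt (<) ts" and p: "p \<in> set ts" and q: "q \<in> set ts" and pq: "p \<le> q"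
  shows "(\<Sum>i<length ts - 1. if p \<le> ts ! i \<and> ts ! i < q then f (ts ! Suc i) - f (ts ! i) else 0) = f q - f p"
proof -
  obtain m n where m: "m < length ts" "ts ! m = p" and n: "n < length ts" "ts ! n = q"
    using p q by (auto simp: in_set_conv_nth)
  have lt: "ts ! i < ts ! j \<longleftrightarrow> i < j" if "i < length ts" "j < length ts" for i j
  proof
    assume "ts ! i < ts ! j"
    then show "i < j" using sorted_wrt_nth_less[OF ts, of j i] that by (cases i j rule: linorder_cases) auto
  qed (use sorted_wrt_nth_less[OF ts, of i j] that in auto)
  have mn: "m \<le> n" using lt[of n m] m n pq by auto
  have "(\<Sum>i<length ts - 1. if p \<le> ts ! i \<and> ts ! i < q then f (ts ! Suc i) - f (ts ! i) else 0) =
      (\<Sum>i\<in>{m..<n}. f (ts ! Suc i) - f (ts ! i))"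
  proof (rule sum.mono_neutral_cong_right)
    show "{m..<n} \<subseteq> {..<length ts - 1}" using n by auto
    have c: "p \<le> ts ! i \<and> ts ! i < q \<longleftrightarrow> i \<in> {m..<n}" if "i < length ts" for i
      using lt[of i m] lt[of i n] that m n by (auto simp: not_less[symmetric])
    show "\<forall>i\<in>{..<length ts - 1} - {m..<n}. (if p \<le> ts ! i \<and> ts ! i < q then f (ts ! Suc i) - f (ts ! i) else 0) = 0"
    proof
      fix i assume i: "i \<in> {..<length ts - 1} - {m..<n}"
      then have "i < length ts" by auto
      from c[OF this] i show "(if p \<le> ts ! i \<and> ts ! i < q then f (ts ! Suc i) - f (ts ! i) else 0) = 0"
        by auto
    qed
    show "(if p \<le> ts ! i \<and> ts ! i < q then f (ts ! Suc i) - f (ts ! i) else 0) = f (ts ! Suc i) - f (ts ! i)"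
      if "i \<in> {m..<n}" for i using c[of i] that n by auto
  qed auto
  also have "\<dots> = f q - f p" using sum_Suc_diff'[OF mn, of "\<lambda>i. f (ts ! i)"] m n by simp
  finally show ?thesis .
qed

text \<open>The coordinates of the indicator of the interval from \<open>a\<close> to
  \<open>b\<close> in the normalized indicators of the grid cells, provided both endpoints lie on
  the grid; the normalization explains the square root.\<close>

definition increment_coeff :: "real list \<Rightarrow> real \<Rightarrow> real \<Rightarrow> nat \<Rightarrow> real" where
  "increment_coeff ts a b i = (if a \<le> ts ! i \<and> ts ! i < b then sqrt (ts ! Suc i - ts ! i) else 0)"

lemma increment_coeff_inner:
  assumes ts: "sorted_wrt (<) ts" and mem: "a \<in> set ts" "b \<in> set ts" "p \<in> set ts" "q \<in> set ts"
  shows "(\<Sum>i<length ts - 1. increment_coeff ts a b i * increment_coeff ts p q i) =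
    measure lborel ({a..<b} \<inter> {p..<q})"
proof -
  define s t where "s = max a p" and "t = min b q"
  have st: "s \<in> set ts" "t \<in> set ts" using mem by (auto simp: s_def t_def max_def min_def)
  have int: "{a..<b} \<inter> {p..<q} = {s..<t}" by (auto simp: s_def t_def)
  have "(\<Sum>i<length ts - 1. increment_coeff ts a b i * increment_coeff ts p q i) =
      (\<Sum>i<length ts - 1. if s \<le> ts ! i \<and> ts ! i < t then ts ! Suc i - ts ! i else 0)"
  proof (rule sum.cong[OF refl])
    fix i assume "i \<in> {..<length ts - 1}"
    then have "ts ! i < ts ! Suc i" by (intro sorted_wrt_nth_less[OF ts]) auto
    then show "increment_coeff ts a b i * increment_coeff ts p q i =
        (if s \<le> ts ! i \<and> ts ! i < t then ts ! Suc i - ts ! i else 0)"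
      by (auto simp: increment_coeff_def s_def t_def)
  qed
  also have "\<dots> = measure lborel {s..<t}"
  proof (cases "s \<le> t")
    case True
    then show ?thesis using sum_increments[OF ts st True, of "\<lambda>x. x"] by simp
  next
    case False
    then show ?thesis by (auto intro!: sum.neutral)
  qed
  finally show ?thesis by (simp only: int)
qed

text \<open>For endpoints on the grid, the coordinates of the step kernel in products of normalized
  cell indicators, and at the same time the coefficients of its Wigner integral in the normalized
  increments.\<close>

definition kernel_matrix :: "real list \<Rightarrow> rectangles \<Rightarrow> nat \<Rightarrow> nat \<Rightarrow> real" where
  "kernel_matrix ts L i j =
     (\<Sum>(c, a, b, a', b')\<leftarrow>L. c * increment_coeff ts a b i * increment_coeff ts a' b' j)"

definition endpoints :: "rectangles \<Rightarrow> real set" where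
  "endpoints L = (\<Union>(c, a, b, a', b')\<in>set L. {a, b, a', b'})"

text \<open>One rectangle contributes its constant times the length of the overlap of its two sides,
  and off the diagonal the sides are disjoint.\<close>

lemma kernel_matrix_trace:
  assumes ts: "sorted_wrt (<) ts" and L: "off_diagonal L" "endpoints L \<subseteq> set ts"
  shows "(\<Sum>i<length ts - 1. kernel_matrix ts L i i) = 0"
  using L
proof (induction L)
  case Nil
  then show ?case by (simp add: kernel_matrix_def)
next
  case (Cons r L)
  obtain c a b a' b' where r: "r = (c, a, b, a', b')" by (cases r)
  have mem: "a \<in> set ts" "b \<in> set ts" "a' \<in> set ts" "b' \<in> set ts" using Cons.prems r by (auto simp: endpoints_def)
  have disj: "{a..<b} \<inter> {a'..<b'} = {}" using Cons.prems r by (auto simp: off_diagonal_def)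
  have "(\<Sum>i<length ts - 1. c * increment_coeff ts a b i * increment_coeff ts a' b' i) =
      c * measure lborel ({a..<b} \<inter> {a'..<b'})"
    (is "_ = ?m") unfolding increment_coeff_inner[OF ts mem, symmetric] by (simp add: sum_distrib_left mult.assoc)
  moreover have "?m = 0" by (simp only: disj measure_empty mult_zero_right)
  moreover have "(\<Sum>i<length ts - 1. kernel_matrix ts L i i) = 0"
    using Cons by (auto simp: off_diagonal_def endpoints_def)
  ultimately show ?case by (simp add: kernel_matrix_def r sum.distrib)
qed

lemma measure_lborel_Times:
  fixes S T :: "real set"
  assumes "S \<in> sets borel" "T \<in> sets borel"
  shows "measure lborel (S \<times> T) = measure lborel S * measure lborel T"
proof -
  have "emeasure lborel (S \<times> T) = emeasure lborel S * emeasure lborel T"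
    unfolding lborel_prod[symmetric] using assms by (intro lborel.emeasure_pair_measure_Times) auto
  then show ?thesis by (simp add: measure_def enn2real_mult)
qed

text \<open>Parseval's identity for the products of cell indicators: both sides expand into overlaps
  of pairs of rectangles.\<close>

lemma step_kernel_integral:
  assumes ts: "sorted_wrt (<) ts" and L: "off_diagonal L" "endpoints L \<subseteq> set ts"
  shows "(LINT z:quadrant|lborel. (step_kernel L z)\<^sup>2) =
      (\<Sum>i<length ts - 1. \<Sum>j<length ts - 1. (kernel_matrix ts L i j)\<^sup>2)"
    and "set_integrable lborel quadrant (\<lambda>z. (step_kernel L z)\<^sup>2)"
    and "step_kernel L \<in> borel_measurable borel"
proof -
  define n where "n = length L"
  define c where "c k = fst (L ! k)" for k
  define a where "a k = fst (snd (L ! k))" for k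
  define b where "b k = fst (snd (snd (L ! k)))" for k
  define a' where "a' k = fst (snd (snd (snd (L ! k))))" for k
  define b' where "b' k = snd (snd (snd (snd (L ! k))))" for k
  define R where "R k = {a k..<b k} \<times> {a' k..<b' k}" for k
  have Lk: "L ! k = (c k, a k, b k, a' k, b' k)" for k by (simp add: c_def a_def b_def a'_def b'_def)
  have sumL: "(\<Sum>(c, a, b, a', b')\<leftarrow>L. h c a b a' b') = (\<Sum>k<n. h (c k) (a k) (b k) (a' k) (b' k))"
    for h :: "real \<Rightarrow> real \<Rightarrow> real \<Rightarrow> real \<Rightarrow> real \<Rightarrow> real"
    unfolding sum_list_sum_nth atLeast0LessThan n_def[symmetric] length_map
    by (intro sum.cong refl) (simp add: n_def Lk)
  have mem: "a k \<in> set ts" "b k \<in> set ts" "a' k \<in> set ts" "b' k \<in> set ts" and nn: "0 \<le> a k" "0 \<le> a' k" if "k < n" for k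
  proof -
    have "(c k, a k, b k, a' k, b' k) \<in> set L" using that Lk[of k] by (metis n_def nth_mem)
    then show "a k \<in> set ts" "b k \<in> set ts" "a' k \<in> set ts" "b' k \<in> set ts" "0 \<le> a k" "0 \<le> a' k"
      using L by (auto simp: endpoints_def off_diagonal_def)
  qed
  have sk: "step_kernel L z = (\<Sum>k<n. c k * indicator (R k) z)" for z
    unfolding step_kernel_def sumL R_def ..
  have Rm: "R k \<in> sets borel" for k unfolding R_def by (intro borel_Times) auto
  have Rf: "emeasure lborel (R k \<inter> R l) < \<infinity>" for k l
  proof -
    have "emeasure lborel (R k) = emeasure lborel {a k..<b k} * emeasure lborel {a' k..<b' k}"
      unfolding R_def lborel_prod[symmetric] by (intro lborel.emeasure_pair_measure_Times) auto
    also have "\<dots> < \<infinity>"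
    proof -
      have "emeasure lborel {p..<q} < \<infinity>" for p q :: real by (cases "p \<le> q") auto
      then show ?thesis by (simp add: ennreal_mult_less_top)
    qed
    finally have "emeasure lborel (R k) < \<infinity>" .
    moreover have "emeasure lborel (R k \<inter> R l) \<le> emeasure lborel (R k)"
      by (rule emeasure_mono) (use Rm in auto)
    ultimately show ?thesis by (rule le_less_trans[rotated])
  qed
  have int: "integrable lborel (\<lambda>z. c k * c l * indicator (R k \<inter> R l) z)" for k l
    by (intro integrable_mult_right integrable_real_indicator Rf) (use Rm in auto)
  have sq: "indicator quadrant z *\<^sub>R (step_kernel L z)\<^sup>2 = (\<Sum>k<n. \<Sum>l<n. c k * c l * indicator (R k \<inter> R l) z)" for z
  proof -
    have "(step_kernel L z)\<^sup>2 = (\<Sum>k<n. \<Sum>l<n. c k * c l * indicator (R k \<inter> R l) z)"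
      unfolding sk power2_eq_square sum_product by (simp add: indicator_inter_arith mult_ac)
    then have "indicator quadrant z *\<^sub>R (step_kernel L z)\<^sup>2 =
        (\<Sum>k<n. \<Sum>l<n. indicator quadrant z * (c k * c l * indicator (R k \<inter> R l) z))"
      by (simp only: real_scaleR_def sum_distrib_left)
    also have "\<dots> = (\<Sum>k<n. \<Sum>l<n. c k * c l * indicator (R k \<inter> R l) z)"
    proof (intro sum.cong refl)
      fix k l assume "k \<in> {..<n}"
      then have "k < n" by simp
      from nn[OF this] show "indicator quadrant z * (c k * c l * indicator (R k \<inter> R l) z) = c k * c l * indicator (R k \<inter> R l) z"
        by (auto simp: indicator_def R_def)
    qed
    finally show ?thesis .
  qed
  show "set_integrable lborel quadrant (\<lambda>z. (step_kernel L z)\<^sup>2)"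
    unfolding set_integrable_def sq by (intro Bochner_Integration.integrable_sum int)
  have [measurable]: "R k \<in> sets borel" for k by (rule Rm)
  show "step_kernel L \<in> borel_measurable borel"
    unfolding sk[abs_def] by measurable
  have m: "measure lborel (R k \<inter> R l) =
      (\<Sum>i<length ts - 1. increment_coeff ts (a k) (b k) i * increment_coeff ts (a l) (b l) i) *
      (\<Sum>j<length ts - 1. increment_coeff ts (a' k) (b' k) j * increment_coeff ts (a' l) (b' l) j)"
    if "k < n" "l < n" for k l
  proof -
    have "R k \<inter> R l = ({a k..<b k} \<inter> {a l..<b l}) \<times> ({a' k..<b' k} \<inter> {a' l..<b' l})" by (auto simp: R_def)
    then show ?thesis
      using mem[OF that(1)] mem[OF that(2)] by (simp only: increment_coeff_inner[OF ts]) (rule measure_lborel_Times; simp)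
  qed
  let ?M = "length ts - 1"
  let ?e = "\<lambda>k i. increment_coeff ts (a k) (b k) i" and ?f = "\<lambda>k j. increment_coeff ts (a' k) (b' k) j"
  have "(LINT z:quadrant|lborel. (step_kernel L z)\<^sup>2) = (\<Sum>k<n. \<Sum>l<n. c k * c l * measure lborel (R k \<inter> R l))"
    unfolding set_lebesgue_integral_def sq
    by (simp only: Bochner_Integration.integral_sum Bochner_Integration.integrable_sum int) simp
  also have "\<dots> = (\<Sum>k<n. \<Sum>l<n. \<Sum>i<?M. \<Sum>j<?M. (c k * ?e k i * ?f k j) * (c l * ?e l i * ?f l j))"
    by (intro sum.cong refl) (simp add: m sum_product sum_distrib_left mult_ac)
  also have "\<dots> = (\<Sum>i<?M. \<Sum>j<?M. \<Sum>k<n. \<Sum>l<n. (c k * ?e k i * ?f k j) * (c l * ?e l i * ?f l j))"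
    by (rule trans[OF sum_rotate]) (rule sum.cong[OF refl], rule sum_rotate)
  also have "\<dots> = (\<Sum>i<?M. \<Sum>j<?M. (kernel_matrix ts L i j)\<^sup>2)"
    unfolding kernel_matrix_def sumL power2_eq_square sum_product ..
  finally show "(LINT z:quadrant|lborel. (step_kernel L z)\<^sup>2) = (\<Sum>i<?M. \<Sum>j<?M. (kernel_matrix ts L i j)\<^sup>2)" .
qed

section \<open>Brownian increments over a grid\<close>

context free_probability_space
begin

definition normalized_increment :: "(real \<Rightarrow> 'h bop) \<Rightarrow> real list \<Rightarrow> nat \<Rightarrow> 'h bop" where
  "normalized_increment S ts i =
     complex_of_real (1 / sqrt (ts ! Suc i - ts ! i)) *\<^sub>C (S (ts ! Suc i) - S (ts ! i))"

text \<open>Each increment is free from the path up to its starting time, and the algebra of that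
  path contains all earlier increments.\<close>

lemma normalized_increments_family:
  assumes S: "free_brownian_motion A \<phi> S" and ts: "sorted_wrt (<) ts" and nn: "\<And>t. t \<in> set ts \<Longrightarrow> 0 \<le> t"
  shows "semicircular_family A \<phi> (normalized_increment S ts) (length ts - 1)"
proof -
  let ?X = "\<lambda>i. S (ts ! Suc i) - S (ts ! i)" and ?v = "\<lambda>i. ts ! Suc i - ts ! i"
  let ?Z = "\<lambda>i. S ` {0..ts ! i}"
  have SA: "S t \<in> A" "self_adjoint (S t)" if "0 \<le> t" for t
    using S that by (auto simp: free_brownian_motion_def)
  have inc: "0 \<le> ts ! i" "ts ! i < ts ! Suc i" if "i < length ts - 1" for i
    using that nn by (auto intro!: sorted_wrt_nth_less[OF ts])
  have XA: "?X i \<in> A" if "i < length ts - 1" for i using inc[OF that] by (intro A_intros SA) auto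
  show ?thesis
  proof unfold_locales
    fix i assume i: "i < length ts - 1"
    show "normalized_increment S ts i \<in> A" unfolding normalized_increment_def by (intro A_intros XA i)
    show "self_adjoint (normalized_increment S ts i)" unfolding normalized_increment_def
      using inc[OF i] by (intro self_adjoint_of_real self_adjoint_diff SA) auto
    fix w assume w: "set w \<subseteq> {..<length ts - 1}"
    show "\<phi> (normalized_increment S ts i * prod_list (map (normalized_increment S ts) w)) =
      split_sum i w (\<lambda>a b. \<phi> (prod_list (map (normalized_increment S ts) a)) *
        \<phi> (prod_list (map (normalized_increment S ts) b)))"
    proof (rule Schwinger_Dyson_of_free[where X="?X" and v="?v" and Z="?Z", OF _ _ _ _ _ _ _ i w])
      fix k assume k: "k < length ts - 1"
      show "?X k \<in> A" by (rule XA[OF k])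
      show "0 < ?v k" using inc[OF k] by simp
      show "semicircular \<phi> (?v k) (?X k)" "freely_independent \<phi> {?X k} (?Z k)"
        using S inc[OF k] by (auto simp: free_brownian_motion_def)
      show "?Z k \<subseteq> A" using SA by auto
    next
      fix k j assume jk: "j < k" "k < length ts - 1"
      have le: "ts ! Suc j \<le> ts ! k"
      proof (cases "Suc j = k")
        case False
        then have "ts ! Suc j < ts ! k" using jk by (intro sorted_wrt_nth_less[OF ts]) auto
        then show ?thesis by simp
      qed simp
      have "0 \<le> ts ! j" "ts ! j < ts ! Suc j" using inc[of j] jk by auto
      then have "S (ts ! Suc j) \<in> ?Z k" "S (ts ! j) \<in> ?Z k" using le by auto
      then have "S (ts ! Suc j) + (- 1) *\<^sub>C S (ts ! j) \<in> generated_unital_algebra (?Z k)"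
        by (intro generated_unital_algebra.intros)
      then show "?X j \<in> generated_unital_algebra (?Z k)" by (simp add: bop_scaleC)
    qed (rule normalized_increment_def)
  qed
qed

lemma step_wigner_integral2_quadratic:
  assumes S: "free_brownian_motion A \<phi> S" and ts: "sorted_wrt (<) ts" and nn: "\<And>t. t \<in> set ts \<Longrightarrow> 0 \<le> t"
    and L: "off_diagonal L" "endpoints L \<subseteq> set ts"
  shows "step_wigner_integral2 S L =
    semicircular_family.quadratic (normalized_increment S ts) (length ts - 1) (kernel_matrix ts L)"
proof -
  interpret semicircular_family A \<phi> "normalized_increment S ts" "length ts - 1"
    by (rule normalized_increments_family[OF S ts nn])
  have expand: "S b - S a = (\<Sum>i<length ts - 1. complex_of_real (increment_coeff ts a b i) *\<^sub>C normalized_increment S ts i)"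
    if "a \<in> set ts" "b \<in> set ts" "a \<le> b" for a b
  proof -
    have "(\<Sum>i<length ts - 1. complex_of_real (increment_coeff ts a b i) *\<^sub>C normalized_increment S ts i) =
        (\<Sum>i<length ts - 1. if a \<le> ts ! i \<and> ts ! i < b then S (ts ! Suc i) - S (ts ! i) else 0)"
    proof (rule sum.cong[OF refl])
      fix i assume "i \<in> {..<length ts - 1}"
      then have "ts ! i < ts ! Suc i" by (intro sorted_wrt_nth_less[OF ts]) auto
      then show "complex_of_real (increment_coeff ts a b i) *\<^sub>C normalized_increment S ts i =
          (if a \<le> ts ! i \<and> ts ! i < b then S (ts ! Suc i) - S (ts ! i) else 0)"
        by (auto simp: increment_coeff_def normalized_increment_def bop_scaleC simp flip: of_real_mult)
    qed
    then show ?thesis using sum_increments[OF ts that, of S] by simp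
  qed
  show ?thesis
    using L
  proof (induction L)
    case Nil
    show ?case unfolding quadratic_def
      by (simp add: step_wigner_integral2_def kernel_matrix_def bop_scaleC)
  next
    case (Cons r L)
    obtain c a b a' b' where r: "r = (c, a, b, a', b')" by (cases r)
    have mem: "a \<in> set ts" "b \<in> set ts" "a' \<in> set ts" "b' \<in> set ts" using Cons.prems r by (auto simp: endpoints_def)
    have le: "a \<le> b" "a' \<le> b'" using Cons.prems r by (auto simp: off_diagonal_def)
    have "complex_of_real c *\<^sub>C ((S b - S a) * (S b' - S a')) =
        quadratic (\<lambda>i j. c * increment_coeff ts a b i * increment_coeff ts a' b' j)"
      unfolding expand[OF mem(1,2) le(1)] expand[OF mem(3,4) le(2)] quadratic_def
      by (simp add: sum_product bop_scaleC bop_scaleC_sum mult_ac)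
    moreover have "step_wigner_integral2 S L = quadratic (kernel_matrix ts L)"
      using Cons by (auto simp: off_diagonal_def endpoints_def)
    moreover have "step_wigner_integral2 S (r # L) =
        complex_of_real c *\<^sub>C ((S b - S a) * (S b' - S a')) + step_wigner_integral2 S L"
      by (simp add: step_wigner_integral2_def r)
    ultimately show ?case
      by (simp only: quadratic_add) (simp add: r kernel_matrix_def[abs_def])
  qed
qed

end

section \<open>Approximation of the second Wigner chaos and the tetilla law\<close>

text \<open>The approximating step kernels need not be symmetric. As \<open>f\<close> is, the
  antisymmetric part of \<open>g\<close> is that of \<open>g - f\<close>; the square of a difference
  costs a factor 2, and the swap preserves Lebesgue measure.\<close>

lemma kernel_antisymmetric_part_le:
  assumes f: "square_integrable_kernel f" "symmetric_kernel f"
    and g: "g \<in> borel_measurable borel" "set_integrable lborel quadrant (\<lambda>z. (g z)\<^sup>2)"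
  shows "(LINT z:quadrant|lborel. (g z - g (prod.swap z))\<^sup>2) \<le> 4 * (LINT z:quadrant|lborel. (f z - g z)\<^sup>2)"
proof -
  have [measurable]: "f \<in> borel_measurable borel" "g \<in> borel_measurable borel"
    using f g by (auto simp: square_integrable_kernel_def)
  define h where "h z = indicator quadrant z *\<^sub>R (f z - g z)\<^sup>2" for z :: "real \<times> real"
  have q[measurable]: "quadrant \<in> sets borel" by (intro borel_closed closed_Times) auto
  have hm[measurable]: "h \<in> borel_measurable borel" unfolding h_def by measurable
  have hint: "integrable lborel h"
  proof (rule Bochner_Integration.integrable_bound)
    show "integrable lborel (\<lambda>z. 2 * (indicator quadrant z *\<^sub>R (f z)\<^sup>2) + 2 * (indicator quadrant z *\<^sub>R (g z)\<^sup>2))"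
      using f g by (intro Bochner_Integration.integrable_add integrable_mult_right)
        (auto simp: square_integrable_kernel_def set_integrable_def)
    show "h \<in> borel_measurable lborel" by simp
    have "(f z - g z)\<^sup>2 \<le> 2 * (f z)\<^sup>2 + 2 * (g z)\<^sup>2" for z
      using zero_le_power2[of "f z + g z"] by (simp add: power2_eq_square algebra_simps)
    then show "AE z in lborel. norm (h z) \<le>
        norm (2 * (indicator quadrant z *\<^sub>R (f z)\<^sup>2) + 2 * (indicator quadrant z *\<^sub>R (g z)\<^sup>2))"
      by (intro AE_I2) (auto simp: h_def indicator_def)
  qed
  have sw: "integrable lborel (\<lambda>z. h (prod.swap z))" "(\<integral>z. h (prod.swap z) \<partial>lborel) = (\<integral>z. h z \<partial>lborel)"
  proof -
    have eq: "(\<lambda>z. h (prod.swap z)) = (\<lambda>(x, y). h (y, x))" by (auto simp: fun_eq_iff)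
    show "integrable lborel (\<lambda>z. h (prod.swap z))"
      using lborel_pair.integrable_product_swap[of h] hint unfolding eq lborel_prod by simp
    show "(\<integral>z. h (prod.swap z) \<partial>lborel) = (\<integral>z. h z \<partial>lborel)"
      using lborel_pair.integral_product_swap[of h] unfolding eq lborel_prod by simp
  qed
  have sym: "AE z in lborel. z \<in> quadrant \<longrightarrow> f z = f (prod.swap z)"
    using f(2) unfolding symmetric_kernel_def by (simp add: case_prod_unfold prod.swap_def mem_Times_iff)
  have "(LINT z:quadrant|lborel. (g z - g (prod.swap z))\<^sup>2) \<le> (\<integral>z. 2 * h z + 2 * h (prod.swap z) \<partial>lborel)"
    unfolding set_lebesgue_integral_def
  proof (rule integral_mono_AE')
    show "integrable lborel (\<lambda>z. 2 * h z + 2 * h (prod.swap z))"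
      by (intro Bochner_Integration.integrable_add integrable_mult_right hint sw)
    show "AE z in lborel. indicator quadrant z *\<^sub>R (g z - g (prod.swap z))\<^sup>2 \<le> 2 * h z + 2 * h (prod.swap z)"
      using sym
    proof eventually_elim
      case (elim z)
      show ?case
      proof (cases "z \<in> quadrant")
        case True
        then have swq: "prod.swap z \<in> quadrant" by auto
        have "(g z - g (prod.swap z))\<^sup>2 \<le> 2 * (f z - g z)\<^sup>2 + 2 * (f z - g (prod.swap z))\<^sup>2"
          using zero_le_power2[of "(f z - g z) + (f z - g (prod.swap z))"]
          by (simp add: power2_eq_square algebra_simps)
        then show ?thesis using True swq elim by (simp add: h_def)
      qed (simp add: h_def)
    qed
    show "AE z in lborel. 0 \<le> 2 * h z + 2 * h (prod.swap z)" by (simp add: h_def)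
  qed
  also have "\<dots> = 4 * (\<integral>z. h z \<partial>lborel)"
    using hint sw by simp
  finally show ?thesis by (simp add: h_def[abs_def] set_lebesgue_integral_def)
qed

context free_probability_space
begin

lemma tendsto_norm2:
  assumes "\<And>n :: nat. T n \<in> A" "(\<lambda>n. \<phi> (adj (T n) * T n)) \<longlonglongrightarrow> 0"
  shows "(\<lambda>n. norm2 (T n)) \<longlonglongrightarrow> 0"
proof -
  have "(\<lambda>n. sqrt (Re (\<phi> (adj (T n) * T n)))) \<longlonglongrightarrow> sqrt (Re 0)"
    by (intro tendsto_real_sqrt tendsto_Re assms)
  then show ?thesis by (simp add: norm2_def)
qed

text \<open>Step integrals converge in L2 only. Symmetrized and normalized they become forms with
  bounded moments, and then their moments converge as well; self-adjointness of the limit is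
  obtained on the way.\<close>

lemma eigenvalues_of_second_chaos:
  assumes S: "free_brownian_motion A \<phi> S" and F: "F \<in> second_wigner_chaos A \<phi> S" and F2: "\<phi> (F ^ 2) = 1"
  shows "F \<in> A" "self_adjoint F"
    and "\<exists>(x :: nat \<Rightarrow> nat \<Rightarrow> real) N. (\<forall>n. eigenvalues (x n) (N n)) \<and>
      (\<forall>k. (\<lambda>n. complex_of_real (free_moment (eigenvalues.\<kappa> (x n) (N n)) k)) \<longlonglongrightarrow> \<phi> (F ^ k))"
proof -
  obtain f L where f: "square_integrable_kernel f" "symmetric_kernel f" and FA: "F \<in> A"
    and L: "\<And>n. off_diagonal (L n)"
    and lim_kernel: "(\<lambda>n. LINT z:quadrant|lborel. (f z - step_kernel (L n) z)\<^sup>2) \<longlonglongrightarrow> 0"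
    and lim_int: "(\<lambda>n. \<phi> (adj (F - step_wigner_integral2 S (L n)) * (F - step_wigner_integral2 S (L n)))) \<longlonglongrightarrow> 0"
    using F unfolding second_wigner_chaos_def has_wigner_integral2_def by blast
  show "F \<in> A" by fact
  define I where "I n = step_wigner_integral2 S (L n)" for n
  define ts where "ts n = sorted_list_of_set (insert 0 (endpoints (L n)))" for n
  have fin: "finite (endpoints (L n))" for n by (auto simp: endpoints_def)
  have ts_sorted: "sorted_wrt (<) (ts n)" for n unfolding ts_def by (rule strict_sorted_list_of_set)
  have ts_set: "set (ts n) = insert 0 (endpoints (L n))" for n
    unfolding ts_def by (rule set_sorted_list_of_set) (simp add: fin)
  have ts_nn: "0 \<le> t" if "t \<in> set (ts n)" for t n
    using that L[of n] unfolding ts_set by (force simp: endpoints_def off_diagonal_def)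
  have times_L: "endpoints (L n) \<subseteq> set (ts n)" for n by (auto simp: ts_set)
  define M where "M n = length (ts n) - 1" for n
  define Y where "Y n = normalized_increment S (ts n)" for n
  define D where "D n = kernel_matrix (ts n) (L n)" for n
  have fam: "semicircular_family A \<phi> (Y n) (M n)" for n
    unfolding Y_def M_def by (rule normalized_increments_family[OF S ts_sorted ts_nn])
  note fam_lemmas = semicircular_family.quadratic_A[OF fam] semicircular_family.quadratic_transpose[OF fam]
    semicircular_family.quadratic_add[OF fam] semicircular_family.quadratic_scale[OF fam]
    semicircular_family.state_quadratic_pair[OF fam]
  define Q where "Q n = semicircular_family.quadratic (Y n) (M n)" for n
  have QA: "Q n d \<in> A" and Qadj: "adj (Q n d) = Q n (\<lambda>i j. d j i)"
    and Qadd: "Q n d + Q n e = Q n (\<lambda>i j. d i j + e i j)"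
    and Qscale: "complex_of_real r *\<^sub>C Q n d = Q n (\<lambda>i j. r * d i j)"
    and Qnorm: "(\<Sum>i<M n. d i i) = 0 \<Longrightarrow> (norm2 (Q n d))\<^sup>2 = (\<Sum>i<M n. \<Sum>j<M n. (d i j)\<^sup>2)" for n d e r
    unfolding Q_def by (rule fam_lemmas; assumption?)+
  have I: "I n = Q n (D n)" for n
    unfolding I_def Q_def D_def Y_def M_def
    by (rule step_wigner_integral2_quadratic[OF S ts_sorted ts_nn L times_L])
  have IA: "I n \<in> A" for n unfolding I by (rule QA)
  have D_trace: "(\<Sum>i<M n. D n i i) = 0" for n
    unfolding M_def D_def by (rule kernel_matrix_trace[OF ts_sorted L times_L])
  have lim1: "(\<lambda>n. norm2 (F - I n)) \<longlonglongrightarrow> 0"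
    using lim_int FA IA unfolding I_def[symmetric] by (intro tendsto_norm2 A_intros) auto
  have lim2: "(\<lambda>n. norm2 (I n - adj (I n))) \<longlonglongrightarrow> 0"
  proof -
    define e where "e n = (LINT z:quadrant|lborel. (f z - step_kernel (L n) z)\<^sup>2)" for n
    have "(norm2 (I n - adj (I n)))\<^sup>2 \<le> 4 * e n" for n
    proof -
      \<comment> \<open>The rectangles together with their negated transposes, so that the
        antisymmetric part is a step kernel on the same grid and Parseval applies to it.\<close>
      define L' where "L' = L n @ map (\<lambda>(c, a, b, a', b'). (- c, a', b', a, b)) (L n)"
      have offL': "off_diagonal L'" using L[of n] by (fastforce simp: off_diagonal_def L'_def)
      have timesL': "endpoints L' \<subseteq> set (ts n)" using times_L[of n] by (fastforce simp: endpoints_def L'_def)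
      have K: "kernel_matrix (ts n) L' i j = D n i j - D n j i" for i j
      proof -
        have "kernel_matrix (ts n) (map (\<lambda>(c, a, b, a', b'). (- c, a', b', a, b)) Z) i j = - kernel_matrix (ts n) Z j i" for Z
          by (induction Z) (auto simp: kernel_matrix_def)
        moreover have "kernel_matrix (ts n) (Z @ Z') i j = kernel_matrix (ts n) Z i j + kernel_matrix (ts n) Z' i j" for Z Z'
          by (simp add: kernel_matrix_def)
        ultimately show ?thesis by (simp add: L'_def D_def)
      qed
      have sk: "step_kernel L' z = step_kernel (L n) z - step_kernel (L n) (prod.swap z)" for z
      proof -
        obtain p q where z: "z = (p, q)" by (cases z)
        have "step_kernel (map (\<lambda>(c, a, b, a', b'). (- c, a', b', a, b)) Z) (p, q) = - step_kernel Z (q, p)" for Z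
          by (induction Z) (auto simp: step_kernel_def indicator_def)
        then show ?thesis by (simp add: L'_def step_kernel_def z)
      qed
      have "I n - adj (I n) = Q n (D n) + complex_of_real (- 1) *\<^sub>C Q n (\<lambda>i j. D n j i)"
        unfolding I Qadj by (simp add: bop_scaleC)
      also have "\<dots> = Q n (\<lambda>i j. D n i j - D n j i)" unfolding Qscale Qadd by simp
      finally have "(norm2 (I n - adj (I n)))\<^sup>2 = (\<Sum>i<M n. \<Sum>j<M n. (D n i j - D n j i)\<^sup>2)"
        by (simp add: Qnorm)
      also have "\<dots> = (LINT z:quadrant|lborel. (step_kernel L' z)\<^sup>2)"
        unfolding step_kernel_integral(1)[OF ts_sorted offL' timesL'] K M_def ..
      also have "\<dots> \<le> 4 * e n"
        unfolding sk e_def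
        by (rule kernel_antisymmetric_part_le[OF f step_kernel_integral(3,2)[OF ts_sorted L times_L]])
      finally show ?thesis .
    qed
    then have le: "norm2 (I n - adj (I n)) \<le> sqrt (4 * e n)" for n by (rule real_le_rsqrt)
    have "(\<lambda>n. sqrt (4 * e n)) \<longlonglongrightarrow> sqrt (4 * 0)"
      using lim_kernel unfolding e_def by (intro tendsto_intros)
    then have "(\<lambda>n. sqrt (4 * e n)) \<longlonglongrightarrow> 0" by simp
    then show ?thesis
      by (rule Lim_null_comparison[rotated]) (use le IA in \<open>auto simp: norm2_nonneg A_intros adj_A\<close>)
  qed
  have adjF: "norm2 (F - adj (I n)) \<le> norm2 (F - I n) + norm2 (I n - adj (I n))" for n
    using norm2_triangle[of "F - I n" "I n - adj (I n)"] FA IA by (simp add: A_intros adj_A)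
  \<comment> \<open>The step integrals are asymptotically self-adjoint, so \<open>F\<close> and its
    adjoint have L2-distance 0, and faithfulness makes them equal.\<close>
  have "norm2 (F - adj F) \<le> 2 * norm2 (F - I n) + norm2 (I n - adj (I n))" for n
  proof -
    have "norm2 (adj (I n) - adj F) = norm2 (F - I n)"
      using norm2_adj[of "I n - F"] FA IA norm2_diff_commute[of F "I n"] by (simp add: adj_diff A_intros)
    then show ?thesis
      using norm2_triangle[of "F - adj (I n)" "adj (I n) - adj F"] adjF[of n] FA IA by (simp add: A_intros adj_A)
  qed
  moreover have "(\<lambda>n. 2 * norm2 (F - I n) + norm2 (I n - adj (I n))) \<longlonglongrightarrow> 2 * 0 + 0"
    by (intro tendsto_intros lim1 lim2)
  ultimately have "norm2 (F - adj F) \<le> 2 * 0 + 0" by (intro LIMSEQ_le_const) auto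
  then have "norm2 (F - adj F) = 0" using FA norm2_nonneg[of "F - adj F"] by (simp add: A_intros adj_A)
  then have "F - adj F = 0" using FA by (intro norm2_eq_0) (auto simp: A_intros adj_A)
  then have "adj F = F" by simp
  then show Fsa: "self_adjoint F" using is_adjoint_adj[OF FA] by (simp add: self_adjoint_def)
  define c where "c n i j = (D n i j + D n j i) / 2" for n i j
  define G where "G n = Q n (c n)" for n
  have GA: "G n \<in> A" for n unfolding G_def by (rule QA)
  have Gsa: "self_adjoint (G n)" for n
  proof -
    have "(\<lambda>i j. c n j i) = c n" by (intro ext) (simp add: c_def add.commute)
    then show ?thesis using is_adjoint_adj[OF GA[of n]] unfolding G_def Qadj by (simp add: self_adjoint_def)
  qed
  have form: "quadratic_form A \<phi> (Y n) (M n) (c n)" for n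
    using fam[of n] D_trace[of n]
    by (simp add: quadratic_form_def quadratic_form_axioms_def c_def add.commute)
  define \<gamma> where "\<gamma> n = quadratic_form.\<gamma> (M n) (c n)" for n
  have Gmom: "\<phi> (G n ^ k) = complex_of_real (free_moment (\<gamma> n) k)" for n k
    unfolding G_def Q_def \<gamma>_def by (rule quadratic_form.state_power_G[OF form])
  have \<gamma>1: "\<gamma> n 1 = 0" for n unfolding \<gamma>_def by (rule quadratic_form.\<gamma>_1[OF form])
  have "\<exists>x :: nat \<Rightarrow> real. \<forall>k. \<gamma> n k = (\<Sum>i<M n. x i ^ k)" for n
    unfolding \<gamma>_def quadratic_form.\<gamma>_def[OF form]
    by (rule symmetric_kernel_eigenvalues) (simp add: c_def add.commute)
  from choice[OF allI[OF this]] obtain x :: "nat \<Rightarrow> nat \<Rightarrow> real"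
    where x: "\<forall>n k. \<gamma> n k = (\<Sum>i<M n. x n i ^ k)" by (rule exE)
  define s where "s n = \<gamma> n 2" for n
  have s_norm: "s n = (norm2 (G n))\<^sup>2" for n
  proof -
    have "free_moment (\<gamma> n) 2 = s n"
      using free_moment_rec[of "\<gamma> n" 0, OF \<gamma>1] by (simp add: s_def free_moment_0 cumulant_path_rec[of _ _ 0] numeral_2_eq_2)
    then have "Re (\<phi> (G n ^ 2)) = s n" using Gmom[of n 2] by simp
    then show ?thesis using norm2_power[OF GA Gsa, of n 1] by simp
  qed
  have lim3: "(\<lambda>n. norm2 (F - G n)) \<longlonglongrightarrow> 0"
  proof (rule Lim_null_comparison)
    show "(\<lambda>n. norm2 (F - I n) + norm2 (I n - adj (I n))) \<longlonglongrightarrow> 0"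
      using tendsto_add[OF lim1 lim2] by simp
    have "norm2 (F - G n) \<le> norm2 (F - I n) + norm2 (I n - adj (I n))" for n
    proof -
      have "G n = complex_of_real (1 / 2) *\<^sub>C (I n + adj (I n))"
        unfolding G_def I Qadj Qadd Qscale c_def by simp
      moreover have "F = complex_of_real (1 / 2) *\<^sub>C (F + F)"
        by (simp add: bop_scaleC flip: bop_scaleC_simps(3))
      ultimately have "F - G n = complex_of_real (1 / 2) *\<^sub>C ((F - I n) + (F - adj (I n)))"
        by (metis (no_types, lifting) add_diff_add bop_scaleC_simps(2))
      then have "norm2 (F - G n) = 1 / 2 * norm2 ((F - I n) + (F - adj (I n)))"
        using norm2_scale[of "(F - I n) + (F - adj (I n))" "1 / 2"] FA IA by (simp add: A_intros adj_A)
      also have "\<dots> \<le> 1 / 2 * (norm2 (F - I n) + norm2 (F - adj (I n)))"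
        using FA IA by (intro mult_left_mono norm2_triangle) (auto simp: A_intros adj_A)
      also have "\<dots> \<le> norm2 (F - I n) + norm2 (I n - adj (I n))"
        using adjF[of n] norm2_nonneg[of "I n - adj (I n)"] FA IA by (simp add: A_intros adj_A)
      finally show ?thesis .
    qed
    then show "\<forall>\<^sub>F n in sequentially. norm (norm2 (F - G n)) \<le> norm2 (F - I n) + norm2 (I n - adj (I n))"
      using FA GA by (simp add: norm2_nonneg A_intros)
  qed
  have F1: "norm2 F = 1"
    using norm2_power[OF FA Fsa, of 1] F2 norm2_nonneg[OF FA] by (simp add: power2_eq_1_iff)
  have "(\<lambda>n. norm2 (G n) - 1) \<longlonglongrightarrow> 0"
  proof (rule Lim_null_comparison[OF _ lim3])
    have "\<bar>norm2 (G n) - 1\<bar> \<le> norm2 (F - G n)" for n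
      using norm2_triangle[of "F - G n" "G n"] norm2_triangle[of "G n - F" F] F1 FA GA[of n]
        norm2_diff_commute[of F "G n"] by (simp add: A_intros)
    then show "\<forall>\<^sub>F n in sequentially. norm (norm2 (G n) - 1) \<le> norm2 (F - G n)" by simp
  qed
  then have G1: "(\<lambda>n. norm2 (G n)) \<longlonglongrightarrow> 1" by (rule LIM_zero_cancel)
  then have "\<forall>\<^sub>F n in sequentially. 1 / 2 < norm2 (G n) \<and> norm2 (G n) < 2"
    by (intro eventually_conj order_tendstoD[OF G1]) auto
  \<comment> \<open>Early forms may vanish and could not be normalized. The lower bound keeps the
    division meaningful, the upper one keeps the moments bounded.\<close>
  then obtain n0 where n0: "\<And>n. n0 \<le> n \<Longrightarrow> 1 / 2 < norm2 (G n) \<and> norm2 (G n) < 2"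
    by (auto simp: eventually_sequentially)
  define r where "r n = norm2 (G (n + n0))" for n
  have r: "1 / 2 < r n" "r n < 2" for n using n0[of "n + n0"] by (auto simp: r_def)
  have rs: "s (n + n0) = (r n)\<^sup>2" for n by (simp add: s_norm r_def)
  define y where "y n i = (1 / r n) * x (n + n0) i" for n i
  define N where "N n = M (n + n0)" for n
  have pow: "(\<Sum>i<N n. y n i ^ k) = (1 / r n) ^ k * \<gamma> (n + n0) k" for n k
    unfolding y_def power_mult_distrib N_def x[rule_format] sum_distrib_left ..
  have ev: "eigenvalues (y n) (N n)" for n
  proof
    show "(\<Sum>i<N n. y n i) = 0" using pow[of n 1] \<gamma>1 by simp
    show "(\<Sum>i<N n. (y n i)\<^sup>2) = 1"
      using pow[of n 2] rs[of n] r[of n] by (simp add: s_def power_one_over)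
  qed
  have \<kappa>: "eigenvalues.\<kappa> (y n) (N n) = (\<lambda>k. (1 / r n) ^ k * \<gamma> (n + n0) k)" for n
    unfolding eigenvalues.\<kappa>_def[OF ev] pow ..
  have fm: "free_moment (eigenvalues.\<kappa> (y n) (N n)) k = (1 / r n) ^ k * free_moment (\<gamma> (n + n0)) k" for n k
    unfolding \<kappa> using cumulant_path_scale[of 1 "1 / r n" "\<gamma> (n + n0)" k] by blast
  have "(\<lambda>n. \<phi> (G (n + n0) ^ k)) \<longlonglongrightarrow> \<phi> (F ^ k)" for k
  proof (rule state_power_tendsto[OF FA Fsa GA Gsa])
    show "(\<lambda>n. norm2 (F - G (n + n0))) \<longlonglongrightarrow> 0" by (rule LIMSEQ_ignore_initial_segment[OF lim3])
    fix k
    \<comment> \<open>The required bound uniform in \<open>n\<close> combines \<open>r n < 2\<close>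
      with the Catalan growth for the normalized form.\<close>
    have "cmod (\<phi> (G (n + n0) ^ k)) \<le> 2 ^ k * (2 * 4 ^ k)" for n
    proof -
      have "\<bar>free_moment (eigenvalues.\<kappa> (y n) (N n)) k\<bar> \<le> 2 * 4 ^ k"
        by (rule free_moment_bound[OF eigenvalues.abs_\<kappa>_le_1[OF ev]])
      moreover have "free_moment (\<gamma> (n + n0)) k = r n ^ k * free_moment (eigenvalues.\<kappa> (y n) (N n)) k"
        using r[of n] by (simp add: fm power_one_over)
      moreover have "r n ^ k \<le> 2 ^ k" "0 \<le> r n ^ k" using r[of n] by (auto intro: power_mono)
      ultimately show ?thesis
        unfolding Gmom norm_of_real abs_mult by (simp add: abs_mult mult_mono)
    qed
    then show "\<exists>B. \<forall>n. cmod (\<phi> (G (n + n0) ^ k)) \<le> B" by blast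
  qed
  moreover have "(\<lambda>n. complex_of_real ((1 / r n) ^ k)) \<longlonglongrightarrow> complex_of_real ((1 / 1) ^ k)" for k
    using LIMSEQ_ignore_initial_segment[OF G1, of n0] unfolding r_def[symmetric] by (intro tendsto_intros) auto
  ultimately have "(\<lambda>n. complex_of_real ((1 / r n) ^ k) * \<phi> (G (n + n0) ^ k)) \<longlonglongrightarrow> complex_of_real ((1 / 1) ^ k) * \<phi> (F ^ k)" for k
    by (intro tendsto_mult)
  then have "\<forall>k. (\<lambda>n. complex_of_real (free_moment (eigenvalues.\<kappa> (y n) (N n)) k)) \<longlonglongrightarrow> \<phi> (F ^ k)"
    unfolding fm Gmom of_real_mult by simp
  with ev show "\<exists>(x :: nat \<Rightarrow> nat \<Rightarrow> real) N. (\<forall>n. eigenvalues (x n) (N n)) \<and>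
      (\<forall>k. (\<lambda>n. complex_of_real (free_moment (eigenvalues.\<kappa> (x n) (N n)) k)) \<longlonglongrightarrow> \<phi> (F ^ k))"
    by (intro exI[of _ y] exI[of _ N] conjI allI) auto
qed

end

text \<open>The form of the symmetric 2 by 2 matrix with zero diagonal and entries
  \<open>1 / sqrt 2\<close>, whose eigenvalues are \<open>1 / sqrt 2\<close> and
  \<open>- 1 / sqrt 2\<close>.\<close>

lemma (in free_probability_space) state_power_tetilla:
  assumes S: "S1 \<in> A" "S2 \<in> A" "semicircular \<phi> 1 S1" "semicircular \<phi> 1 S2"
    and free: "freely_independent \<phi> {S1} {S2}"
  defines "T \<equiv> complex_of_real (1 / sqrt 2) *\<^sub>C (S1 * S2 + S2 * S1)"
  shows "T \<in> A" "self_adjoint T" "\<phi> (T ^ k) = complex_of_real (free_moment tetilla_cumulant k)"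
proof -
  define X where "X i = (if i = 0 then S2 else S1)" for i :: nat
  have sa: "self_adjoint S1" "self_adjoint S2" using S by (auto simp: semicircular_def)
  \<comment> \<open>Freeness is symmetric, by negating the boolean index; the first letter needs it
    with the roles of \<open>S1\<close> and \<open>S2\<close> exchanged.\<close>
  have U2: "free_algebras \<phi> (UNIV :: bool set) B' \<longleftrightarrow> free_algebras \<phi> (UNIV :: bool set) (B' \<circ> Not)" for B' :: "bool \<Rightarrow> 'h bop set"
  proof -
    have imp: "free_algebras \<phi> (UNIV :: bool set) (C' \<circ> Not)" if "free_algebras \<phi> (UNIV :: bool set) C'" for C' :: "bool \<Rightarrow> 'h bop set"
      unfolding free_algebras_def
    proof (intro allI impI)
      fix w :: "(bool \<times> 'h bop) list"
      assume w: "w \<noteq> [] \<and> (\<forall>(i, a)\<in>set w. i \<in> UNIV \<and> a \<in> (C' \<circ> Not) i \<and> \<phi> a = 0) \<and> distinct_adj (map fst w)"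
      define v where "v = map (\<lambda>(i, a). (\<not> i, a)) w"
      have "\<phi> (prod_list (map snd v)) = 0"
      proof (rule that[unfolded free_algebras_def, rule_format], intro conjI)
        show "v \<noteq> []" "\<forall>(i, a)\<in>set v. i \<in> UNIV \<and> a \<in> C' i \<and> \<phi> a = 0" using w by (auto simp: v_def)
        have e: "map fst v = map Not (map fst w)" by (auto simp: v_def)
        show "distinct_adj (map fst v)" unfolding e by (rule distinct_adj_mapI) (use w in \<open>auto simp: inj_on_def\<close>)
      qed
      moreover have "map snd v = map snd w" by (auto simp: v_def)
      ultimately show "\<phi> (prod_list (map snd w)) = 0" by simp
    qed
    have "B' \<circ> Not \<circ> Not = B'" by (auto simp: fun_eq_iff)
    then show ?thesis using imp[of B'] imp[of "B' \<circ> Not"] by auto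
  qed
  have fam: "semicircular_family A \<phi> X 2"
  proof unfold_locales
    show "X i \<in> A" "self_adjoint (X i)" for i using S sa by (auto simp: X_def)
    fix i :: nat and w :: "nat list" assume "i < 2" "set w \<subseteq> {..<2}"
    then show "\<phi> (X i * prod_list (map X w)) =
        split_sum i w (\<lambda>a b. \<phi> (prod_list (map X a)) * \<phi> (prod_list (map X b)))"
    proof (rule Schwinger_Dyson_of_free[where X=X and v="\<lambda>_. 1" and N=2
          and Z="\<lambda>i. if i = 0 then {S1} else {S2}", rotated -2])
      fix i :: nat assume "i < 2"
      then have i: "i = 0 \<or> i = 1" by auto
      show "X i \<in> A" "semicircular \<phi> 1 (X i)" "(if i = 0 then {S1} else {S2}) \<subseteq> A"
        using S by (auto simp: X_def)
      have "free_algebras \<phi> UNIV (\<lambda>b. generated_unital_algebra (if b then {S2} else {S1}))"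
      proof -
        have "(\<lambda>b. generated_unital_algebra (if b then {S1} else {S2})) \<circ> Not =
            (\<lambda>b. generated_unital_algebra (if b then {S2} else {S1}))" by (rule ext) simp
        then show ?thesis using free U2 unfolding freely_independent_def by metis
      qed
      then show "freely_independent \<phi> {X i} (if i = 0 then {S1} else {S2})"
        using i free by (auto simp: freely_independent_def X_def)
    next
      fix i j :: nat assume "j < i" "i < 2"
      then show "X j \<in> generated_unital_algebra (if i = 0 then {S1} else {S2})"
        by (auto simp: X_def intro: generated_unital_algebra.intros)
    qed (simp_all add: bop_scaleC)
  qed
  define c :: "nat \<Rightarrow> nat \<Rightarrow> real" where "c i j = (if i = j then 0 else 1 / sqrt 2)" for i j
  interpret quadratic_form A \<phi> X 2 c
  proof -
    show "quadratic_form A \<phi> X 2 c"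
      using fam by (simp add: quadratic_form_def quadratic_form_axioms_def c_def)
  qed
  have TG: "T = G"
    unfolding T_def quadratic_def by (simp add: numeral_2_eq_2 c_def X_def bop_scaleC add.commute)
  show "T \<in> A" unfolding TG by (rule quadratic_A)
  show "self_adjoint T"
    unfolding T_def using is_adjoint_times[of S1 S1 S2 S2] is_adjoint_times[of S2 S2 S1 S1] sa
      is_adjoint_add[of "S1 * S2" "S2 * S1" "S2 * S1" "S1 * S2"]
    by (intro self_adjoint_of_real) (simp add: self_adjoint_def add.commute)
  \<comment> \<open>Each further factor switches between diagonal and off-diagonal position, so
    parity decides which entries survive.\<close>
  have kp: "kernel_power c 2 k i j = (if even (k + i + j) then (1 / sqrt 2) ^ k else 0)" if "i < 2" "j < 2" for k i j
    using that
  proof (induction k arbitrary: j)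
    case 0
    then show ?case by (cases i; cases j) auto
  next
    case (Suc k)
    have j: "j = 0 \<or> j = 1" using Suc.prems by auto
    have 01: "kernel_power c 2 k i 0 = (if even (k + i) then (1 / sqrt 2) ^ k else 0)"
      "kernel_power c 2 k i (Suc 0) = (if even (k + i + 1) then (1 / sqrt 2) ^ k else 0)"
      using Suc.IH[of 0] Suc.IH[of 1] Suc.prems by auto
    have sum2: "(\<Sum>l<2. g l) = g 0 + g (Suc 0)" for g :: "nat \<Rightarrow> real" by (simp add: numeral_2_eq_2)
    have c: "c 0 0 = 0" "c 0 (Suc 0) = 1 / sqrt 2" "c (Suc 0) 0 = 1 / sqrt 2" "c (Suc 0) (Suc 0) = 0"
      by (simp_all add: c_def)
    show ?case using j by (auto simp: sum2 c 01)
  qed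
  have \<gamma>: "\<gamma> k = tetilla_cumulant k" for k
  proof -
    have "\<gamma> k = kernel_power c 2 k 0 0 + kernel_power c 2 k 1 1"
      unfolding quadratic_form.\<gamma>_def[OF quadratic_form_axioms] by (simp add: numeral_2_eq_2)
    also have "\<dots> = (if even k then 2 * (1 / sqrt 2) ^ k else 0)" by (simp add: kp)
    also have "\<dots> = tetilla_cumulant k"
      by (auto simp: tetilla_cumulant_def power_mult power_divide elim!: evenE)
    finally show ?thesis .
  qed
  then have "\<gamma> = tetilla_cumulant" by (rule ext)
  then show "\<phi> (T ^ k) = complex_of_real (free_moment tetilla_cumulant k)"
    using state_power_G[of k] by (simp add: TG)
qed

section \<open>Equivalence of the three kinds of convergence\<close>

theorem theorem1p4:
  fixes A :: "'h :: complex_hilbert_space bop set" and \<phi> :: "'h bop \<Rightarrow> complex"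
    and S :: "real \<Rightarrow> 'h bop"
    and F :: "nat \<Rightarrow> 'h bop"
    and B :: "'k :: complex_hilbert_space bop set" and \<psi> :: "'k bop \<Rightarrow> complex"
    and S1 S2 :: "'k bop"
    and C :: "'l :: complex_hilbert_space bop set" and \<tau> :: "'l bop \<Rightarrow> complex"
    and Finf :: "'l bop"
  assumes "free_probability_space A \<phi>"
    and "free_brownian_motion A \<phi> S"
    and "\<And>n. n \<ge> 1 \<Longrightarrow> F n \<in> second_wigner_chaos A \<phi> S"
    and "\<And>n. n \<ge> 1 \<Longrightarrow> \<phi> (F n ^ 2) = 1"
    and "free_probability_space B \<psi>"
    and "S1 \<in> B" and "S2 \<in> B"
    and "semicircular \<psi> 1 S1" and "semicircular \<psi> 1 S2"
    and "freely_independent \<psi> {S1} {S2}"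
    and "free_probability_space C \<tau>"
    and "Finf \<in> C" and "self_adjoint Finf"
    and "nc_law \<tau> Finf = nc_law \<psi> (complex_of_real (1 / sqrt 2) *\<^sub>C (S1 * S2 + S2 * S1))"
  shows "((\<lambda>n. wasserstein2 (nc_law \<phi> (F n)) (nc_law \<tau> Finf)) \<longlonglongrightarrow> 0
            \<longleftrightarrow> weak_conv_m (\<lambda>n. nc_law \<phi> (F n)) (nc_law \<tau> Finf))
       \<and> (weak_conv_m (\<lambda>n. nc_law \<phi> (F n)) (nc_law \<tau> Finf)
            \<longleftrightarrow> (\<lambda>n. \<phi> (F n ^ 4)) \<longlonglongrightarrow> 5 / 2 \<and>
                (\<exists>r\<ge>3. (\<lambda>n. \<phi> (F n ^ (2 * r))) \<longlonglongrightarrow> \<tau> (Finf ^ (2 * r))))"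
proof -
  interpret A: free_probability_space A \<phi> by fact
  interpret B: free_probability_space B \<psi> by fact
  interpret C: free_probability_space C \<tau> by fact
  define Q where "Q = nc_law \<tau> Finf"
  \<comment> \<open>The hypotheses start at index 1, hence the shift; the three assertions are
    limits and do not change.\<close>
  define P where "P n = nc_law \<phi> (F (Suc n))" for n
  define m where "m = free_moment tetilla_cumulant"
  \<comment> \<open>Moments bounded by \<open>2 * 4 ^ k\<close>, as \<open>free_moment_bound\<close>
    gives, put all laws on the interval from -4 to 4.\<close>
  have four: "(4 :: real) > 0" by simp
  note T = B.state_power_tetilla[OF assms(6-10)]
  have Q\<psi>: "has_nc_law \<psi> (complex_of_real (1 / sqrt 2) *\<^sub>C (S1 * S2 + S2 * S1)) Q"
    unfolding Q_def assms(14) by (rule B.has_nc_law_nc_law[OF T(1,2)])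
  have Q\<tau>: "has_nc_law \<tau> Finf Q"
    unfolding Q_def by (rule C.has_nc_law_nc_law[OF assms(12,13)])
  have Qm: "(\<integral>x. x ^ k \<partial>Q) = m k" for k
  proof -
    have "complex_of_real (m k) = complex_of_real (\<integral>x. x ^ k \<partial>Q)"
      using Q\<psi> T(3)[of k] unfolding has_nc_law_def m_def by metis
    then show ?thesis by simp
  qed
  have Finf_m: "\<tau> (Finf ^ k) = complex_of_real (m k)" for k
    using Q\<tau> Qm unfolding has_nc_law_def by metis
  have m_bound: "\<bar>m k\<bar> \<le> 2 * 4 ^ k" for k
    unfolding m_def using tetilla_cumulant_bounds by (intro free_moment_bound) auto
  have Q: "real_distribution Q" "AE x in Q. \<bar>x\<bar> \<le> 4"
    by (rule C.has_nc_law_AE_bounded[OF Q\<tau> four, of 2]; simp add: Finf_m m_bound)+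
  have chaos: "F (Suc n) \<in> A" "self_adjoint (F (Suc n))"
    "\<exists>(x :: nat \<Rightarrow> nat \<Rightarrow> real) N. (\<forall>n. eigenvalues (x n) (N n)) \<and>
      (\<forall>k. (\<lambda>j. complex_of_real (free_moment (eigenvalues.\<kappa> (x j) (N j)) k)) \<longlonglongrightarrow> \<phi> (F (Suc n) ^ k))" for n
    using A.eigenvalues_of_second_chaos[OF assms(2) assms(3)[of "Suc n"] assms(4)[of "Suc n"]] by auto
  have P\<phi>: "has_nc_law \<phi> (F (Suc n)) (P n)" for n
    unfolding P_def by (rule A.has_nc_law_nc_law[OF chaos(1,2)])
  have ev_bound: "cmod (complex_of_real (free_moment (eigenvalues.\<kappa> x N) k)) \<le> 2 * 4 ^ k" if "eigenvalues x N" for x N k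
    unfolding norm_of_real by (rule free_moment_bound[OF eigenvalues.abs_\<kappa>_le_1[OF that]])
  have F_bound: "cmod (\<phi> (F (Suc n) ^ k)) \<le> 2 * 4 ^ k" for n k
  proof -
    obtain x :: "nat \<Rightarrow> nat \<Rightarrow> real" and N where x: "\<forall>n. eigenvalues (x n) (N n)"
      and lim: "\<forall>k. (\<lambda>j. complex_of_real (free_moment (eigenvalues.\<kappa> (x j) (N j)) k)) \<longlonglongrightarrow> \<phi> (F (Suc n) ^ k)"
      using chaos(3) by blast
    have "(\<lambda>j. cmod (complex_of_real (free_moment (eigenvalues.\<kappa> (x j) (N j)) k))) \<longlonglongrightarrow> cmod (\<phi> (F (Suc n) ^ k))"
      by (intro tendsto_norm lim[rule_format])
    then show ?thesis by (rule LIMSEQ_le_const2) (use ev_bound x in blast)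
  qed
  have P: "real_distribution (P n)" "AE x in P n. \<bar>x\<bar> \<le> 4" for n
    by (rule A.has_nc_law_AE_bounded[OF P\<phi> four F_bound])+
  have Pm: "\<phi> (F (Suc n) ^ k) = complex_of_real (\<integral>x. x ^ k \<partial>P n)" for n k
    using P\<phi>[of n] by (simp add: has_nc_law_def)
  have shift_W: "((\<lambda>n. wasserstein2 (nc_law \<phi> (F n)) (nc_law \<tau> Finf)) \<longlonglongrightarrow> 0) \<longleftrightarrow> (\<lambda>n. wasserstein2 (P n) Q) \<longlonglongrightarrow> 0"
    unfolding P_def Q_def
    using filterlim_sequentially_Suc[of "\<lambda>n. wasserstein2 (nc_law \<phi> (F n)) (nc_law \<tau> Finf)" "nhds 0"] by simp
  have shift_weak: "weak_conv_m (\<lambda>n. nc_law \<phi> (F n)) (nc_law \<tau> Finf) \<longleftrightarrow> weak_conv_m P Q"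
  proof -
    have "((\<lambda>n. cdf (nc_law \<phi> (F n)) x) \<longlonglongrightarrow> l) \<longleftrightarrow> (\<lambda>n. cdf (nc_law \<phi> (F (Suc n))) x) \<longlonglongrightarrow> l" for x l
      using filterlim_sequentially_Suc[of "\<lambda>n. cdf (nc_law \<phi> (F n)) x" "nhds l"] by simp
    then show ?thesis unfolding weak_conv_m_def weak_conv_def P_def Q_def by blast
  qed
  have shift_m: "((\<lambda>n. \<phi> (F n ^ k)) \<longlonglongrightarrow> complex_of_real l) \<longleftrightarrow> (\<lambda>n. \<integral>x. x ^ k \<partial>P n) \<longlonglongrightarrow> l" for k l
    using filterlim_sequentially_Suc[of "\<lambda>n. \<phi> (F n ^ k)" "nhds (complex_of_real l)"]
    by (simp add: Pm tendsto_of_real_iff)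
  have m4: "m 4 = 5 / 2"
    using free_moment_small(4)[of tetilla_cumulant] tetilla_cumulant_simps by (simp add: m_def)
  have I_II: "(\<lambda>n. wasserstein2 (P n) Q) \<longlonglongrightarrow> 0 \<longleftrightarrow> weak_conv_m P Q"
    using weak_conv_m_of_wasserstein2[of P 4 Q, OF P Q] wasserstein2_of_weak_conv_m[of P 4 Q, OF P Q] by blast
  have II_moments: "weak_conv_m P Q \<Longrightarrow> (\<lambda>n. \<integral>x. x ^ k \<partial>P n) \<longlonglongrightarrow> m k" for k
    using moments_of_weak_conv_m[of P 4 Q, OF P Q _ less_imp_le[OF four], of k] by (simp add: Qm)
  have III_II: "weak_conv_m P Q"
    if lim4: "(\<lambda>n. \<integral>x. x ^ 4 \<partial>P n) \<longlonglongrightarrow> 5 / 2" and limr: "(\<lambda>n. \<integral>x. x ^ (2 * r) \<partial>P n) \<longlonglongrightarrow> m (2 * r)" and r: "3 \<le> r" for r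
  proof (rule weak_conv_m_of_moments[of P 4 Q, OF P Q])
    \<comment> \<open>Diagonal choice: each law is a limit of forms, and a single form is picked
      whose moments up to order \<open>n\<close> differ from those of \<open>P n\<close> by less
      than \<open>1 / Suc n\<close>. Any fixed moment is controlled from \<open>n = k\<close>
      on.\<close>
    have "\<exists>(y :: nat \<Rightarrow> real) K. eigenvalues y K \<and>
        (\<forall>k\<le>n. \<bar>free_moment (eigenvalues.\<kappa> y K) k - (\<integral>x. x ^ k \<partial>P n)\<bar> < 1 / real (Suc n))" for n
    proof -
      obtain x :: "nat \<Rightarrow> nat \<Rightarrow> real" and N where x: "\<forall>n. eigenvalues (x n) (N n)"
        and lim: "\<forall>k. (\<lambda>j. complex_of_real (free_moment (eigenvalues.\<kappa> (x j) (N j)) k)) \<longlonglongrightarrow> \<phi> (F (Suc n) ^ k)"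
        using chaos(3) by blast
      have "(\<lambda>j. free_moment (eigenvalues.\<kappa> (x j) (N j)) k) \<longlonglongrightarrow> (\<integral>x. x ^ k \<partial>P n)" for k
        using lim[rule_format, of k] by (simp add: Pm tendsto_of_real_iff)
      then have "\<forall>\<^sub>F j in sequentially. \<bar>free_moment (eigenvalues.\<kappa> (x j) (N j)) k - (\<integral>x. x ^ k \<partial>P n)\<bar> < 1 / real (Suc n)" for k
        using tendstoD[of _ "\<integral>x. x ^ k \<partial>P n" sequentially "1 / real (Suc n)"] by (simp add: dist_real_def)
      then have "\<forall>\<^sub>F j in sequentially. \<forall>k\<in>{..n}. \<bar>free_moment (eigenvalues.\<kappa> (x j) (N j)) k - (\<integral>x. x ^ k \<partial>P n)\<bar> < 1 / real (Suc n)"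
        by (intro eventually_ball_finite) auto
      then obtain j where "\<forall>k\<in>{..n}. \<bar>free_moment (eigenvalues.\<kappa> (x j) (N j)) k - (\<integral>x. x ^ k \<partial>P n)\<bar> < 1 / real (Suc n)"
        using eventually_happens'[OF sequentially_bot] by blast
      then show ?thesis using x by (intro exI[of _ "x j"] exI[of _ "N j"]) auto
    qed
    then have "\<forall>n. \<exists>z :: (nat \<Rightarrow> real) \<times> nat. eigenvalues (fst z) (snd z) \<and>
        (\<forall>k\<le>n. \<bar>free_moment (eigenvalues.\<kappa> (fst z) (snd z)) k - (\<integral>x. x ^ k \<partial>P n)\<bar> < 1 / real (Suc n))"
      by simp
    from choice[OF this] obtain z :: "nat \<Rightarrow> (nat \<Rightarrow> real) \<times> nat"
      where z: "\<forall>n. eigenvalues (fst (z n)) (snd (z n)) \<and>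
        (\<forall>k\<le>n. \<bar>free_moment (eigenvalues.\<kappa> (fst (z n)) (snd (z n))) k - (\<integral>x. x ^ k \<partial>P n)\<bar> < 1 / real (Suc n))"
      by (rule exE)
    define fm where "fm n k = free_moment (eigenvalues.\<kappa> (fst (z n)) (snd (z n))) k" for n k
    have diff: "(\<lambda>n. fm n k - (\<integral>x. x ^ k \<partial>P n)) \<longlonglongrightarrow> 0" for k
    proof (rule Lim_null_comparison)
      show "(\<lambda>n. 1 / real (Suc n)) \<longlonglongrightarrow> 0" by (rule LIMSEQ_Suc[OF lim_const_over_n])
      have "\<bar>fm n k - (\<integral>x. x ^ k \<partial>P n)\<bar> \<le> 1 / real (Suc n)" if "k \<le> n" for n
        using z[rule_format, of n] that unfolding fm_def by (meson less_imp_le)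
      then show "\<forall>\<^sub>F n in sequentially. norm (fm n k - (\<integral>x. x ^ k \<partial>P n)) \<le> 1 / real (Suc n)"
        by (intro eventually_sequentiallyI[of k]) simp
    qed
    have transfer: "(\<lambda>n. fm n k) \<longlonglongrightarrow> l \<longleftrightarrow> (\<lambda>n. \<integral>x. x ^ k \<partial>P n) \<longlonglongrightarrow> l" for k l
      using tendsto_diff[of "\<lambda>n. fm n k" l _ _ 0, OF _ diff[of k]] tendsto_add[of _ l _ _ 0, OF _ diff[of k]] by force
    fix k
    have "(\<lambda>n. fm n k) \<longlonglongrightarrow> m k"
      unfolding fm_def m_def
    proof (rule eigenvalues_moments_tendsto[OF _ _ _ r])
      show "eigenvalues (fst (z n)) (snd (z n))" for n using z by blast
      show "(\<lambda>n. free_moment (eigenvalues.\<kappa> (fst (z n)) (snd (z n))) 4) \<longlonglongrightarrow> 5 / 2"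
        using transfer[of 4 "5 / 2"] lim4 by (simp add: fm_def)
      show "(\<lambda>n. free_moment (eigenvalues.\<kappa> (fst (z n)) (snd (z n))) (2 * r)) \<longlonglongrightarrow> free_moment tetilla_cumulant (2 * r)"
        using transfer[of "2 * r" "m (2 * r)"] limr by (simp add: fm_def m_def)
    qed
    then show "(\<lambda>n. \<integral>x. x ^ k \<partial>P n) \<longlonglongrightarrow> (\<integral>x. x ^ k \<partial>Q)" by (simp add: transfer Qm)
  qed
  have lim4_iff: "(\<lambda>n. \<phi> (F n ^ 4)) \<longlonglongrightarrow> 5 / 2 \<longleftrightarrow> (\<lambda>n. \<integral>x. x ^ 4 \<partial>P n) \<longlonglongrightarrow> 5 / 2"
    using shift_m[of 4 "5 / 2"] by simp
  have limr_iff: "(\<lambda>n. \<phi> (F n ^ (2 * r))) \<longlonglongrightarrow> \<tau> (Finf ^ (2 * r)) \<longleftrightarrow> (\<lambda>n. \<integral>x. x ^ (2 * r) \<partial>P n) \<longlonglongrightarrow> m (2 * r)" for r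
    unfolding Finf_m by (rule shift_m)
  \<comment> \<open>Weak convergence gives all moments, so the witness \<open>r = 3\<close> serves
    for the existential.\<close>
  have "weak_conv_m P Q \<longleftrightarrow> (\<lambda>n. \<integral>x. x ^ 4 \<partial>P n) \<longlonglongrightarrow> 5 / 2 \<and>
      (\<exists>r\<ge>3. (\<lambda>n. \<integral>x. x ^ (2 * r) \<partial>P n) \<longlonglongrightarrow> m (2 * r))"
    using III_II II_moments[of 4] II_moments[of "2 * 3"] unfolding m4 by blast
  then show ?thesis unfolding shift_W shift_weak I_II lim4_iff limr_iff by blast
qed

end
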